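(* Let $\omega>2$. For every fixed $t>0$, the random field $x\mapsto u_\varepsilon(t,x)$ is intermittent as $\varepsilon\to0$ with scale function $A(\varepsilon)=\varepsilon^{-\omega}$ and Lyapunov exponents $$\ell_p=\lim_{\varepsilon\to0}\frac{\log\langle u_\varepsilon(t,x)^p\rangle}{\varepsilon^{-\omega}}=\frac{p^2t^2\gamma_1(0)}{2},\qquad p>0.$$
   Context: Fix $d\in\mathbb N$, $\kappa>0$, $\sigma>0$. The noise $\xi$ is a centered Gaussian process indexed by $C_0^\infty(\mathbb R^d)$ with covariance $\langle\xi(f)\xi(g)\rangle=\iint f(x)\gamma(x-y)g(y)\,dx\,dy$, where $\langle\cdot\rangle$ denotes expectation with respect to $\xi$ and $\gamma$ is one of: (White) $\gamma=\sigma^2\delta_0$; (Riesz) $\gamma(x)=\sigma^2|x|^{-\omega}$ with $0<\omega<d$; (Fractional) $\gamma(x)=\sigma^2\prod_{i=1}^d|x_i|^{-\omega_i}$ with $\omega_i\in(0,1)$. The scaling exponent $\omega$ is $d$ for white noise, the exponent $\omega$ for Riesz noise, and $\sum_{i=1}^d\omega_i$ for fractional noise. For $\varepsilon>0$ let $p_\varepsilon(x)=(2\pi\varepsilon^2)^{-d/2}e^{-|x|^2/2\varepsilon^2}$, $\gamma_\varepsilon=\gamma*p_\varepsilon$, and $\xi_\varepsilon=\xi*p_{\varepsilon/\sqrt2}$, a centered stationary smooth Gaussian process with covariance $\gamma_\varepsilon(x-y)$. Let $u_\varepsilon(t,x)=\mathbb E_x[\exp(\int_0^t\xi_\varepsilon(W_s)\,ds)]$,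 with $W$ a Brownian motion with generator $\kappa\Delta$ started at $x$ and independent of $\xi$; it solves $\partial_tu_\varepsilon=(\kappa\Delta+\xi_\varepsilon)u_\varepsilon$, $u_\varepsilon(0,\cdot)=1$. Intermittency with scale function $A$ means: the Lyapunov exponents $\ell_p=\lim\log\langle u^p\rangle/A$ exist and are finite for some values of $p>0$, and there is a subset of $(0,\infty)$ containing at least two points on which $p\mapsto\ell_p/p$ is strictly increasing. (By stationarity, $\ell_p$ does not depend on $x\in\mathbb R^d$.) *)

theory Defs
  imports "HOL-Probability.Probability"
begin

text \<open>The space dimension is \<open>d = CARD('n)\<close>; space is \<^typ>\<open>real ^ 'n\<close>.\<close>

datatype 'n noise = White | Riesz real | Fractional "'n \<Rightarrow> real"

fun admissible :: "'n::finite noise \<Rightarrow> bool" where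
  "admissible White \<longleftrightarrow> True"
| "admissible (Riesz w) \<longleftrightarrow> 0 < w \<and> w < real CARD('n)"
| "admissible (Fractional w) \<longleftrightarrow> (\<forall>i. 0 < w i \<and> w i < 1)"

fun scaling_exponent :: "'n::finite noise \<Rightarrow> real" where
  "scaling_exponent (White :: 'n noise) = real CARD('n)"
| "scaling_exponent (Riesz w) = w"
| "scaling_exponent (Fractional w) = (\<Sum>i\<in>UNIV. w i)"

text \<open>Since \<open>\<sigma>\<^sup>2 \<delta>\<^sub>0\<close> is not a function, \<open>\<gamma>\<close> is represented as a measure: for Riesz and
  fractional noise it is the measure with the given Lebesgue density (the value of the density
  on the null set where some base vanishes is irrelevant).\<close>

fun noise_kernel :: "real \<Rightarrow> 'n::finite noise \<Rightarrow> (real ^ 'n) measure" where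
  "noise_kernel \<sigma> White = scale_measure (ennreal (\<sigma>\<^sup>2)) (return borel 0)"
| "noise_kernel \<sigma> (Riesz w) = density lborel (\<lambda>x. ennreal (\<sigma>\<^sup>2 * norm x powr (- w)))"
| "noise_kernel \<sigma> (Fractional w) =
     density lborel (\<lambda>x. ennreal (\<sigma>\<^sup>2 * (\<Prod>i\<in>UNIV. \<bar>x $ i\<bar> powr (- w i))))"

text \<open>\<open>\<integral>\<integral> f(x) \<gamma>(x - y) g(y) dx dy\<close>, with the substitution \<open>z = x - y\<close> so that it makes sense
  for a measure \<open>\<gamma>(dz)\<close>.\<close>

definition kernel_form ::
  "(real ^ 'n::finite) measure \<Rightarrow> (real ^ 'n \<Rightarrow> real) \<Rightarrow> (real ^ 'n \<Rightarrow> real) \<Rightarrow> real" where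
  "kernel_form \<gamma> f g = (LINT x|lborel. LINT z|\<gamma>. f x * g (x - z))"

definition gauss :: "real \<Rightarrow> real ^ 'n::finite \<Rightarrow> real" where
  "gauss \<epsilon> x = (2 * pi * \<epsilon>\<^sup>2) powr (- real CARD('n) / 2) * exp (- (norm x)\<^sup>2 / (2 * \<epsilon>\<^sup>2))"

definition mollified_kernel :: "(real ^ 'n::finite) measure \<Rightarrow> real \<Rightarrow> real ^ 'n \<Rightarrow> real" where
  "mollified_kernel \<gamma> \<epsilon> x = (LINT z|\<gamma>. gauss \<epsilon> (x - z))"

text \<open>\<open>C\<^sup>k\<close> on the whole space, by recursion over directional derivatives.\<close>

fun C_k :: "nat \<Rightarrow> ('v::real_normed_vector \<Rightarrow> real) \<Rightarrow> bool" where
  "C_k 0 f \<longleftrightarrow> continuous_on UNIV f"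
| "C_k (Suc k) f \<longleftrightarrow>
     (\<forall>x. f differentiable (at x)) \<and> (\<forall>v. C_k k (\<lambda>x. frechet_derivative f (at x) v))"

definition smooth :: "('v::real_normed_vector \<Rightarrow> real) \<Rightarrow> bool" where
  "smooth f \<longleftrightarrow> (\<forall>k. C_k k f)"

definition test_functions :: "('v::real_normed_vector \<Rightarrow> real) set" where
  "test_functions = {f. smooth f \<and> compact (closure {x. f x \<noteq> 0})}"

text \<open>Degenerate normal variables are allowed.\<close>

definition centered_normal :: "'a measure \<Rightarrow> ('a \<Rightarrow> real) \<Rightarrow> bool" where
  "centered_normal M Y \<longleftrightarrow> Y \<in> borel_measurable M \<and>
     ((AE w in M. Y w = 0) \<or> (\<exists>s>0. distributed M lborel Y (normal_density 0 s)))"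

definition centered_gaussian_process ::
  "'a measure \<Rightarrow> 'i set \<Rightarrow> ('i \<Rightarrow> 'a \<Rightarrow> real) \<Rightarrow> bool" where
  "centered_gaussian_process M T X \<longleftrightarrow> prob_space M \<and>
     (\<forall>S c. finite S \<and> S \<subseteq> T \<longrightarrow> centered_normal M (\<lambda>w. \<Sum>i\<in>S. c i * X i w))"

definition gaussian_noise ::
  "'a measure \<Rightarrow> (real ^ 'n::finite) measure \<Rightarrow> ((real ^ 'n \<Rightarrow> real) \<Rightarrow> 'a \<Rightarrow> real) \<Rightarrow> bool" where
  "gaussian_noise M \<gamma> \<xi> \<longleftrightarrow> centered_gaussian_process M test_functions \<xi> \<and>
     (\<forall>f\<in>test_functions. \<forall>g\<in>test_functions. (LINT w|M. \<xi> f w * \<xi> g w) = kernel_form \<gamma> f g)"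

text \<open>The Gaussian \<open>gauss \<epsilon>\<close> is not compactly supported, so \<open>\<xi>\<close> has to be extended beyond the test
  functions. As usual, \<open>Y = \<xi>(g)\<close> means that \<open>Y\<close> is the mean-square limit of \<open>\<xi>(f\<^sub>n)\<close> for test
  functions \<open>f\<^sub>n\<close> tending to \<open>g\<close>; here \<open>f\<^sub>n \<rightarrow> g\<close> pointwise, dominated by \<open>\<bar>g\<bar>\<close> (smooth truncations
  of \<open>g\<close>). When \<open>\<integral>\<integral> \<bar>g(x)\<bar> \<gamma>(x - y) \<bar>g(y)\<bar> dx dy < \<infinity>\<close>, dominated convergence makes the limit
  independent of the sequence, up to null sets.\<close>

definition extended_value ::
  "'a measure \<Rightarrow> ((real ^ 'n::finite \<Rightarrow> real) \<Rightarrow> 'a \<Rightarrow> real) \<Rightarrow> (real ^ 'n \<Rightarrow> real) \<Rightarrow>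
     ('a \<Rightarrow> real) \<Rightarrow> bool" where
  "extended_value M \<xi> g Y \<longleftrightarrow> Y \<in> borel_measurable M \<and>
     (\<exists>f :: nat \<Rightarrow> real ^ 'n \<Rightarrow> real.
        (\<forall>n. f n \<in> test_functions) \<and>
        (\<forall>n x. \<bar>f n x\<bar> \<le> \<bar>g x\<bar>) \<and> (\<forall>x. (\<lambda>n. f n x) \<longlonglongrightarrow> g x) \<and>
        (\<lambda>n. \<integral>\<^sup>+ w. ennreal ((\<xi> (f n) w - Y w)\<^sup>2) \<partial>M) \<longlonglongrightarrow> 0)"

text \<open>\<open>\<xi>\<^sub>\<epsilon>(x) = (\<xi> * p\<^sub>\<epsilon>\<^sub>/\<^sub>\<surd>\<^sub>2)(x) = \<xi>(p\<^sub>\<epsilon>\<^sub>/\<^sub>\<surd>\<^sub>2(x - \<cdot>))\<close>, in the version with smooth sample paths.\<close>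

definition mollified_noise ::
  "'a measure \<Rightarrow> ((real ^ 'n::finite \<Rightarrow> real) \<Rightarrow> 'a \<Rightarrow> real) \<Rightarrow> real \<Rightarrow>
     (real ^ 'n \<Rightarrow> 'a \<Rightarrow> real) \<Rightarrow> bool" where
  "mollified_noise M \<xi> \<epsilon> X \<longleftrightarrow>
     (\<forall>x. extended_value M \<xi> (\<lambda>y. gauss (\<epsilon> / sqrt 2) (x - y)) (X x)) \<and>
     (\<forall>w\<in>space M. smooth (\<lambda>x. X x w))"

text \<open>Brownian motion with generator \<open>\<kappa>\<Delta>\<close> (not \<open>\<Delta>/2\<close>): the increment over \<open>[r, s]\<close> is normal with
  covariance matrix \<open>2\<kappa>(s - r)\<close> times the identity.\<close>

definition brownian_motion ::
  "real \<Rightarrow> real ^ 'n::finite \<Rightarrow> 'b measure \<Rightarrow> (real \<Rightarrow> 'b \<Rightarrow> real ^ 'n) \<Rightarrow> bool" where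
  "brownian_motion \<kappa> x P W \<longleftrightarrow> prob_space P \<and>
     (\<forall>s\<ge>0. W s \<in> borel_measurable P) \<and>
     (AE b in P. W 0 b = x) \<and>
     (\<forall>b\<in>space P. continuous_on {0..} (\<lambda>s. W s b)) \<and>
     (\<forall>r s. 0 \<le> r \<and> r < s \<longrightarrow>
        distributed P lborel (\<lambda>b. W s b - W r b) (gauss (sqrt (2 * \<kappa> * (s - r))))) \<and>
     (\<forall>\<tau> :: nat \<Rightarrow> real. \<forall>n. 0 \<le> \<tau> 0 \<and> strict_mono \<tau> \<longrightarrow>
        prob_space.indep_vars P (\<lambda>_. borel) (\<lambda>i b. W (\<tau> (Suc i)) b - W (\<tau> i) b) {..<n})"

text \<open>\<open>\<E>\<^sub>x[exp (\<integral>\<^sub>0\<^sup>t V(W\<^sub>s) ds)]\<close> for a frozen potential \<open>V\<close>, where \<open>P x\<close> is the law under which \<open>W\<close>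
  starts at \<open>x\<close>. Independence of \<open>W\<close> and \<open>\<xi>\<close> is encoded by \<open>P x\<close> and \<open>M\<close> being separate
  probability spaces, \<open>V\<close> being a realisation of \<open>\<xi>\<^sub>\<epsilon>\<close>.\<close>

definition feynman_kac ::
  "('x \<Rightarrow> 'b measure) \<Rightarrow> (real \<Rightarrow> 'b \<Rightarrow> 'x) \<Rightarrow> ('x \<Rightarrow> real) \<Rightarrow> real \<Rightarrow> 'x \<Rightarrow> real" where
  "feynman_kac P W V t x = (LINT b|P x. exp (LINT s:{0..t}|lborel. V (W s b)))"

text \<open>Integrability is required explicitly because the integral of a non-integrable function
  is 0 by convention.\<close>

definition has_lyapunov_exponent ::
  "'a measure \<Rightarrow> (real \<Rightarrow> 'a \<Rightarrow> real) \<Rightarrow> (real \<Rightarrow> real) \<Rightarrow> real filter \<Rightarrow> real \<Rightarrow> real \<Rightarrow> bool" where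
  "has_lyapunov_exponent M u A F p l \<longleftrightarrow>
     (\<forall>\<^sub>F \<epsilon> in F. integrable M (\<lambda>w. u \<epsilon> w powr p)) \<and>
     ((\<lambda>\<epsilon>. ln (LINT w|M. u \<epsilon> w powr p) / A \<epsilon>) \<longlongrightarrow> l) F"

definition intermittent ::
  "'a measure \<Rightarrow> (real \<Rightarrow> 'x \<Rightarrow> 'a \<Rightarrow> real) \<Rightarrow> (real \<Rightarrow> real) \<Rightarrow> real filter \<Rightarrow> bool" where
  "intermittent M u A F \<longleftrightarrow>
     (\<exists>l :: real \<Rightarrow> real. \<exists>S \<subseteq> {0<..}.
        (\<exists>p\<in>S. \<exists>q\<in>S. p \<noteq> q) \<and>
        (\<forall>p\<in>S. \<forall>x. has_lyapunov_exponent M (\<lambda>\<epsilon>. u \<epsilon> x) A F p (l p)) \<and>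
        strict_mono_on S (\<lambda>p. l p / p))"

end

theory Submission
  imports Defs "HOL-Real_Asymp.Real_Asymp"
begin

text \<open>Write \<open>\<gamma>\<^sub>\<epsilon>\<close> for the covariance function of the mollified noise \<open>\<xi>\<^sub>\<epsilon>\<close>. By scaling,
\<open>\<gamma>\<^sub>\<epsilon>(\<epsilon> z) = \<epsilon>\<^sup>-\<^sup>\<omega> \<gamma>\<^sub>1(z)\<close>, so the variance \<open>\<gamma>\<^sub>\<epsilon>(0)\<close> is of order \<open>\<epsilon>\<^sup>-\<^sup>\<omega>\<close> and the field hardly varies
over distances much smaller than \<open>\<epsilon>\<close>. The moment of order \<open>p\<close> of \<open>u\<^sub>\<epsilon>(t, x)\<close> is then that of
\<open>exp (t \<xi>\<^sub>\<epsilon>(x))\<close>, namely \<open>exp (p\<^sup>2 t\<^sup>2 \<gamma>\<^sub>\<epsilon>(0) / 2)\<close>, up to a factor \<open>exp (o(\<epsilon>\<^sup>-\<^sup>\<omega>))\<close>. All Gaussian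
computations reduce to the moment generating function of linear combinations of two values of the
field (\<open>mollified_noise_mgf\<close>).

Upper bound. By convexity of the exponential function, \<open>u\<^sub>\<epsilon>\<close> is at most the integral of
\<open>exp (t \<xi>\<^sub>\<epsilon>(y))\<close> over the occupation measure of the Brownian motion. For \<open>p \<ge> 1\<close> a second use of
convexity gives the bound without error term (\<open>moment_le_ge1\<close>). For \<open>p < 1\<close>, \<open>\<xi>\<^sub>\<epsilon>\<close> is compared with
its values on a lattice of mesh \<open>\<delta> \<epsilon>\<close>. If \<open>\<Lambda>\<close> is a weighted sum of \<open>exp (p t \<xi>\<^sub>\<epsilon>)\<close> over the lattice,
Young's inequality gives \<open>u powr p \<le> (1 - p) \<Lambda> + p u \<Lambda> powr (- (1 - p) / p)\<close>. In the last term,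
\<open>u\<close> is replaced by the integral over \<open>y\<close> and \<open>\<Lambda>\<close> is bounded below by its summand near \<open>y\<close>. The Gaussian expectations that
remain have the right exponent, and the weights contribute only a power of \<open>\<epsilon>\<close> (\<open>moment_le_lt1\<close>).

Lower bound. The Brownian motion is restricted to an event on which it stays within distance of
order \<open>\<delta> \<epsilon>\<close> from \<open>x\<close> most of the time. Let \<open>G\<close> be the mean of the field over the occupation measure
conditioned on this event. By Jensen's inequality the moment is at least the \<open>p\<close>-th power of the
probability of the event times the expectation of \<open>exp (p t G)\<close>, and the latter is bounded below by
replacing the exponential with its tangent at a point close to \<open>p t \<xi>\<^sub>\<epsilon>(x)\<close>, which makes it linear
in \<open>G\<close> (\<open>moment_ge\<close>). For the event one takes \<open>N \<approx> \<epsilon>\<^sup>-\<^sup>\<theta>\<close> time steps, where \<open>2 < \<theta> < \<omega>\<close>, and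
requires each increment to be at most \<open>\<delta> \<epsilon> / N\<close>. Because \<open>\<theta> > 2\<close>, excursions between two grid
points are very unlikely; because \<open>\<theta> < \<omega>\<close>, the logarithm of the probability of the event, which is of order
\<open>\<epsilon>\<^sup>-\<^sup>\<theta> log (1 / \<epsilon>)\<close>, is negligible (\<open>confinement\<close>, \<open>moment_lower\<close>). This is where \<open>\<omega> > 2\<close> is needed.\<close>

section \<open>Gaussian densities\<close>

lemma gauss_nonneg: "0 \<le> gauss s x"
  by (simp add: gauss_def)

lemma gauss_pos: "s > 0 \<Longrightarrow> 0 < gauss s x"
  by (simp add: gauss_def)

lemma continuous_gauss: "continuous_on UNIV (gauss s)"
  unfolding gauss_def divide_inverse by (intro continuous_intros)

lemma borel_measurable_gauss [measurable]: "gauss s \<in> borel_measurable borel"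
  by (intro borel_measurable_continuous_onI continuous_gauss)

lemma gauss_minus: "gauss s (- x) = gauss s x"
  by (simp add: gauss_def)

lemma gauss_eq_prod_normal_density:
  fixes x :: "real ^ 'n::finite"
  assumes "s > 0"
  shows "gauss s x = (\<Prod>b\<in>Basis. normal_density 0 s (x \<bullet> b))"
proof -
  have n: "(norm x)\<^sup>2 = (\<Sum>b\<in>Basis. (x \<bullet> b)\<^sup>2)"
    unfolding power2_norm_eq_inner by (subst euclidean_inner) (simp add: power2_eq_square)
  have c: "(1 / sqrt (2 * pi * s\<^sup>2)) ^ CARD('n) = (2 * pi * s\<^sup>2) powr (- real CARD('n) / 2)"
  proof -
    have "1 / sqrt (2 * pi * s\<^sup>2) = (2 * pi * s\<^sup>2) powr (- 1 / 2)"
      using assms by (simp add: powr_minus_divide powr_half_sqrt)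
    then show ?thesis
      using assms by (simp add: powr_power)
  qed
  have "(\<Prod>b\<in>Basis. normal_density 0 s (x \<bullet> b)) =
      (1 / sqrt (2 * pi * s\<^sup>2)) ^ CARD('n) * exp (\<Sum>b\<in>Basis. - (x \<bullet> b)\<^sup>2 / (2 * s\<^sup>2))"
    unfolding normal_density_def by (simp add: prod.distrib prod_dividef exp_sum power_divide)
  also have "(\<Sum>b\<in>Basis. - (x \<bullet> b)\<^sup>2 / (2 * s\<^sup>2)) = - (norm x)\<^sup>2 / (2 * s\<^sup>2)"
    unfolding n by (simp add: sum_divide_distrib sum_negf)
  finally show ?thesis
    unfolding c gauss_def by simp
qed

lemma nn_integral_normal_density:
  assumes "s > 0" shows "(\<integral>\<^sup>+x. ennreal (normal_density m s x) \<partial>lborel) = 1"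
proof -
  have "emeasure (density lborel (normal_density m s)) UNIV = 1"
    using prob_space.emeasure_space_1[OF prob_space_normal_density[OF assms]] by simp
  then show ?thesis by (simp add: emeasure_density)
qed

lemma nn_integral_gauss:
  assumes "s > 0"
  shows "(\<integral>\<^sup>+x. ennreal (gauss s x) \<partial>(lborel :: (real ^ 'n::finite) measure)) = 1"
proof -
  have "(\<integral>\<^sup>+x. ennreal (gauss s x) \<partial>(lborel :: (real ^ 'n) measure)) =
      (\<integral>\<^sup>+x. (\<Prod>b\<in>Basis. ennreal (normal_density 0 s (x \<bullet> b))) \<partial>(lborel :: (real ^ 'n) measure))"
    by (simp add: gauss_eq_prod_normal_density[OF assms] prod_ennreal)
  also have "\<dots> = 1"
    by (subst nn_integral_lborel_prod) (auto simp: nn_integral_normal_density[OF assms])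
  finally show ?thesis .
qed

lemma nn_integral_lborel_translate:
  fixes f :: "'a::euclidean_space \<Rightarrow> ennreal"
  assumes [measurable]: "f \<in> borel_measurable borel"
  shows "(\<integral>\<^sup>+x. f (x + c) \<partial>lborel) = (\<integral>\<^sup>+x. f x \<partial>lborel)"
proof -
  have "(\<integral>\<^sup>+x. f x \<partial>lborel) = (\<integral>\<^sup>+x. f x \<partial>(distr lborel borel ((+) c)))"
    by (simp add: lborel_distr_plus)
  also have "\<dots> = (\<integral>\<^sup>+x. f (x + c) \<partial>lborel)"
    by (subst nn_integral_distr) (auto simp: add.commute)
  finally show ?thesis by simp
qed

text \<open>The parallelogram identity separates the sum of two squared distances into the squared distance of
the end points and that to their midpoint.\<close>

lemma gauss_mult_gauss:
  fixes x y u :: "real ^ 'n::finite"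
  assumes "s > 0"
  shows "gauss (s / sqrt 2) (x - u) * gauss (s / sqrt 2) (u - y) =
    gauss s (x - y) * gauss (s / 2) (u - (1/2) *\<^sub>R (x + y))"
proof -
  let ?m = "(1/2) *\<^sub>R (x + y)"
  have n: "(norm (x - u))\<^sup>2 + (norm (u - y))\<^sup>2 = 2 * (norm (u - ?m))\<^sup>2 + (norm (x - y))\<^sup>2 / 2"
    by (simp add: power2_norm_eq_inner inner_diff_left inner_diff_right inner_add_left
        inner_add_right inner_commute field_simps)
  have e: "- (norm (x - u))\<^sup>2 / (2 * (s / sqrt 2)\<^sup>2) + - (norm (u - y))\<^sup>2 / (2 * (s / sqrt 2)\<^sup>2) =
     - (norm (x - y))\<^sup>2 / (2 * s\<^sup>2) + - (norm (u - ?m))\<^sup>2 / (2 * (s / 2)\<^sup>2)"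
  proof -
    have "- (norm (x - u))\<^sup>2 / (2 * (s / sqrt 2)\<^sup>2) + - (norm (u - y))\<^sup>2 / (2 * (s / sqrt 2)\<^sup>2)
      = - ((norm (x - u))\<^sup>2 + (norm (u - y))\<^sup>2) / s\<^sup>2"
      by (simp add: power_divide add_divide_distrib diff_divide_distrib)
    also have "\<dots> = - (norm (x - y))\<^sup>2 / (2 * s\<^sup>2) + - (norm (u - ?m))\<^sup>2 / (2 * (s / 2)\<^sup>2)"
      unfolding n using assms by (simp add: field_simps power_divide)
    finally show ?thesis .
  qed
  have c: "(2 * pi * (s / sqrt 2)\<^sup>2) powr a * (2 * pi * (s / sqrt 2)\<^sup>2) powr a =
     (2 * pi * s\<^sup>2) powr a * (2 * pi * (s / 2)\<^sup>2) powr a" for a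
  proof -
    have "(2 * pi * (s / sqrt 2)\<^sup>2) * (2 * pi * (s / sqrt 2)\<^sup>2) = (2 * pi * s\<^sup>2) * (2 * pi * (s / 2)\<^sup>2)"
      by (simp add: power_divide)
    then show ?thesis
      using assms by (simp only: powr_mult[symmetric])
  qed
  have "gauss (s / sqrt 2) (x - u) * gauss (s / sqrt 2) (u - y) =
    ((2 * pi * (s / sqrt 2)\<^sup>2) powr (- real CARD('n) / 2) * (2 * pi * (s / sqrt 2)\<^sup>2) powr (- real CARD('n) / 2))
     * exp (- (norm (x - u))\<^sup>2 / (2 * (s / sqrt 2)\<^sup>2) + - (norm (u - y))\<^sup>2 / (2 * (s / sqrt 2)\<^sup>2))"
    unfolding gauss_def exp_add by (simp only: mult_ac)
  then show ?thesis
    unfolding c e unfolding gauss_def exp_add by (simp only: mult_ac)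
qed

lemma nn_integral_gauss_convolution:
  fixes x y :: "real ^ 'n::finite"
  assumes "s > 0"
  shows "(\<integral>\<^sup>+u. ennreal (gauss (s / sqrt 2) (x - u) * gauss (s / sqrt 2) (u - y)) \<partial>lborel)
    = ennreal (gauss s (x - y))"
proof -
  have "(\<integral>\<^sup>+u. ennreal (gauss (s / sqrt 2) (x - u) * gauss (s / sqrt 2) (u - y)) \<partial>lborel) =
    (\<integral>\<^sup>+u. ennreal (gauss s (x - y)) * ennreal (gauss (s / 2) (u + - ((1/2) *\<^sub>R (x + y)))) \<partial>lborel)"
    by (simp add: gauss_mult_gauss[OF assms] ennreal_mult gauss_nonneg)
  also have "\<dots> = ennreal (gauss s (x - y)) * (\<integral>\<^sup>+u. ennreal (gauss (s / 2) u) \<partial>(lborel :: (real ^ 'n) measure))"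
    by (subst nn_integral_cmult, measurable,
        subst nn_integral_lborel_translate[where f="\<lambda>u. ennreal (gauss (s / 2) u)"]) auto
  finally show ?thesis
    using assms by (simp add: nn_integral_gauss)
qed

lemma gauss_scaleR:
  fixes x :: "real ^ 'n::finite"
  assumes "s > 0"
  shows "gauss s (s *\<^sub>R x) = s powr (- real CARD('n)) * gauss 1 x"
proof -
  have "(2 * pi * s\<^sup>2) powr (- real CARD('n) / 2) = (2 * pi) powr (- real CARD('n) / 2) * (s\<^sup>2) powr (- real CARD('n) / 2)"
    by (simp add: powr_mult)
  also have "(s\<^sup>2) powr (- real CARD('n) / 2) = s powr (- real CARD('n))"
    using assms powr_powr[of s 2 "- real CARD('n) / 2"] by (simp add: powr_numeral)
  finally show ?thesis
    using assms by (simp add: gauss_def power_mult_distrib)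
qed

text \<open>Quadratic exponential moments of a Gaussian law: the factor is absorbed into a density of twice the
variance.\<close>

lemma exp_times_gauss:
  fixes z :: "real ^ 'n::finite"
  assumes "a > 0"
  shows "exp ((norm z)\<^sup>2 / (4 * a\<^sup>2)) * gauss a z = 2 powr (real CARD('n) / 2) * gauss (sqrt 2 * a) z"
proof -
  have "(2 * pi * (sqrt 2 * a)\<^sup>2) powr (- real CARD('n) / 2) = 
     2 powr (- real CARD('n) / 2) * (2 * pi * a\<^sup>2) powr (- real CARD('n) / 2)"
    by (subst powr_mult[symmetric]) (simp_all add: power_mult_distrib)
  moreover have "2 powr (real CARD('n) / 2) * 2 powr (- real CARD('n) / 2) = (1::real)"
    by (simp flip: powr_add)
  moreover have "exp ((norm z)\<^sup>2 / (4 * a\<^sup>2)) * exp (- (norm z)\<^sup>2 / (2 * a\<^sup>2)) = exp (- (norm z)\<^sup>2 / (2 * (sqrt 2 * a)\<^sup>2))"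
    unfolding exp_add[symmetric] using assms by (simp add: field_simps power_mult_distrib)
  ultimately show ?thesis
    unfolding gauss_def by (simp add: mult_ac)
qed

lemma nn_integral_exp_gauss:
  assumes "a > 0"
  shows "(\<integral>\<^sup>+z. ennreal (exp ((norm z)\<^sup>2 / (4 * a\<^sup>2))) * ennreal (gauss a z) \<partial>(lborel :: (real ^ 'n::finite) measure))
    = ennreal (2 powr (real CARD('n) / 2))"
proof -
  have "(\<integral>\<^sup>+z. ennreal (exp ((norm z)\<^sup>2 / (4 * a\<^sup>2))) * ennreal (gauss a z) \<partial>(lborel :: (real ^ 'n) measure))
   = (\<integral>\<^sup>+z. ennreal (2 powr (real CARD('n) / 2)) * ennreal (gauss (sqrt 2 * a) z) \<partial>(lborel :: (real ^ 'n) measure))"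
    by (intro nn_integral_cong) (simp flip: ennreal_mult add: gauss_nonneg exp_times_gauss[OF assms])
  also have "\<dots> = ennreal (2 powr (real CARD('n) / 2))"
    using assms by (subst nn_integral_cmult) (auto simp: nn_integral_gauss)
  finally show ?thesis .
qed

section \<open>Homogeneous noise kernels\<close>

text \<open>Under the dilation by \<open>\<epsilon>\<close>, Lebesgue measure has degree \<open>d\<close> and the kernel has degree \<open>- \<omega>\<close> as a
formal density. The scaling is stated for integrals so that it also covers the point mass of white
noise, where \<open>\<omega> = d\<close>.\<close>

definition homogeneous_kernel :: "(real ^ 'n::finite) measure \<Rightarrow> real \<Rightarrow> bool" where
  "homogeneous_kernel \<gamma> \<omega> \<longleftrightarrow> sets \<gamma> = sets borel \<and> sigma_finite_measure \<gamma> \<and> emeasure \<gamma> UNIV \<noteq> 0 \<and>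
     (\<integral>\<^sup>+z. ennreal (gauss 1 z) \<partial>\<gamma>) < \<infinity> \<and>
     (\<forall>\<epsilon>>0. \<forall>f\<in>borel_measurable borel.
        (\<integral>\<^sup>+z. f z \<partial>\<gamma>) = ennreal (\<epsilon> powr (real CARD('n) - \<omega>)) * (\<integral>\<^sup>+z. f (\<epsilon> *\<^sub>R z) \<partial>\<gamma>))"

lemma homogeneous_kernel_scale:
  fixes \<gamma> :: "(real ^ 'n::finite) measure"
  assumes "homogeneous_kernel \<gamma> \<omega>" "\<epsilon> > 0" "f \<in> borel_measurable borel"
  shows "(\<integral>\<^sup>+z. f z \<partial>\<gamma>) = ennreal (\<epsilon> powr (real CARD('n) - \<omega>)) * (\<integral>\<^sup>+z. f (\<epsilon> *\<^sub>R z) \<partial>\<gamma>)"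
  using assms(1) unfolding homogeneous_kernel_def
  by (elim conjE) (drule spec[of _ \<epsilon>], drule mp, rule assms(2), erule bspec, rule assms(3))

text \<open>For a kernel with a density, homogeneity of the measure is the change of variables \<open>z \<mapsto> \<epsilon> z\<close>.
Positivity off the coordinate hyperplanes is enough to make the measure nonzero.\<close>

lemma homogeneous_density:
  fixes h :: "real ^ 'n::finite \<Rightarrow> real"
  assumes [measurable]: "h \<in> borel_measurable borel" and h: "\<And>x. 0 \<le> h x"
    and hom: "\<And>\<epsilon> x. \<epsilon> > 0 \<Longrightarrow> h (\<epsilon> *\<^sub>R x) = \<epsilon> powr (- \<omega>) * h x"
    and pos: "\<And>x. (\<forall>i. x $ i \<noteq> 0) \<Longrightarrow> h x > 0"
    and fin: "(\<integral>\<^sup>+z. ennreal (h z) * ennreal (gauss 1 z) \<partial>lborel) < \<infinity>"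
  shows "homogeneous_kernel (density lborel (\<lambda>x. ennreal (h x))) \<omega>"
  unfolding homogeneous_kernel_def
proof (intro conjI allI impI ballI)
  show "sets (density lborel (\<lambda>x. ennreal (h x))) = sets borel" by simp
  show "sigma_finite_measure (density lborel (\<lambda>x. ennreal (h x)))"
    by (subst sigma_finite_measure.sigma_finite_iff_density_finite[OF sigma_finite_lborel]) auto
  show "(\<integral>\<^sup>+z. ennreal (gauss 1 z) \<partial>(density lborel (\<lambda>x. ennreal (h x)))) < \<infinity>"
    using fin by (simp add: nn_integral_density)
  show "emeasure (density lborel (\<lambda>x. ennreal (h x))) UNIV \<noteq> 0"
  proof
    assume "emeasure (density lborel (\<lambda>x. ennreal (h x))) UNIV = 0"
    then have "(\<integral>\<^sup>+x. ennreal (h x) \<partial>lborel) = 0" by (simp add: emeasure_density)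
    then have 1: "AE x in lborel. h x \<le> 0"
      by (subst (asm) nn_integral_0_iff_AE) (auto simp: ennreal_eq_0_iff)
    let ?B = "box 0 (\<chi> i. 1) :: (real ^ 'n) set"
    have "?B \<subseteq> {x. 0 < h x}" by (auto intro!: pos simp: mem_box_cart less_imp_neq[symmetric])
    with 1 have "AE x in lborel. x \<notin> ?B" by (auto elim!: eventually_mono simp: subset_eq not_less)
    then have "emeasure lborel ?B = 0" by (subst (asm) AE_iff_measurable[of ?B]) auto
    moreover have "measure lborel ?B = (\<Prod>b\<in>(Basis :: (real ^ 'n) set). 1)"
      by (subst measure_lborel_box) (auto simp: Basis_vec_def inner_axis intro!: prod.neutral)
    ultimately show False by (simp add: measure_def)
  qed
  fix \<epsilon> :: real and f :: "real ^ 'n \<Rightarrow> ennreal"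
  assume e: "\<epsilon> > 0" and [measurable]: "f \<in> borel_measurable borel"
  have "(\<integral>\<^sup>+z. f z \<partial>(density lborel (\<lambda>x. ennreal (h x)))) = (\<integral>\<^sup>+z. ennreal (h z) * f z \<partial>lborel)"
    by (simp add: nn_integral_density)
  also have "\<dots> = (\<integral>\<^sup>+z. ennreal (h z) * f z \<partial>(density (distr lborel borel (\<lambda>x. 0 + \<epsilon> *\<^sub>R x)) (\<lambda>_. ennreal (\<bar>\<epsilon>\<bar>^DIM(real^'n)))))"
    using e by (subst lborel_affine[where c=\<epsilon> and t=0]) auto
  also have "\<dots> = (\<integral>\<^sup>+z. ennreal (\<epsilon> ^ CARD('n)) * (ennreal (\<epsilon> powr (- \<omega>) * h z) * f (\<epsilon> *\<^sub>R z)) \<partial>lborel)"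
    using e by (simp add: nn_integral_density nn_integral_distr hom)
  also have "\<dots> = (\<integral>\<^sup>+z. ennreal (\<epsilon> powr (real CARD('n) - \<omega>)) * (ennreal (h z) * f (\<epsilon> *\<^sub>R z)) \<partial>lborel)"
  proof (intro nn_integral_cong)
    fix z :: "real ^ 'n"
    have "\<epsilon> ^ CARD('n) * \<epsilon> powr (- \<omega>) = \<epsilon> powr (real CARD('n) - \<omega>)"
      unfolding powr_realpow[OF e, symmetric] powr_add[symmetric] by simp
    then have "ennreal (\<epsilon> ^ CARD('n)) * ennreal (\<epsilon> powr (- \<omega>) * h z) = ennreal (\<epsilon> powr (real CARD('n) - \<omega>)) * ennreal (h z)"
      using e by (simp add: ennreal_mult[symmetric] h mult.assoc[symmetric])
    then show "ennreal (\<epsilon> ^ CARD('n)) * (ennreal (\<epsilon> powr (- \<omega>) * h z) * f (\<epsilon> *\<^sub>R z)) =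
        ennreal (\<epsilon> powr (real CARD('n) - \<omega>)) * (ennreal (h z) * f (\<epsilon> *\<^sub>R z))"
      unfolding mult.assoc[symmetric] by simp
  qed
  also have "\<dots> = ennreal (\<epsilon> powr (real CARD('n) - \<omega>)) * (\<integral>\<^sup>+z. f (\<epsilon> *\<^sub>R z) \<partial>(density lborel (\<lambda>x. ennreal (h x))))"
    by (simp add: nn_integral_density nn_integral_cmult)
  finally show "(\<integral>\<^sup>+z. f z \<partial>(density lborel (\<lambda>x. ennreal (h x)))) = \<dots>" .
qed

lemma nn_integral_abs_powr_normal_density_finite:
  assumes "0 < a" "a < 1"
  shows "(\<integral>\<^sup>+z. ennreal (\<bar>z\<bar> powr (- a) * normal_density 0 1 z) \<partial>lborel) < \<infinity>"
proof -
  have I: "(\<integral>\<^sup>+z. ennreal (z powr (- a)) * indicator {0..1} z \<partial>lborel) = ennreal (1 / (1 - a))"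
  proof -
    have "((\<lambda>z. z powr (- a) * indicator {0..1} z) has_integral 1 / (1 - a)) UNIV"
    proof -
      have "(\<lambda>z. z powr (- a) * indicator {0..1} z) = (\<lambda>z. if z \<in> {0..1} then z powr (- a) else 0)"
        by (auto simp: indicator_def)
      then show ?thesis
        using has_integral_powr_from_0[of "- a" 1] assms has_integral_restrict_UNIV[of "{0..1}" "\<lambda>z. z powr (- a)" "1 / (1 - a)"]
        by (simp del: has_integral_restrict_UNIV)
    qed
    then have "(\<integral>\<^sup>+z. ennreal (z powr (- a) * indicator {0..1} z) \<partial>lborel) = ennreal (1 / (1 - a))"
      by (intro nn_integral_has_integral_lborel) auto
    then show ?thesis
      by (simp add: ennreal_mult' ennreal_indicator)
  qed
  have I': "(\<integral>\<^sup>+z. ennreal ((- z) powr (- a)) * indicator {0..1} (- z) \<partial>lborel) = ennreal (1 / (1 - a))"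
    using I by (subst (asm) nn_integral_real_affine[where c="-1" and t=0]) auto
  have "(\<integral>\<^sup>+z. ennreal (\<bar>z\<bar> powr (- a) * normal_density 0 1 z) \<partial>lborel) \<le>
     (\<integral>\<^sup>+z. (ennreal (z powr (- a)) * indicator {0..1} z + ennreal ((- z) powr (- a)) * indicator {0..1} (- z))
        + ennreal (normal_density 0 1 z) \<partial>lborel)"
  proof (intro nn_integral_mono)
    fix z :: real
    have n1: "normal_density 0 1 z \<le> 1"
    proof -
      have "1 \<le> sqrt (2 * pi)" using pi_gt3 by simp
      then show ?thesis using \<open>1 \<le> sqrt (2 * pi)\<close> 
        by (simp add: normal_density_def divide_le_eq del: real_sqrt_ge_1_iff) (rule order_trans[of _ 1], auto)
    qed
    show "ennreal (\<bar>z\<bar> powr (- a) * normal_density 0 1 z) \<le> (ennreal (z powr (- a)) * indicator {0..1} z + ennreal ((- z) powr (- a)) * indicator {0..1} (- z))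
        + ennreal (normal_density 0 1 z)"
    proof (cases "\<bar>z\<bar> \<le> 1")
      case True
      have "\<bar>z\<bar> powr (- a) * normal_density 0 1 z \<le> \<bar>z\<bar> powr (- a)"
        using n1 by (simp add: mult_left_le)
      moreover have "ennreal (\<bar>z\<bar> powr (- a)) \<le> (ennreal (z powr (- a)) * indicator {0..1} z + ennreal ((- z) powr (- a)) * indicator {0..1} (- z))"
        using True by (cases "z \<ge> 0") (auto simp: indicator_def)
      ultimately show ?thesis
        by (meson add_increasing2 ennreal_leI order_trans zero_le)
    next
      case False
      then have "\<bar>z\<bar> powr (- a) \<le> 1 powr (-a)" using assms by (intro powr_mono2') auto
      then have "\<bar>z\<bar> powr (- a) * normal_density 0 1 z \<le> normal_density 0 1 z"
        by (simp add: mult_right_le_one_le mult_left_le_one_le)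
      then show ?thesis
        by (meson add_increasing ennreal_leI order_trans zero_le)
    qed
  qed
  also have "\<dots> = ennreal (1 / (1 - a)) + ennreal (1 / (1 - a)) + 1"
    by (simp add: nn_integral_add I I' nn_integral_normal_density)
  also have "\<dots> < \<infinity>" by simp
  finally show ?thesis .
qed

lemma prod_Basis_cart:
  fixes f :: "'n::finite \<Rightarrow> 'b::comm_monoid_mult"
  shows "(\<Prod>b\<in>(Basis :: (real ^ 'n) set). f (axis_index b)) = (\<Prod>i\<in>UNIV. f i)"
proof -
  have B: "(Basis :: (real ^ 'n) set) = (\<lambda>i. axis i 1) ` UNIV"
    by (auto simp: Basis_vec_def)
  show ?thesis
    unfolding B by (subst prod.reindex) (auto simp: inj_on_def axis_eq_axis axis_index_axis)
qed

lemma fractional_gauss_finite: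
  fixes w :: "'n::finite \<Rightarrow> real"
  assumes "\<And>i. 0 < w i \<and> w i < 1"
  shows "(\<integral>\<^sup>+z. ennreal (\<Prod>i\<in>UNIV. \<bar>z $ i\<bar> powr (- w i)) * ennreal (gauss 1 z) \<partial>lborel) < \<infinity>"
proof -
  let ?f = "\<lambda>b::real^'n. \<lambda>x. ennreal (\<bar>x\<bar> powr (- w (axis_index b)) * normal_density 0 1 x)"
  have "ennreal (\<Prod>i\<in>UNIV. \<bar>z $ i\<bar> powr (- w i)) * ennreal (gauss 1 z) = (\<Prod>b\<in>Basis. ?f b (z \<bullet> b))" for z
  proof -
    have "(\<Prod>i\<in>UNIV. \<bar>z $ i\<bar> powr (- w i)) = (\<Prod>b\<in>(Basis::(real^'n) set). \<bar>z $ axis_index b\<bar> powr (- w (axis_index b)))"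
      using prod_Basis_cart[of "\<lambda>i. \<bar>z $ i\<bar> powr (- w i)"] by simp
    also have "\<dots> = (\<Prod>b\<in>(Basis::(real^'n) set). \<bar>z \<bullet> b\<bar> powr (- w (axis_index b)))"
      by (intro prod.cong) (auto simp: Basis_vec_def axis_index_axis inner_axis)
    finally show ?thesis
      by (simp add: gauss_eq_prod_normal_density prod_ennreal ennreal_mult[symmetric] prod_nonneg
           flip: prod.distrib)
  qed
  then have "(\<integral>\<^sup>+z. ennreal (\<Prod>i\<in>UNIV. \<bar>z $ i\<bar> powr (- w i)) * ennreal (gauss 1 z) \<partial>lborel) =
     (\<integral>\<^sup>+z. (\<Prod>b\<in>Basis. ?f b (z \<bullet> b)) \<partial>lborel)"
    by simp
  also have "\<dots> = (\<Prod>b\<in>Basis. (\<integral>\<^sup>+x. ?f b x \<partial>lborel))"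
    by (rule nn_integral_lborel_prod) auto
  also have "\<dots> < \<infinity>"
    using nn_integral_abs_powr_normal_density_finite assms
    by (simp add: less_top[symmetric] ennreal_prod_eq_top)
  finally show ?thesis .
qed

text \<open>Reduces the integrability of the Riesz kernel to that of the fractional one, which factorises:
every coordinate is at most the norm, and \<open>w / d < 1\<close>.\<close>

lemma riesz_le_fractional:
  fixes z :: "real ^ 'n::finite"
  assumes "0 < w" "\<forall>i. z $ i \<noteq> 0"
  shows "norm z powr (- w) \<le> (\<Prod>i\<in>UNIV. \<bar>z $ i\<bar> powr (- (w / real CARD('n))))"
proof -
  have "z \<noteq> 0" using assms(2) by auto
  then have "norm z powr (- w) = (\<Prod>i\<in>(UNIV::'n set). norm z powr (- (w / real CARD('n))))"
    by (simp add: powr_power)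
  also have "\<dots> \<le> (\<Prod>i\<in>UNIV. \<bar>z $ i\<bar> powr (- (w / real CARD('n))))"
    using assms by (intro prod_mono) (auto intro!: powr_mono2' component_le_norm_cart)
  finally show ?thesis .
qed

lemma AE_components_nonzero: "AE z in (lborel :: (real ^ 'n::finite) measure). \<forall>i. z $ i \<noteq> 0"
proof -
  have "AE z in (lborel :: (real ^ 'n) measure). z $ i \<noteq> 0" for i
  proof -
    have "{z :: real ^ 'n. axis i 1 \<bullet> z = 0} \<in> null_sets lborel"
      using negligible_hyperplane[of "axis i 1 :: real^'n" 0]
      by (simp add: negligible_iff_null_sets null_sets_completion_iff)
    then show ?thesis
      by (rule AE_mp[OF AE_not_in]) (auto simp: inner_axis' intro!: AE_I2)
  qed
  then show ?thesis by (simp add: AE_all_countable)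
qed

lemma homogeneous_noise_kernel:
  fixes K :: "'n::finite noise"
  assumes \<sigma>: "\<sigma> > 0" and "admissible K"
  shows "homogeneous_kernel (noise_kernel \<sigma> K) (scaling_exponent K)"
proof (cases K)
  case White
  interpret f: finite_measure "scale_measure (ennreal (\<sigma>\<^sup>2)) (return borel (0 :: real ^ 'n))"
    by standard (simp add: emeasure_scale_measure space_scale_measure ennreal_mult_eq_top_iff)
  show ?thesis
    using \<sigma> unfolding White homogeneous_kernel_def
    by (auto simp: nn_integral_scale_measure nn_integral_return f.sigma_finite_measure_axioms
          emeasure_scale_measure ennreal_mult_less_top)
next
  case (Riesz w)
  then have w: "0 < w" "w < real CARD('n)" using assms by auto
  let ?h = "\<lambda>z :: real ^ 'n. \<Prod>i\<in>UNIV. \<bar>z $ i\<bar> powr (- (w / real CARD('n)))"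
  have "(\<integral>\<^sup>+z. ennreal (\<sigma>\<^sup>2 * norm z powr (- w)) * ennreal (gauss 1 z) \<partial>(lborel :: (real ^ 'n) measure)) \<le>
    (\<integral>\<^sup>+z. ennreal (\<sigma>\<^sup>2) * (ennreal (?h z) * ennreal (gauss 1 z)) \<partial>(lborel :: (real ^ 'n) measure))"
  proof (rule nn_integral_mono_AE)
    have le: "ennreal (\<sigma>\<^sup>2 * norm z powr (- w)) * ennreal (gauss 1 z) \<le>
      ennreal (\<sigma>\<^sup>2) * (ennreal (?h z) * ennreal (gauss 1 z))"
      if z: "\<forall>i. z $ i \<noteq> 0" for z :: "real ^ 'n"
      using riesz_le_fractional[OF w(1) z]
      by (simp add: ennreal_mult mult.assoc mult_left_mono mult_right_mono ennreal_leI)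
    show "AE z in (lborel :: (real ^ 'n) measure). ennreal (\<sigma>\<^sup>2 * norm z powr (- w)) * ennreal (gauss 1 z) \<le>
      ennreal (\<sigma>\<^sup>2) * (ennreal (?h z) * ennreal (gauss 1 z))"
      using AE_components_nonzero le by (rule eventually_mono)
  qed
  also have "\<dots> = ennreal (\<sigma>\<^sup>2) * (\<integral>\<^sup>+z. (ennreal (?h z) * ennreal (gauss 1 z)) \<partial>(lborel :: (real ^ 'n) measure))"
    by (intro nn_integral_cmult) measurable
  also have "\<dots> < \<infinity>"
    using fractional_gauss_finite[of "\<lambda>_::'n. w / real CARD('n)"] w by (simp add: ennreal_mult_less_top)
  finally have fin: "(\<integral>\<^sup>+z. ennreal (\<sigma>\<^sup>2 * norm z powr (- w)) * ennreal (gauss 1 z) \<partial>(lborel :: (real ^ 'n) measure)) < \<infinity>" .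
  have "x \<noteq> 0" if "\<forall>i. x $ i \<noteq> 0" for x :: "real ^ 'n" using that by auto
  then show ?thesis
    unfolding Riesz noise_kernel.simps scaling_exponent.simps using \<sigma> fin
    by (intro homogeneous_density) (auto simp: powr_mult)
next
  case (Fractional w)
  then have w: "\<And>i. 0 < w i \<and> w i < 1" using assms by auto
  let ?h = "\<lambda>z :: real ^ 'n. \<Prod>i\<in>UNIV. \<bar>z $ i\<bar> powr (- w i)"
  have "(\<integral>\<^sup>+z. ennreal (\<sigma>\<^sup>2 * ?h z) * ennreal (gauss 1 z) \<partial>(lborel :: (real ^ 'n) measure)) =
    ennreal (\<sigma>\<^sup>2) * (\<integral>\<^sup>+z. (ennreal (?h z) * ennreal (gauss 1 z)) \<partial>lborel)"
    by (subst nn_integral_cmult[symmetric]) (auto simp: ennreal_mult prod_nonneg mult.assoc)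
  also have "\<dots> < \<infinity>"
    using fractional_gauss_finite[of w] w by (simp add: ennreal_mult_less_top)
  finally have fin: "(\<integral>\<^sup>+z. ennreal (\<sigma>\<^sup>2 * ?h z) * ennreal (gauss 1 z) \<partial>(lborel :: (real ^ 'n) measure)) < \<infinity>" .
  have hom: "(\<Prod>i\<in>UNIV. \<bar>(\<epsilon> *\<^sub>R x) $ i\<bar> powr (- w i)) = \<epsilon> powr (- (\<Sum>i\<in>UNIV. w i)) * ?h x"
    if "\<epsilon> > 0" for \<epsilon> and x :: "real ^ 'n"
    using that by (simp add: abs_mult powr_mult prod.distrib powr_sum[symmetric] flip: sum_negf)
  have "0 < \<sigma>\<^sup>2 * ?h x" if "\<forall>i. x $ i \<noteq> 0" for x :: "real ^ 'n"
    using that \<sigma> by (intro mult_pos_pos prod_pos) auto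
  then show ?thesis
    unfolding Fractional noise_kernel.simps scaling_exponent.simps using \<sigma> fin hom
    by (intro homogeneous_density) (auto simp: prod_nonneg)
qed

text \<open>Dominates all translates of a Gaussian density by a bounded amount at once; used for the
integrability of translates and for dominated convergence.\<close>

lemma gauss_shift_le:
  fixes x z :: "real ^ 'n::finite"
  assumes "a > 0"
  shows "gauss a (x - z) \<le> 2 powr (real CARD('n) / 2) * exp ((norm x)\<^sup>2 / (2 * a\<^sup>2)) * gauss (sqrt 2 * a) z"
proof -
  have "(norm z)\<^sup>2 \<le> (norm x + norm (x - z))\<^sup>2"
    by (intro power_mono) (use norm_triangle_ineq4[of x "x - z"] in auto)
  also have "\<dots> \<le> 2 * (norm x)\<^sup>2 + 2 * (norm (x - z))\<^sup>2"
    using sum_squares_bound[of "norm x" "norm (x - z)"] by (simp add: power2_sum)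
  finally have "- (norm (x - z))\<^sup>2 \<le> (norm x)\<^sup>2 - (norm z)\<^sup>2 / 2" by simp
  then have "- (norm (x - z))\<^sup>2 / (2 * a\<^sup>2) \<le> ((norm x)\<^sup>2 - (norm z)\<^sup>2 / 2) / (2 * a\<^sup>2)"
    by (intro divide_right_mono) auto
  also have "\<dots> = (norm x)\<^sup>2 / (2 * a\<^sup>2) + ((norm z)\<^sup>2 / (4 * a\<^sup>2) - (norm z)\<^sup>2 / (2 * a\<^sup>2))"
    using assms by (simp add: field_simps)
  finally have "exp (- (norm (x - z))\<^sup>2 / (2 * a\<^sup>2)) \<le> exp ((norm x)\<^sup>2 / (2 * a\<^sup>2)) *
      (exp ((norm z)\<^sup>2 / (4 * a\<^sup>2)) * exp (- (norm z)\<^sup>2 / (2 * a\<^sup>2)))"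
    by (simp flip: exp_add)
  from mult_left_mono[OF this, of "(2 * pi * a\<^sup>2) powr (- real CARD('n) / 2)"]
  have "gauss a (x - z) \<le> exp ((norm x)\<^sup>2 / (2 * a\<^sup>2)) * (exp ((norm z)\<^sup>2 / (4 * a\<^sup>2)) * gauss a z)"
    unfolding gauss_def by (simp add: mult_ac)
  then show ?thesis
    unfolding exp_times_gauss[OF assms] by (simp only: mult_ac)
qed

lemma nn_integral_kernel_gauss_finite:
  fixes \<gamma> :: "(real ^ 'n::finite) measure"
  assumes hk: "homogeneous_kernel \<gamma> \<omega>" and "\<epsilon> > 0"
  shows "(\<integral>\<^sup>+z. ennreal (gauss \<epsilon> (x - z)) \<partial>\<gamma>) < \<infinity>"
proof -
  have [measurable_cong]: "sets \<gamma> = sets borel" using hk by (simp add: homogeneous_kernel_def)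
  have s: "sqrt 2 * \<epsilon> > 0" using assms by simp
  have "(\<integral>\<^sup>+z. ennreal (gauss (sqrt 2 * \<epsilon>) z) \<partial>\<gamma>) = ennreal ((sqrt 2 * \<epsilon>) powr (real CARD('n) - \<omega>)) *
     (\<integral>\<^sup>+z. ennreal (gauss (sqrt 2 * \<epsilon>) ((sqrt 2 * \<epsilon>) *\<^sub>R z)) \<partial>\<gamma>)"
    by (rule homogeneous_kernel_scale[OF hk s]) measurable
  also have "\<dots> = ennreal ((sqrt 2 * \<epsilon>) powr (real CARD('n) - \<omega>)) *
     (ennreal ((sqrt 2 * \<epsilon>) powr (- real CARD('n))) * (\<integral>\<^sup>+z. ennreal (gauss 1 z) \<partial>\<gamma>))"
    by (simp only: gauss_scaleR[OF s]) (simp add: ennreal_mult gauss_nonneg nn_integral_cmult)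
  also have "\<dots> < \<infinity>"
    using hk by (simp add: homogeneous_kernel_def ennreal_mult_less_top)
  finally have fin: "(\<integral>\<^sup>+z. ennreal (gauss (sqrt 2 * \<epsilon>) z) \<partial>\<gamma>) < \<infinity>" .
  have "(\<integral>\<^sup>+z. ennreal (gauss \<epsilon> (x - z)) \<partial>\<gamma>) \<le>
    (\<integral>\<^sup>+z. ennreal (2 powr (real CARD('n) / 2) * exp ((norm x)\<^sup>2 / (2 * \<epsilon>\<^sup>2))) * ennreal (gauss (sqrt 2 * \<epsilon>) z) \<partial>\<gamma>)"
    using gauss_shift_le[OF \<open>\<epsilon> > 0\<close>]
    by (intro nn_integral_mono) (simp add: ennreal_mult[symmetric] gauss_nonneg ennreal_leI)
  also have "\<dots> < \<infinity>"
    using fin by (simp add: nn_integral_cmult ennreal_mult_less_top)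
  finally show ?thesis .
qed

lemma integrable_kernel_gauss:
  assumes "homogeneous_kernel \<gamma> \<omega>" and "\<epsilon> > 0"
  shows "integrable \<gamma> (\<lambda>z. gauss \<epsilon> (x - z))"
proof -
  have [measurable_cong]: "sets \<gamma> = sets borel" using assms by (simp add: homogeneous_kernel_def)
  show ?thesis
    using nn_integral_kernel_gauss_finite[OF assms, of x]
    by (intro integrableI_bounded) (auto simp: gauss_nonneg)
qed

lemma ennreal_mollified_kernel:
  assumes "homogeneous_kernel \<gamma> \<omega>" and "\<epsilon> > 0"
  shows "ennreal (mollified_kernel \<gamma> \<epsilon> x) = (\<integral>\<^sup>+z. ennreal (gauss \<epsilon> (x - z)) \<partial>\<gamma>)"
  unfolding mollified_kernel_def
  by (rule nn_integral_eq_integral[symmetric, OF integrable_kernel_gauss[OF assms]]) (simp add: gauss_nonneg)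

lemma mollified_kernel_nonneg: "0 \<le> mollified_kernel \<gamma> \<epsilon> x"
  unfolding mollified_kernel_def by (simp add: gauss_nonneg integral_nonneg_AE)

lemma mollified_kernel_pos:
  fixes \<gamma> :: "(real ^ 'n::finite) measure"
  assumes hk: "homogeneous_kernel \<gamma> \<omega>" and "\<epsilon> > 0"
  shows "0 < mollified_kernel \<gamma> \<epsilon> x"
proof -
  have sets[measurable_cong]: "sets \<gamma> = sets borel" using hk by (simp add: homogeneous_kernel_def)
  then have sp: "space \<gamma> = UNIV" using sets_eq_imp_space_eq by fastforce
  have "(\<integral>\<^sup>+z. ennreal (gauss \<epsilon> (x - z)) \<partial>\<gamma>) \<noteq> 0"
  proof
    assume "(\<integral>\<^sup>+z. ennreal (gauss \<epsilon> (x - z)) \<partial>\<gamma>) = 0"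
    then have "AE z in \<gamma>. ennreal (gauss \<epsilon> (x - z)) = 0"
      by (subst (asm) nn_integral_0_iff_AE) auto
    then have "AE z in \<gamma>. False"
      by eventually_elim (use gauss_pos[OF \<open>\<epsilon> > 0\<close>] in \<open>auto simp: ennreal_eq_0_iff not_le[symmetric]\<close>)
    then have "emeasure \<gamma> UNIV = 0"
      by (subst (asm) AE_iff_measurable[of UNIV]) (auto simp: sp sets)
    then show False using hk by (simp add: homogeneous_kernel_def)
  qed
  then show ?thesis
    using ennreal_mollified_kernel[OF assms, of x] mollified_kernel_nonneg[of \<gamma> \<epsilon> x]
    by (metis ennreal_0 less_eq_real_def)
qed

lemma mollified_kernel_scaling:
  fixes \<gamma> :: "(real ^ 'n::finite) measure"
  assumes hk: "homogeneous_kernel \<gamma> \<omega>" and e: "\<epsilon> > 0"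
  shows "mollified_kernel \<gamma> \<epsilon> (\<epsilon> *\<^sub>R x) = \<epsilon> powr (- \<omega>) * mollified_kernel \<gamma> 1 x"
proof -
  have [measurable_cong]: "sets \<gamma> = sets borel" using hk by (simp add: homogeneous_kernel_def)
  have "(\<integral>\<^sup>+z. ennreal (gauss \<epsilon> (\<epsilon> *\<^sub>R x - z)) \<partial>\<gamma>) = ennreal (\<epsilon> powr (real CARD('n) - \<omega>)) *
      (\<integral>\<^sup>+z. ennreal (gauss \<epsilon> (\<epsilon> *\<^sub>R x - \<epsilon> *\<^sub>R z)) \<partial>\<gamma>)"
    by (rule homogeneous_kernel_scale[OF hk e]) measurable
  also have "\<dots> = ennreal (\<epsilon> powr (real CARD('n) - \<omega>)) *
      (ennreal (\<epsilon> powr (- real CARD('n))) * (\<integral>\<^sup>+z. ennreal (gauss 1 (x - z)) \<partial>\<gamma>))"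
    by (simp only: scaleR_diff_right[symmetric] gauss_scaleR[OF e])
       (simp add: ennreal_mult gauss_nonneg nn_integral_cmult)
  also have "\<dots> = ennreal (\<epsilon> powr (real CARD('n) - \<omega>) * \<epsilon> powr (- real CARD('n))) * (\<integral>\<^sup>+z. ennreal (gauss 1 (x - z)) \<partial>\<gamma>)"
    by (simp add: ennreal_mult mult.assoc)
  also have "\<epsilon> powr (real CARD('n) - \<omega>) * \<epsilon> powr (- real CARD('n)) = \<epsilon> powr (- \<omega>)"
    by (simp flip: powr_add)
  finally have "ennreal (mollified_kernel \<gamma> \<epsilon> (\<epsilon> *\<^sub>R x)) = ennreal (\<epsilon> powr (- \<omega>) * mollified_kernel \<gamma> 1 x)"
    using e by (simp add: ennreal_mollified_kernel[OF hk, symmetric] ennreal_mult mollified_kernel_nonneg)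
  then show ?thesis
    by (simp add: mollified_kernel_nonneg)
qed

text \<open>After rescaling, this makes the mollified noise nearly constant over distances that are small
compared with \<open>\<epsilon>\<close>. The majorant is the one for translates by at most \<open>1\<close>.\<close>

lemma isCont_mollified_kernel_0:
  fixes \<gamma> :: "(real ^ 'n::finite) measure"
  assumes hk: "homogeneous_kernel \<gamma> \<omega>"
  shows "isCont (mollified_kernel \<gamma> 1) 0"
proof -
  have [measurable_cong]: "sets \<gamma> = sets borel" using hk by (simp add: homogeneous_kernel_def)
  show ?thesis
    unfolding continuous_at_sequentially
  proof (intro allI impI)
    fix X :: "nat \<Rightarrow> real ^ 'n" assume X: "X \<longlonglongrightarrow> 0"
    then have "eventually (\<lambda>n. norm (X n) < 1) sequentially"
      by (simp add: tendsto_iff)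
    then obtain N where N: "\<And>n. n \<ge> N \<Longrightarrow> norm (X n) < 1" by (auto simp: eventually_sequentially)
    let ?C = "2 powr (real CARD('n) / 2) * exp (1 / 2)"
    have "(\<lambda>n. LINT z|\<gamma>. gauss 1 (X (n + N) - z)) \<longlonglongrightarrow> (LINT z|\<gamma>. gauss 1 (0 - z))"
    proof (rule integral_dominated_convergence[where w="\<lambda>z. ?C * gauss (sqrt 2) z"])
      show "integrable \<gamma> (\<lambda>z. ?C * gauss (sqrt 2) z)"
        using integrable_kernel_gauss[OF hk, of "sqrt 2" 0] by (simp add: gauss_minus)
      show "AE z in \<gamma>. norm (gauss 1 (X (n + N) - z)) \<le> ?C * gauss (sqrt 2) z" for n
      proof (rule AE_I2)
        fix z :: "real ^ 'n"
        have "(norm (X (n + N)))\<^sup>2 \<le> 1" using N[of "n + N"] by (simp add: power_le_one)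
        then have "exp ((norm (X (n + N)))\<^sup>2 / 2) \<le> exp (1 / 2)" by simp
        then have "2 powr (real CARD('n) / 2) * exp ((norm (X (n + N)))\<^sup>2 / 2) * gauss (sqrt 2) z \<le> ?C * gauss (sqrt 2) z"
          by (intro mult_right_mono mult_left_mono) (auto simp: gauss_nonneg)
        then show "norm (gauss 1 (X (n + N) - z)) \<le> ?C * gauss (sqrt 2) z"
          using order_trans[OF gauss_shift_le[of 1 "X (n + N)" z]] by (simp add: gauss_nonneg)
      qed
      have X': "(\<lambda>n. X (n + N)) \<longlonglongrightarrow> 0" using X by (rule LIMSEQ_ignore_initial_segment)
      show "AE z in \<gamma>. (\<lambda>n. gauss 1 (X (n + N) - z)) \<longlonglongrightarrow> gauss 1 (0 - z)"
        using continuous_gauss[of 1] X'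
        by (intro AE_I2 isCont_tendsto_compose[of _ "gauss 1"] tendsto_intros)
           (auto simp: continuous_on_eq_continuous_at)
    qed measurable
    then show "(mollified_kernel \<gamma> 1 \<circ> X) \<longlonglongrightarrow> mollified_kernel \<gamma> 1 0"
      unfolding mollified_kernel_def comp_def by (rule LIMSEQ_offset)
  qed
qed

section \<open>Two-point moment generating function of the mollified noise\<close>

lemma centered_normal_mgf:
  assumes "prob_space M" "centered_normal M Y"
  shows "integrable M (\<lambda>w. (Y w)\<^sup>2)"
    and "(\<integral>\<^sup>+w. ennreal (exp (a * Y w)) \<partial>M) = ennreal (exp (a\<^sup>2 * (LINT w|M. (Y w)\<^sup>2) / 2))"
proof -
  interpret prob_space M by fact
  have [measurable]: "Y \<in> borel_measurable M" using assms by (simp add: centered_normal_def)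
  have "integrable M (\<lambda>w. (Y w)\<^sup>2) \<and>
    (\<integral>\<^sup>+w. ennreal (exp (a * Y w)) \<partial>M) = ennreal (exp (a\<^sup>2 * (LINT w|M. (Y w)\<^sup>2) / 2))"
  proof (cases "AE w in M. Y w = 0")
    case True
    have i: "integrable M (\<lambda>w. (Y w)\<^sup>2) \<longleftrightarrow> integrable M (\<lambda>w. 0::real)"
      by (rule integrable_cong_AE) (use True in auto)
    have "(LINT w|M. (Y w)\<^sup>2) = (LINT w|M. (0::real))"
      by (rule integral_cong_AE) (use True in auto)
    moreover have "(\<integral>\<^sup>+w. ennreal (exp (a * Y w)) \<partial>M) = (\<integral>\<^sup>+w. 1 \<partial>M)"
      by (rule nn_integral_cong_AE) (use True in auto)
    ultimately show ?thesis using i by (simp add: emeasure_space_1)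
  next
    case False
    then obtain s where s: "s > 0" and D: "distributed M lborel Y (normal_density 0 s)"
      using assms(2) by (auto simp: centered_normal_def)
    have "integrable lborel (\<lambda>x. normal_density 0 s x * x\<^sup>2)"
      using integrable_normal_moment[OF s, of 0 2] by simp
    then have i: "integrable M (\<lambda>w. (Y w)\<^sup>2)"
      by (subst (asm) distributed_integrable[OF D, of "\<lambda>x. x\<^sup>2"]) auto
    have "(LINT x|lborel. normal_density 0 s x * x\<^sup>2) = s\<^sup>2"
      using integral_normal_moment_even[OF s, of 0 1] by (simp add: eval_nat_numeral field_simps)
    then have v: "(LINT w|M. (Y w)\<^sup>2) = s\<^sup>2"
      by (subst (asm) distributed_integral[OF D, of "\<lambda>x. x\<^sup>2"]) auto
    have "(\<integral>\<^sup>+w. ennreal (exp (a * Y w)) \<partial>M) = (\<integral>\<^sup>+x. ennreal (normal_density 0 s x) * ennreal (exp (a * x)) \<partial>lborel)"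
      by (rule distributed_nn_integral[OF D, symmetric]) auto
    also have "\<dots> = (\<integral>\<^sup>+x. ennreal (exp (a\<^sup>2 * s\<^sup>2 / 2)) * ennreal (normal_density (a * s\<^sup>2) s x) \<partial>lborel)"
    proof (intro nn_integral_cong)
      fix x
      have "- (x - 0)\<^sup>2 / (2 * s\<^sup>2) + a * x = a\<^sup>2 * s\<^sup>2 / 2 + - (x - a * s\<^sup>2)\<^sup>2 / (2 * s\<^sup>2)"
        using s by (simp add: field_simps power2_eq_square)
      then have "exp (- (x - 0)\<^sup>2 / (2 * s\<^sup>2)) * exp (a * x) = exp (a\<^sup>2 * s\<^sup>2 / 2) * exp (- (x - a * s\<^sup>2)\<^sup>2 / (2 * s\<^sup>2))"
        by (simp only: exp_add[symmetric])
      then have "normal_density 0 s x * exp (a * x) = exp (a\<^sup>2 * s\<^sup>2 / 2) * normal_density (a * s\<^sup>2) s x"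
        unfolding normal_density_def by (simp only: mult.assoc mult.left_commute[of "exp (a\<^sup>2 * s\<^sup>2 / 2)"])
      then show "ennreal (normal_density 0 s x) * ennreal (exp (a * x)) = ennreal (exp (a\<^sup>2 * s\<^sup>2 / 2)) * ennreal (normal_density (a * s\<^sup>2) s x)"
        by (simp add: ennreal_mult[symmetric])
    qed
    also have "\<dots> = ennreal (exp (a\<^sup>2 * s\<^sup>2 / 2))"
      by (simp add: nn_integral_cmult nn_integral_normal_density[OF s])
    finally show ?thesis using i v by simp
  qed
  then show "integrable M (\<lambda>w. (Y w)\<^sup>2)"
    and "(\<integral>\<^sup>+w. ennreal (exp (a * Y w)) \<partial>M) = ennreal (exp (a\<^sup>2 * (LINT w|M. (Y w)\<^sup>2) / 2))"
    by auto
qed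

text \<open>The eventual finiteness of the distances gives the integrability that the extraction of a
subsequence from convergence in \<open>L\<^sup>1\<close> asks for.\<close>

lemma L2_tendsto_AE_subseq:
  fixes Z :: "nat \<Rightarrow> 'a \<Rightarrow> real"
  assumes [measurable]: "\<And>n. Z n \<in> borel_measurable M" "Y \<in> borel_measurable M"
    and L2: "(\<lambda>n. \<integral>\<^sup>+ w. ennreal ((Z n w - Y w)\<^sup>2) \<partial>M) \<longlonglongrightarrow> 0"
  shows "\<exists>r :: nat \<Rightarrow> nat. filterlim r sequentially sequentially \<and> (AE w in M. (\<lambda>n. Z (r n) w) \<longlonglongrightarrow> Y w)"
proof -
  have "eventually (\<lambda>n. (\<integral>\<^sup>+ w. ennreal ((Z n w - Y w)\<^sup>2) \<partial>M) < 1) sequentially"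
    using L2 by (rule order_tendstoD) simp
  then obtain N where N: "\<And>n. n \<ge> N \<Longrightarrow> (\<integral>\<^sup>+ w. ennreal ((Z n w - Y w)\<^sup>2) \<partial>M) < 1"
    by (auto simp: eventually_sequentially)
  define u where "u n w = (Z (n + N) w - Y w)\<^sup>2" for n w
  have int: "integrable M (u n)" for n
    unfolding u_def using N[of "n + N"]
    by (intro integrableI_bounded) (auto intro: less_trans)
  have "(\<lambda>n. enn2real (\<integral>\<^sup>+ w. ennreal (u n w) \<partial>M)) \<longlonglongrightarrow> enn2real 0"
    unfolding u_def
    using LIMSEQ_ignore_initial_segment[OF L2, of N] by (intro tendsto_enn2real) auto
  moreover have "enn2real (\<integral>\<^sup>+ w. ennreal (u n w) \<partial>M) = (\<integral>w. norm (u n w) \<partial>M)" for n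
    by (subst nn_integral_eq_integral[OF int]) (auto simp: u_def intro!: Bochner_Integration.integral_cong)
  ultimately have "(\<lambda>n. \<integral>w. norm (u n w) \<partial>M) \<longlonglongrightarrow> 0" by simp
  from tendsto_L1_AE_subseq[OF int this] obtain r :: "nat \<Rightarrow> nat" where
    r: "strict_mono r" "AE w in M. (\<lambda>n. u (r n) w) \<longlonglongrightarrow> 0" by auto
  have "AE w in M. (\<lambda>n. Z (r n + N) w) \<longlonglongrightarrow> Y w"
    using r(2)
  proof eventually_elim
    case (elim w)
    then have "(\<lambda>n. sqrt (u (r n) w)) \<longlonglongrightarrow> sqrt 0" by (rule tendsto_real_sqrt)
    then have "(\<lambda>n. \<bar>Z (r n + N) w - Y w\<bar>) \<longlonglongrightarrow> 0" by (simp add: u_def)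
    then show ?case by (subst (asm) tendsto_rabs_zero_iff) (simp add: LIM_zero_iff)
  qed
  moreover have "filterlim (\<lambda>n. r n + N) sequentially sequentially"
    using filterlim_subseq[OF r(1)] by (rule filterlim_at_top_mono) auto
  ultimately show ?thesis by blast
qed

text \<open>Convergence in mean square controls exponentials only along an almost surely convergent
subsequence. The exponentials are uniformly integrable because their second moments
\<open>exp (2 v n)\<close> are bounded: cutting off at level \<open>B\<close> costs at most \<open>exp (2 v n) / B\<close>.\<close>

lemma mgf_L2_limit:
  fixes Z :: "nat \<Rightarrow> 'a \<Rightarrow> real"
  assumes "prob_space M"
    and [measurable]: "\<And>n. Z n \<in> borel_measurable M" "Y \<in> borel_measurable M"
    and L2: "(\<lambda>n. \<integral>\<^sup>+ w. ennreal ((Z n w - Y w)\<^sup>2) \<partial>M) \<longlonglongrightarrow> 0"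
    and mgf: "\<And>n a. (\<integral>\<^sup>+w. ennreal (exp (a * Z n w)) \<partial>M) = ennreal (exp (a\<^sup>2 * v n / 2))"
    and v: "v \<longlonglongrightarrow> v0"
  shows "(\<integral>\<^sup>+w. ennreal (exp (Y w)) \<partial>M) = ennreal (exp (v0 / 2))"
proof -
  interpret prob_space M by fact
  obtain r :: "nat \<Rightarrow> nat" where r: "filterlim r sequentially sequentially"
    and ae: "AE w in M. (\<lambda>n. Z (r n) w) \<longlonglongrightarrow> Y w"
    using L2_tendsto_AE_subseq[OF _ _ L2] by auto
  have vr: "(\<lambda>n. v (r n)) \<longlonglongrightarrow> v0" using v r by (rule filterlim_compose)
  have hb: "has_bochner_integral M (\<lambda>w. exp (a * Z n w)) (exp (a\<^sup>2 * v n / 2))" for a n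
    by (rule has_bochner_integral_nn_integral) (auto simp: mgf)
  note i1 = hb[of 1, simplified] and i2 = hb[of 2, simplified]
  have trunc: "exp z \<le> min (exp z) B + exp (2 * z) / B" if "B > 0" for z B :: real
  proof (cases "exp z \<le> B")
    case False
    then have "exp z * B \<le> exp z * exp z" by simp
    then have "exp z \<le> exp (2 * z) / B" using that by (simp add: field_simps flip: exp_add)
    moreover have "0 \<le> min (exp z) B" using that by simp
    ultimately show ?thesis by linarith
  qed (use that in auto)
  define L where "L B = (LINT w|M. min (exp (Y w)) B)" for B
  have lim: "(\<lambda>n. LINT w|M. min (exp (Z (r n) w)) B) \<longlonglongrightarrow> L B" if "B > 0" for B
    unfolding L_def
  proof (rule integral_dominated_convergence[where w="\<lambda>_. B"])
    show "AE w in M. (\<lambda>n. min (exp (Z (r n) w)) B) \<longlonglongrightarrow> min (exp (Y w)) B"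
      using ae by eventually_elim (intro tendsto_intros)
  qed (use that in auto)
  have im: "integrable M (\<lambda>w. min (exp (X w)) B)" if "B > 0" and [measurable]: "X \<in> borel_measurable M" for X and B :: real
    using that by (intro integrable_const_bound[where B=B]) auto
  have up: "L B \<le> exp (v0 / 2)" if "B > 0" for B
  proof (rule LIMSEQ_le[OF lim[OF that]])
    show "(\<lambda>n. exp (v (r n) / 2)) \<longlonglongrightarrow> exp (v0 / 2)" by (intro tendsto_intros vr) simp
    have "(LINT w|M. min (exp (Z n w)) B) \<le> (LINT w|M. exp (Z n w))" for n
      by (intro integral_mono im that integrable.intros[OF i1]) auto
    then show "\<exists>N. \<forall>n\<ge>N. (LINT w|M. min (exp (Z (r n) w)) B) \<le> exp (v (r n) / 2)"
      using has_bochner_integral_integral_eq[OF i1] by auto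
  qed
  have low: "exp (v0 / 2) - exp (2 * v0) / B \<le> L B" if "B > 0" for B
  proof (rule LIMSEQ_le[OF _ lim[OF that]])
    show "(\<lambda>n. exp (v (r n) / 2) - exp (2 * v (r n)) / B) \<longlonglongrightarrow> exp (v0 / 2) - exp (2 * v0) / B"
      using that by (intro tendsto_intros vr) auto
    have "(LINT w|M. exp (Z n w)) \<le> (LINT w|M. min (exp (Z n w)) B + exp (2 * Z n w) / B)" for n
      by (intro integral_mono Bochner_Integration.integrable_add im that integrable.intros[OF i1]
          integrable_divide integrable.intros[OF i2] trunc) auto
    also have "(LINT w|M. min (exp (Z n w)) B + exp (2 * Z n w) / B) = (LINT w|M. min (exp (Z n w)) B) + exp (2 * v n) / B" for n
      using has_bochner_integral_integral_eq[OF i2[of n]] im[OF that, of "Z n"] integrable.intros[OF i2[of n]]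
      by (subst Bochner_Integration.integral_add) auto
    finally have *: "(LINT w|M. exp (Z n w)) \<le> (LINT w|M. min (exp (Z n w)) B) + exp (2 * v n) / B" for n .
    have "exp (v n / 2) \<le> (LINT w|M. min (exp (Z n w)) B) + exp (2 * v n) / B" for n
      using *[of n] has_bochner_integral_integral_eq[OF i1[of n]] by simp
    then show "\<exists>N. \<forall>n\<ge>N. exp (v (r n) / 2) - exp (2 * v (r n)) / B \<le> (LINT w|M. min (exp (Z (r n) w)) B)"
      by (auto simp: diff_le_eq)
  qed
  have "(\<lambda>n. L (real (Suc n))) \<longlonglongrightarrow> exp (v0 / 2)"
  proof (rule tendsto_sandwich[where h="\<lambda>_. exp (v0 / 2)"])
    have "(\<lambda>n. exp (v0 / 2) - exp (2 * v0) * (1 / real (Suc n))) \<longlonglongrightarrow> exp (v0 / 2) - exp (2 * v0) * 0"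
      by (intro tendsto_intros LIMSEQ_Suc[OF lim_1_over_n])
    then show "(\<lambda>n. exp (v0 / 2) - exp (2 * v0) / real (Suc n)) \<longlonglongrightarrow> exp (v0 / 2)" by simp
  qed (use up low in \<open>auto intro!: always_eventually simp del: of_nat_Suc\<close>)
  then have "(\<lambda>n. ennreal (L (real (Suc n)))) \<longlonglongrightarrow> ennreal (exp (v0 / 2))" by simp
  moreover have "ennreal (L (real (Suc n))) = (\<integral>\<^sup>+w. ennreal (min (exp (Y w)) (real (Suc n))) \<partial>M)" for n
    unfolding L_def by (rule nn_integral_eq_integral[symmetric]) (auto intro!: im)
  moreover have "(\<lambda>n. \<integral>\<^sup>+w. ennreal (min (exp (Y w)) (real (Suc n))) \<partial>M) \<longlonglongrightarrow> (\<integral>\<^sup>+w. ennreal (exp (Y w)) \<partial>M)"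
  proof (rule nn_integral_LIMSEQ)
    show "incseq (\<lambda>n w. ennreal (min (exp (Y w)) (real (Suc n))))"
      by (auto simp: incseq_def le_fun_def intro!: ennreal_leI)
    fix w
    obtain N where "exp (Y w) \<le> real N" using real_arch_simple by blast
    then have "eventually (\<lambda>n. ennreal (min (exp (Y w)) (real (Suc n))) = ennreal (exp (Y w))) sequentially"
      by (intro eventually_sequentiallyI[of N]) auto
    then show "(\<lambda>n. ennreal (min (exp (Y w)) (real (Suc n)))) \<longlonglongrightarrow> ennreal (exp (Y w))"
      by (rule tendsto_eventually)
  qed measurable
  ultimately show ?thesis
    using LIMSEQ_unique by simp
qed

text \<open>Dominated convergence, with the product of the two Gaussian densities as majorant. Integrating the
majorant first over space and then over the kernel turns it into a Gaussian convolution, which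
yields both its integrability and the value of the limit.\<close>

lemma kernel_form_tendsto:
  fixes \<gamma> :: "(real ^ 'n::finite) measure"
  assumes hk: "homogeneous_kernel \<gamma> \<omega>" and e: "\<epsilon> > 0"
    and f [measurable]: "\<And>n. f n \<in> borel_measurable borel"
    and g [measurable]: "\<And>n. g n \<in> borel_measurable borel"
    and fb: "\<And>n u. \<bar>f n u\<bar> \<le> \<bar>gauss (\<epsilon> / sqrt 2) (x - u)\<bar>"
    and gb: "\<And>n u. \<bar>g n u\<bar> \<le> \<bar>gauss (\<epsilon> / sqrt 2) (y - u)\<bar>"
    and fl: "\<And>u. (\<lambda>n. f n u) \<longlonglongrightarrow> gauss (\<epsilon> / sqrt 2) (x - u)"
    and gl: "\<And>u. (\<lambda>n. g n u) \<longlonglongrightarrow> gauss (\<epsilon> / sqrt 2) (y - u)"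
  shows "(\<lambda>n. kernel_form \<gamma> (f n) (g n)) \<longlonglongrightarrow> mollified_kernel \<gamma> \<epsilon> (x - y)"
proof -
  have sets[measurable_cong]: "sets \<gamma> = sets borel" using hk by (simp add: homogeneous_kernel_def)
  interpret G: sigma_finite_measure \<gamma> using hk by (simp add: homogeneous_kernel_def)
  interpret LG: pair_sigma_finite lborel \<gamma> ..
  let ?h = "gauss (\<epsilon> / sqrt 2) :: real ^ 'n \<Rightarrow> real"
  define D where "D = (\<lambda>(u, z). ?h (x - u) * ?h (y - (u - z)))"
  have [measurable]: "D \<in> borel_measurable (lborel \<Otimes>\<^sub>M \<gamma>)" unfolding D_def by measurable
  have D0: "0 \<le> D p" for p by (simp add: D_def gauss_nonneg split_beta)
  have "(\<integral>\<^sup>+p. ennreal (D p) \<partial>(lborel \<Otimes>\<^sub>M \<gamma>)) = (\<integral>\<^sup>+z. \<integral>\<^sup>+u. ennreal (D (u, z)) \<partial>lborel \<partial>\<gamma>)"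
    by (subst LG.nn_integral_snd) auto
  also have "\<dots> = (\<integral>\<^sup>+z. ennreal (gauss \<epsilon> ((x - y) - z)) \<partial>\<gamma>)"
  proof (intro nn_integral_cong)
    fix z
    have "D (u, z) = ?h (x - u) * ?h (u - (y + z))" for u
      using gauss_minus[of "\<epsilon> / sqrt 2" "u - (y + z)"] by (simp add: D_def algebra_simps)
    then show "(\<integral>\<^sup>+u. ennreal (D (u, z)) \<partial>lborel) = ennreal (gauss \<epsilon> ((x - y) - z))"
      using nn_integral_gauss_convolution[OF e, of x "y + z"] by (simp add: algebra_simps)
  qed
  also have "\<dots> = ennreal (mollified_kernel \<gamma> \<epsilon> (x - y))"
    by (rule ennreal_mollified_kernel[OF hk e, symmetric])
  finally have nnD: "(\<integral>\<^sup>+p. ennreal (D p) \<partial>(lborel \<Otimes>\<^sub>M \<gamma>)) = ennreal (mollified_kernel \<gamma> \<epsilon> (x - y))" .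
  have hbD: "has_bochner_integral (lborel \<Otimes>\<^sub>M \<gamma>) D (mollified_kernel \<gamma> \<epsilon> (x - y))"
    by (rule has_bochner_integral_nn_integral[OF _ _ _ nnD]) (auto simp: D0 mollified_kernel_nonneg)
  define F where "F n = (\<lambda>(u, z). f n u * g n (u - z))" for n
  have [measurable]: "F n \<in> borel_measurable (lborel \<Otimes>\<^sub>M \<gamma>)" for n unfolding F_def by measurable
  have FD: "norm (F n p) \<le> D p" for n p
    using mult_mono[OF fb[of n "fst p"] gb[of n "fst p - snd p"]]
    by (simp add: F_def D_def split_beta abs_mult gauss_nonneg)
  have "(\<lambda>n. LINT p|(lborel \<Otimes>\<^sub>M \<gamma>). F n p) \<longlonglongrightarrow> (LINT p|(lborel \<Otimes>\<^sub>M \<gamma>). D p)"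
  proof (rule integral_dominated_convergence[where w=D])
    show "integrable (lborel \<Otimes>\<^sub>M \<gamma>) D" using hbD by (rule integrable.intros)
    show "AE p in lborel \<Otimes>\<^sub>M \<gamma>. (\<lambda>n. F n p) \<longlonglongrightarrow> D p"
      by (intro AE_I2) (auto simp: F_def D_def split_beta intro!: tendsto_mult fl gl)
  qed (use FD in auto)
  moreover have "kernel_form \<gamma> (f n) (g n) = (LINT p|(lborel \<Otimes>\<^sub>M \<gamma>). F n p)" for n
  proof -
    have "integrable (lborel \<Otimes>\<^sub>M \<gamma>) (F n)"
      by (rule Bochner_Integration.integrable_bound[OF integrable.intros[OF hbD]]) (use FD D0 in auto)
    from LG.integral_fst'[OF this] show ?thesis
      by (simp add: kernel_form_def F_def)
  qed
  ultimately show ?thesis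
    using has_bochner_integral_integral_eq[OF hbD] by simp
qed

lemma test_function_measurable:
  "f \<in> test_functions \<Longrightarrow> f \<in> borel_measurable borel"
proof -
  assume "f \<in> test_functions"
  then have "C_k 0 f" unfolding test_functions_def smooth_def by blast
  then show ?thesis by (simp add: borel_measurable_continuous_onI)
qed

lemma L2_tendsto_lincomb:
  fixes A B :: "nat \<Rightarrow> 'a \<Rightarrow> real"
  assumes [measurable]: "\<And>n. A n \<in> borel_measurable M" "\<And>n. B n \<in> borel_measurable M"
    "X \<in> borel_measurable M" "Y \<in> borel_measurable M"
    and 1: "(\<lambda>n. \<integral>\<^sup>+ w. ennreal ((A n w - X w)\<^sup>2) \<partial>M) \<longlonglongrightarrow> 0"
    and 2: "(\<lambda>n. \<integral>\<^sup>+ w. ennreal ((B n w - Y w)\<^sup>2) \<partial>M) \<longlonglongrightarrow> 0"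
  shows "(\<lambda>n. \<integral>\<^sup>+ w. ennreal ((a * A n w + b * B n w - (a * X w + b * Y w))\<^sup>2) \<partial>M) \<longlonglongrightarrow> 0"
proof -
  let ?L = "\<lambda>n. \<integral>\<^sup>+ w. ennreal ((a * A n w + b * B n w - (a * X w + b * Y w))\<^sup>2) \<partial>M"
  let ?R = "\<lambda>n. ennreal (2 * a\<^sup>2) * (\<integral>\<^sup>+ w. ennreal ((A n w - X w)\<^sup>2) \<partial>M) +
     ennreal (2 * b\<^sup>2) * (\<integral>\<^sup>+ w. ennreal ((B n w - Y w)\<^sup>2) \<partial>M)"
  show ?thesis
  proof (rule tendsto_sandwich[OF _ _ tendsto_const])
  have "(\<lambda>n. ?R n) \<longlonglongrightarrow> ennreal (2 * a\<^sup>2) * 0 + ennreal (2 * b\<^sup>2) * 0"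
    by (intro tendsto_add ennreal_tendsto_cmult 1 2) auto
  then show "(\<lambda>n. ?R n) \<longlonglongrightarrow> 0"
    by simp
  show "\<forall>\<^sub>F n in sequentially. ?L n \<le>
     ?R n"
  proof (intro always_eventually allI)
    fix n
    have "?L n \<le>
      (\<integral>\<^sup>+ w. ennreal (2 * a\<^sup>2) * ennreal ((A n w - X w)\<^sup>2) + ennreal (2 * b\<^sup>2) * ennreal ((B n w - Y w)\<^sup>2) \<partial>M)"
    proof (intro nn_integral_mono)
      fix w
      have "(a * A n w + b * B n w - (a * X w + b * Y w))\<^sup>2 = (a * (A n w - X w) + b * (B n w - Y w))\<^sup>2"
        by (simp add: algebra_simps)
      also have "\<dots> \<le> 2 * (a * (A n w - X w))\<^sup>2 + 2 * (b * (B n w - Y w))\<^sup>2"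
        using sum_squares_bound[of "a * (A n w - X w)" "b * (B n w - Y w)"] by (simp add: power2_sum)
      also have "\<dots> = 2 * a\<^sup>2 * (A n w - X w)\<^sup>2 + 2 * b\<^sup>2 * (B n w - Y w)\<^sup>2"
        by (simp add: power_mult_distrib)
      finally show "ennreal ((a * A n w + b * B n w - (a * X w + b * Y w))\<^sup>2) \<le>
        ennreal (2 * a\<^sup>2) * ennreal ((A n w - X w)\<^sup>2) + ennreal (2 * b\<^sup>2) * ennreal ((B n w - Y w)\<^sup>2)"
        by (simp add: ennreal_mult[symmetric] ennreal_plus[symmetric] ennreal_leI del: ennreal_plus)
    qed
    also have "\<dots> = ?R n"
      by (simp add: nn_integral_add nn_integral_cmult)
    finally show "?L n \<le> \<dots>" .
  qed
qed auto
qed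

text \<open>The linear combination is a mean-square limit of linear combinations of the noise at two test
functions, which are normal with the variance given by the kernel. If both test functions coincide,
the coefficients have to be added first, because the Gaussian property is stated for sets of
indices.\<close>

lemma mollified_noise_mgf:
  fixes \<gamma> :: "(real ^ 'n::finite) measure"
  assumes noise: "gaussian_noise M \<gamma> \<xi>" and hk: "homogeneous_kernel \<gamma> \<omega>" and e: "\<epsilon> > 0"
    and X: "mollified_noise M \<xi> \<epsilon> X"
  shows "(\<integral>\<^sup>+w. ennreal (exp (a * X x w + b * X y w)) \<partial>M) =
    ennreal (exp ((a\<^sup>2 + b\<^sup>2) / 2 * mollified_kernel \<gamma> \<epsilon> 0 + a * b * mollified_kernel \<gamma> \<epsilon> (x - y)))"
proof -
  let ?k = "mollified_kernel \<gamma> \<epsilon>"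
  interpret prob_space M
    using noise by (simp add: gaussian_noise_def centered_gaussian_process_def)
  have gp: "centered_normal M (\<lambda>w. \<Sum>i\<in>S. c i * \<xi> i w)" if "finite S" "S \<subseteq> test_functions" for S c
    using noise that by (auto simp: gaussian_noise_def centered_gaussian_process_def)
  have cov: "(LINT w|M. \<xi> f w * \<xi> g w) = kernel_form \<gamma> f g" if "f \<in> test_functions" "g \<in> test_functions" for f g
    using noise that by (auto simp: gaussian_noise_def)
  have [measurable]: "X z \<in> borel_measurable M" for z
    using X by (auto simp: mollified_noise_def extended_value_def)
  let ?approx = "\<lambda>f z. (\<forall>n. f n \<in> test_functions) \<and>
      (\<forall>n u. \<bar>f n u\<bar> \<le> \<bar>gauss (\<epsilon> / sqrt 2) (z - u)\<bar>) \<and>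
      (\<forall>u. (\<lambda>n. f n u) \<longlonglongrightarrow> gauss (\<epsilon> / sqrt 2) (z - u)) \<and>
      (\<lambda>n. \<integral>\<^sup>+ w. ennreal ((\<xi> (f n) w - X z w)\<^sup>2) \<partial>M) \<longlonglongrightarrow> 0"
  have ex: "\<exists>f :: nat \<Rightarrow> real ^ 'n \<Rightarrow> real. ?approx f z" for z
    using X unfolding mollified_noise_def extended_value_def by (elim conjE allE[of _ z])
  obtain f where "?approx f x" using ex[of x] by (rule exE)
  note f = this[THEN conjunct1, rule_format] this[THEN conjunct2, THEN conjunct1, rule_format]
    this[THEN conjunct2, THEN conjunct2, THEN conjunct1, rule_format] this[THEN conjunct2, THEN conjunct2, THEN conjunct2]
  obtain g where "?approx g y" using ex[of y] by (rule exE)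
  note g = this[THEN conjunct1, rule_format] this[THEN conjunct2, THEN conjunct1, rule_format]
    this[THEN conjunct2, THEN conjunct2, THEN conjunct1, rule_format] this[THEN conjunct2, THEN conjunct2, THEN conjunct2]
  have n1: "centered_normal M (\<xi> h)" if "h \<in> test_functions" for h
    using gp[of "{h}" "\<lambda>_. 1"] that by simp
  have meas[measurable]: "\<xi> (f n) \<in> borel_measurable M" "\<xi> (g n) \<in> borel_measurable M" for n
    using n1 f(1) g(1) by (auto simp: centered_normal_def)
  define Z where "Z n w = a * \<xi> (f n) w + b * \<xi> (g n) w" for n w
  have Zn: "centered_normal M (Z n)" for n
  proof (cases "f n = g n")
    case True
    then show ?thesis using gp[of "{f n}" "\<lambda>_. a + b"] f(1)[of n] by (simp add: Z_def[abs_def] distrib_right)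
  next
    case False
    then show ?thesis using gp[of "{f n, g n}" "\<lambda>h. if h = f n then a else b"] f(1)[of n] g(1)[of n]
      by (auto simp: Z_def[abs_def])
  qed
  define v where "v n = (LINT w|M. (Z n w)\<^sup>2)" for n
  have veq: "v n = a\<^sup>2 * kernel_form \<gamma> (f n) (f n) + 2 * a * b * kernel_form \<gamma> (f n) (g n) + b\<^sup>2 * kernel_form \<gamma> (g n) (g n)" for n
  proof -
    note fi = centered_normal_mgf(1)[OF prob_space_axioms n1[OF f(1)[of n]]]
    note gi = centered_normal_mgf(1)[OF prob_space_axioms n1[OF g(1)[of n]]]
    have fgi: "integrable M (\<lambda>w. \<xi> (f n) w * \<xi> (g n) w)"
    proof (rule Bochner_Integration.integrable_bound[OF Bochner_Integration.integrable_add[OF fi gi]])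
      show "AE w in M. norm (\<xi> (f n) w * \<xi> (g n) w) \<le> norm ((\<xi> (f n) w)\<^sup>2 + (\<xi> (g n) w)\<^sup>2)"
      proof (rule AE_I2)
        fix w
        have "2 * (\<bar>\<xi> (f n) w\<bar> * \<bar>\<xi> (g n) w\<bar>) \<le> (\<xi> (f n) w)\<^sup>2 + (\<xi> (g n) w)\<^sup>2"
          using sum_squares_bound[of "\<bar>\<xi> (f n) w\<bar>" "\<bar>\<xi> (g n) w\<bar>"] by simp
        moreover have "0 \<le> \<bar>\<xi> (f n) w\<bar> * \<bar>\<xi> (g n) w\<bar>" by simp
        ultimately show "norm (\<xi> (f n) w * \<xi> (g n) w) \<le> norm ((\<xi> (f n) w)\<^sup>2 + (\<xi> (g n) w)\<^sup>2)"
          by (simp only: real_norm_def abs_mult)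
      qed
    qed measurable
    have "v n = (LINT w|M. a\<^sup>2 * (\<xi> (f n) w)\<^sup>2 + 2 * a * b * (\<xi> (f n) w * \<xi> (g n) w) + b\<^sup>2 * (\<xi> (g n) w)\<^sup>2)"
      unfolding v_def Z_def by (intro Bochner_Integration.integral_cong) (auto simp: power2_eq_square algebra_simps)
    also have "\<dots> = a\<^sup>2 * (LINT w|M. (\<xi> (f n) w)\<^sup>2) + 2 * a * b * (LINT w|M. \<xi> (f n) w * \<xi> (g n) w) + b\<^sup>2 * (LINT w|M. (\<xi> (g n) w)\<^sup>2)"
      using fi gi fgi by simp
    finally show ?thesis
      using cov[OF f(1) f(1)] cov[OF f(1) g(1)] cov[OF g(1) g(1)] by (simp add: power2_eq_square)
  qed
  note tm = test_function_measurable
  have v: "v \<longlonglongrightarrow> a\<^sup>2 * ?k (x - x) + 2 * a * b * ?k (x - y) + b\<^sup>2 * ?k (y - y)"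
    unfolding veq[abs_def]
    by (intro tendsto_intros kernel_form_tendsto[OF hk e] tm f g)
  have "(\<integral>\<^sup>+w. ennreal (exp (a * X x w + b * X y w)) \<partial>M) =
     ennreal (exp ((a\<^sup>2 * ?k (x - x) + 2 * a * b * ?k (x - y) + b\<^sup>2 * ?k (y - y)) / 2))"
  proof (rule mgf_L2_limit[OF prob_space_axioms _ _ _ _ v])
    show "(\<lambda>n. \<integral>\<^sup>+ w. ennreal ((Z n w - (a * X x w + b * X y w))\<^sup>2) \<partial>M) \<longlonglongrightarrow> 0"
      unfolding Z_def by (intro L2_tendsto_lincomb f g) auto
    show "Z n \<in> borel_measurable M" for n unfolding Z_def by measurable
    show "(\<integral>\<^sup>+ w. ennreal (exp (c * Z n w)) \<partial>M) = ennreal (exp (c\<^sup>2 * v n / 2))" for n c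
      unfolding v_def by (rule centered_normal_mgf(2)[OF prob_space_axioms Zn])
  qed measurable
  then show ?thesis by (simp add: field_simps)
qed

section \<open>Random paths and their occupation measure\<close>

text \<open>The parameter is approximated by simple functions; for these, joint measurability is a countable
case distinction.\<close>

lemma measurable_continuous_parameter:
  fixes f :: "'x::euclidean_space \<Rightarrow> 'a \<Rightarrow> 'y::euclidean_space"
  assumes f: "\<And>x. f x \<in> borel_measurable M"
    and cont: "\<And>w. w \<in> space M \<Longrightarrow> continuous_on UNIV (\<lambda>x. f x w)"
  shows "(\<lambda>(x, w). f x w) \<in> borel_measurable (borel \<Otimes>\<^sub>M M)"
proof -
  obtain F :: "nat \<Rightarrow> 'x \<Rightarrow> 'x" where F: "\<And>i. simple_function borel (F i)" "\<And>x. (\<lambda>i. F i x) \<longlonglongrightarrow> x"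
    using borel_measurable_implies_sequence_metric[of "\<lambda>x::'x. x" borel 0] by auto
  have "(\<lambda>p. f (F i (fst p)) (snd p)) \<in> borel_measurable (borel \<Otimes>\<^sub>M M)" for i
  proof (rule measurable_compose_countable'[where I="range (F i)" and f="\<lambda>z p. f z (snd p)"])
    show "(\<lambda>p. F i (fst p)) \<in> borel \<Otimes>\<^sub>M M \<rightarrow>\<^sub>M count_space (range (F i))"
    proof (rule measurable_compose[OF measurable_fst])
      have "F i \<in> borel \<rightarrow>\<^sub>M count_space UNIV"
        by (rule measurable_simple_function[OF F(1)])
      then show "F i \<in> borel \<rightarrow>\<^sub>M count_space (range (F i))"
        by (simp add: measurable_def)
    qed
    show "countable (range (F i))"
      using simple_functionD(1)[OF F(1)[of i]] by (simp add: countable_finite)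
  qed (use f in \<open>auto intro: measurable_compose[OF measurable_snd]\<close>)
  then have "(\<lambda>p. f (fst p) (snd p)) \<in> borel_measurable (borel \<Otimes>\<^sub>M M)"
  proof (rule borel_measurable_LIMSEQ_metric)
    fix p :: "'x \<times> 'a" assume "p \<in> space (borel \<Otimes>\<^sub>M M)"
    then have "snd p \<in> space M" by (auto simp: space_pair_measure)
    then show "(\<lambda>i. f (F i (fst p)) (snd p)) \<longlonglongrightarrow> f (fst p) (snd p)"
      using cont F(2) by (intro isCont_tendsto_compose[of _ "\<lambda>x. f x (snd p)"]) (auto simp: continuous_on_eq_continuous_at)
  qed
  then show ?thesis by (simp add: split_beta')
qed

text \<open>The conditional law given \<open>A\<close>, with a real-valued density so that Bochner integrals transfer
directly. With Lebesgue measure and an interval it also serves as the uniform distribution.\<close>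

definition cond_law :: "'b measure \<Rightarrow> 'b set \<Rightarrow> 'b measure" where
  "cond_law P A = density P (\<lambda>b. ennreal (indicator A b / measure P A))"

lemma sets_cond_law [simp, measurable_cong]: "sets (cond_law P A) = sets P"
  by (simp add: cond_law_def)

lemma space_cond_law [simp]: "space (cond_law P A) = space P"
  by (simp add: cond_law_def)

lemma nn_integral_cond_law:
  assumes [measurable]: "A \<in> sets P" "f \<in> borel_measurable P" and "0 < measure P A"
  shows "(\<integral>\<^sup>+b. f b \<partial>cond_law P A) = ennreal (1 / measure P A) * (\<integral>\<^sup>+b. f b * indicator A b \<partial>P)"
proof -
  have "(\<integral>\<^sup>+b. f b \<partial>cond_law P A) = (\<integral>\<^sup>+b. ennreal (1 / measure P A) * (f b * indicator A b) \<partial>P)"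
    unfolding cond_law_def
    by (subst nn_integral_density) (auto intro!: nn_integral_cong split: split_indicator simp: mult_ac)
  then show ?thesis by (simp add: nn_integral_cmult)
qed

lemma integral_cond_law:
  fixes f :: "'b \<Rightarrow> real"
  assumes [measurable]: "A \<in> sets P" "f \<in> borel_measurable P" and "0 < measure P A"
  shows "(LINT b|cond_law P A. f b) = (LINT b:A|P. f b) / measure P A"
  unfolding cond_law_def set_lebesgue_integral_def
  by (subst integral_real_density) auto

lemma prob_space_cond_law:
  assumes [measurable]: "A \<in> sets P" and "0 < measure P A"
  shows "prob_space (cond_law P A)"
proof
  have "emeasure P A \<noteq> \<infinity>" using assms(2) by (auto simp: measure_def)
  then have "emeasure P A = ennreal (measure P A)" by (simp add: emeasure_eq_ennreal_measure)
  then have "(\<integral>\<^sup>+b. 1 \<partial>cond_law P A) = 1"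
    using assms by (subst nn_integral_cond_law) (auto simp: ennreal_mult[symmetric])
  then show "emeasure (cond_law P A) (space (cond_law P A)) = 1" by simp
qed

lemma AE_cond_law:
  assumes [measurable]: "A \<in> sets P" and "0 < measure P A"
  shows "AE b in cond_law P A. b \<in> A"
  unfolding cond_law_def by (subst AE_density) (auto split: split_indicator)

text \<open>A continuous path up to time \<open>t\<close>: the common setting of the Brownian motion, for the upper bounds,
and of its conditional law given an event, for the lower bound.\<close>

locale random_path = prob_space P for P :: "'b measure" +
  fixes W :: "real \<Rightarrow> 'b \<Rightarrow> real ^ 'n::finite" and t :: real
  assumes t_pos: "t > 0"
    and W_measurable: "\<And>s. 0 \<le> s \<Longrightarrow> W s \<in> borel_measurable P"
    and W_continuous: "\<And>b. b \<in> space P \<Longrightarrow> continuous_on {0..} (\<lambda>s. W s b)"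
begin

text \<open>Time is extended to the real line by \<open>max 0 s\<close>, which keeps the path continuous.\<close>

lemma W_joint: "(\<lambda>(s, b). W (max 0 s) b) \<in> borel_measurable (borel \<Otimes>\<^sub>M P)"
proof (rule measurable_continuous_parameter)
  show "W (max 0 s) \<in> borel_measurable P" for s by (rule W_measurable) simp
  show "continuous_on UNIV (\<lambda>s. W (max 0 s) b)" if "b \<in> space P" for b
    by (rule continuous_on_compose2[OF W_continuous[OF that]]) (auto intro!: continuous_intros)
qed

lemma W_joint' [measurable (raw)]:
  assumes "f \<in> borel_measurable N" "g \<in> N \<rightarrow>\<^sub>M P"
  shows "(\<lambda>v. W (max 0 (f v)) (g v)) \<in> borel_measurable N"
  using measurable_compose[OF measurable_Pair[OF assms] W_joint] by (simp only: split)

definition time_law :: "real measure" where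
  "time_law = cond_law lborel {0..t}"

lemma sets_time_law [simp, measurable_cong]: "sets time_law = sets borel"
  by (simp add: time_law_def)

lemma prob_space_time_law: "prob_space time_law"
  unfolding time_law_def using t_pos by (intro prob_space_cond_law) auto

sublocale U: prob_space time_law by (rule prob_space_time_law)
sublocale UP: pair_prob_space time_law P ..

text \<open>The occupation measure: the law of the position at an independent, uniformly distributed time in
\<open>[0, t]\<close>.\<close>

definition occ :: "(real ^ 'n) measure" where
  "occ = distr (time_law \<Otimes>\<^sub>M P) borel (\<lambda>(s, b). W (max 0 s) b)"

lemma sets_occ [simp, measurable_cong]: "sets occ = sets borel"
  by (simp add: occ_def)

lemma prob_space_occ: "prob_space occ"
  unfolding occ_def by (rule UP.prob_space_distr) measurable

sublocale occ: prob_space occ by (rule prob_space_occ)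

lemma nn_integral_occ:
  assumes [measurable]: "f \<in> borel_measurable borel"
  shows "(\<integral>\<^sup>+y. f y \<partial>occ) = (\<integral>\<^sup>+b. \<integral>\<^sup>+s. f (W (max 0 s) b) \<partial>time_law \<partial>P)"
proof -
  have "(\<integral>\<^sup>+y. f y \<partial>occ) = (\<integral>\<^sup>+p. f (W (max 0 (fst p)) (snd p)) \<partial>(time_law \<Otimes>\<^sub>M P))"
    unfolding occ_def by (subst nn_integral_distr) (auto simp: split_beta')
  also have "\<dots> = (\<integral>\<^sup>+b. \<integral>\<^sup>+s. f (W (max 0 s) b) \<partial>time_law \<partial>P)"
    by (subst UP.nn_integral_snd[symmetric]) auto
  finally show ?thesis .
qed

lemma nn_integral_occ':
  assumes [measurable]: "f \<in> borel_measurable borel"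
  shows "(\<integral>\<^sup>+y. f y \<partial>occ) = (\<integral>\<^sup>+s. \<integral>\<^sup>+b. f (W (max 0 s) b) \<partial>P \<partial>time_law)"
proof -
  have "(\<lambda>(s, b). f (W (max 0 s) b)) \<in> borel_measurable (time_law \<Otimes>\<^sub>M P)"
    by measurable
  from UP.Fubini'[OF this] show ?thesis
    unfolding nn_integral_occ[OF assms] .
qed

lemma nn_integral_occ_le:
  assumes [measurable]: "f \<in> borel_measurable borel"
    and le: "\<And>s. 0 \<le> s \<Longrightarrow> s \<le> t \<Longrightarrow> (\<integral>\<^sup>+b. f (W s b) \<partial>P) \<le> C"
  shows "(\<integral>\<^sup>+y. f y \<partial>occ) \<le> C"
proof -
  have "(\<integral>\<^sup>+y. f y \<partial>occ) \<le> (\<integral>\<^sup>+s. C \<partial>time_law)"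
    unfolding nn_integral_occ'[OF assms(1)]
  proof (rule nn_integral_mono_AE)
    have "AE s in time_law. s \<in> {0..t}"
      unfolding time_law_def using t_pos by (intro AE_cond_law) auto
    then show "AE s in time_law. (\<integral>\<^sup>+b. f (W (max 0 s) b) \<partial>P) \<le> C"
      by eventually_elim (use le in \<open>auto simp: max_def\<close>)
  qed
  then show ?thesis by (simp add: U.emeasure_space_1)
qed

abbreviation path_integral :: "(real ^ 'n \<Rightarrow> real) \<Rightarrow> 'b \<Rightarrow> real" where
  "path_integral V b \<equiv> (LINT s:{0..t}|lborel. V (W s b))"

lemma path_integral_eq:
  assumes V: "continuous_on UNIV V" and b: "b \<in> space P"
  shows "path_integral V b = t * (LINT s|time_law. V (W (max 0 s) b))"
    and "integrable time_law (\<lambda>s. V (W (max 0 s) b))"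
    and "integrable time_law (\<lambda>s. exp (t * V (W (max 0 s) b)))"
proof -
  have c: "continuous_on UNIV (\<lambda>s. W (max 0 s) b)"
    by (rule continuous_on_compose2[OF W_continuous[OF b]]) (auto intro!: continuous_intros)
  then have cV: "continuous_on UNIV (\<lambda>s. V (W (max 0 s) b))"
    by (rule continuous_on_compose2[OF V]) auto
  have [measurable]: "(\<lambda>s. V (W (max 0 s) b)) \<in> borel_measurable borel"
    by (rule borel_measurable_continuous_onI[OF cV])
  have "(LINT s|time_law. V (W (max 0 s) b)) = (LINT s:{0..t}|lborel. V (W (max 0 s) b)) / t"
    unfolding time_law_def using t_pos by (subst integral_cond_law) auto
  also have "(LINT s:{0..t}|lborel. V (W (max 0 s) b)) = path_integral V b"
    by (rule set_lebesgue_integral_cong) (auto simp: max_def)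
  finally show "path_integral V b = t * (LINT s|time_law. V (W (max 0 s) b))"
    using t_pos by simp
  have *: "integrable time_law g" if g: "continuous_on UNIV g" for g :: "real \<Rightarrow> real"
  proof -
    have "compact (g ` {0..t})"
      by (rule compact_continuous_image[OF continuous_on_subset[OF g]]) auto
    then obtain B where B: "\<And>x. x \<in> {0..t} \<Longrightarrow> norm (g x) \<le> B"
      using compact_imp_bounded by (fastforce simp: bounded_iff)
    have "AE s in time_law. s \<in> {0..t}"
      unfolding time_law_def using t_pos by (intro AE_cond_law) auto
    then show ?thesis
      using B borel_measurable_continuous_onI[OF g] by (intro U.integrable_const_bound[where B=B]) (auto elim: eventually_mono)
  qed
  show "integrable time_law (\<lambda>s. V (W (max 0 s) b))" by (rule *[OF cV])
  show "integrable time_law (\<lambda>s. exp (t * V (W (max 0 s) b)))"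
    by (rule *) (intro continuous_intros cV)
qed

text \<open>Jensen's inequality in the time variable.\<close>

lemma exp_path_integral_le:
  assumes V: "continuous_on UNIV V" and b: "b \<in> space P"
  shows "ennreal (exp (path_integral V b)) \<le> (\<integral>\<^sup>+s. ennreal (exp (t * V (W (max 0 s) b))) \<partial>time_law)"
proof -
  note i = path_integral_eq[OF V b]
  have "exp (U.expectation (\<lambda>s. t * V (W (max 0 s) b))) \<le> U.expectation (\<lambda>s. exp (t * V (W (max 0 s) b)))"
    by (rule U.jensens_inequality[where I=UNIV]) (use i exp_convex in auto)
  then have "ennreal (exp (path_integral V b)) \<le> ennreal (LINT s|time_law. exp (t * V (W (max 0 s) b)))"
    unfolding i(1) by (intro ennreal_leI) simp
  also have "\<dots> = (\<integral>\<^sup>+s. ennreal (exp (t * V (W (max 0 s) b))) \<partial>time_law)"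
    by (rule nn_integral_eq_integral[symmetric]) (use i in auto)
  finally show ?thesis .
qed

lemma nn_integral_exp_path_le:
  assumes V: "continuous_on UNIV V"
  shows "(\<integral>\<^sup>+b. ennreal (exp (path_integral V b)) \<partial>P) \<le> (\<integral>\<^sup>+y. ennreal (exp (t * V y)) \<partial>occ)"
proof -
  have [measurable]: "V \<in> borel_measurable borel" by (rule borel_measurable_continuous_onI[OF V])
  show ?thesis
    by (subst nn_integral_occ, measurable) (intro nn_integral_mono exp_path_integral_le V)
qed

lemma integral_occ:
  fixes V :: "real ^ 'n \<Rightarrow> real"
  assumes V: "continuous_on UNIV V" and int: "integrable occ V"
  shows "integrable P (path_integral V)"
    and "(LINT b|P. path_integral V b) = t * (LINT y|occ. V y)"
proof -
  have [measurable]: "V \<in> borel_measurable borel" by (rule borel_measurable_continuous_onI[OF V])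
  have i: "integrable (time_law \<Otimes>\<^sub>M P) (\<lambda>(s, b). V (W (max 0 s) b))"
    using int unfolding occ_def by (subst (asm) integrable_distr_eq) (auto simp: split_beta')
  have j: "integrable P (\<lambda>b. t * (LINT s|time_law. V (W (max 0 s) b)))"
    using UP.integrable_snd[OF i] by simp
  have "integrable P (path_integral V) \<longleftrightarrow> integrable P (\<lambda>b. t * (LINT s|time_law. V (W (max 0 s) b)))"
    by (rule Bochner_Integration.integrable_cong) (auto intro: path_integral_eq(1)[OF V])
  with j show "integrable P (path_integral V)" by simp
  have "(LINT b|P. path_integral V b) = (LINT b|P. t * (LINT s|time_law. V (W (max 0 s) b)))"
    by (rule Bochner_Integration.integral_cong) (auto intro: path_integral_eq(1)[OF V])
  also have "\<dots> = t * (LINT y|occ. V y)"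
    using UP.integral_snd[OF i] unfolding occ_def by (subst integral_distr) (auto simp: split_beta')
  finally show "(LINT b|P. path_integral V b) = t * (LINT y|occ. V y)" .
qed

text \<open>Jensen's inequality over the paths; the time integral of \<open>V\<close> along the path has mean \<open>t\<close> times the
mean of \<open>V\<close> under the occupation measure.\<close>

lemma exp_integral_occ_le:
  assumes V: "continuous_on UNIV V" and int: "integrable occ V"
    and e: "integrable P (\<lambda>b. exp (path_integral V b))"
  shows "exp (t * (LINT y|occ. V y)) \<le> (LINT b|P. exp (path_integral V b))"
  unfolding integral_occ(2)[OF V int, symmetric]
  by (rule jensens_inequality[where I=UNIV]) (use integral_occ[OF V int] e exp_convex in auto)

lemma random_path_cond_law:
  assumes "A \<in> sets P" "0 < measure P A"
  shows "random_path (cond_law P A) W t"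
proof -
  interpret Q: prob_space "cond_law P A" by (rule prob_space_cond_law[OF assms])
  show ?thesis
    by standard (use t_pos W_measurable W_continuous in \<open>auto simp: cond_law_def\<close>)
qed

end

section \<open>Gaussian fields\<close>

lemma abs_le_exp: "\<bar>x\<bar> \<le> exp x + exp (- x)" for x :: real
proof -
  have "x < exp x" "- x < exp (- x)" by (rule exp_gt_self)+
  moreover have "0 < exp x" "0 < exp (- x)" by simp_all
  ultimately show ?thesis by linarith
qed

text \<open>A centred stationary Gaussian field, given by the joint exponential moments of pairs of its values.\<close>

locale gaussian_field = prob_space M for M :: "'a measure" +
  fixes X :: "real ^ 'n::finite \<Rightarrow> 'a \<Rightarrow> real" and k :: "real ^ 'n \<Rightarrow> real"
  assumes X_measurable: "\<And>x. X x \<in> borel_measurable M"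
    and X_continuous: "\<And>w. w \<in> space M \<Longrightarrow> continuous_on UNIV (\<lambda>x. X x w)"
    and mgf: "\<And>x y a b. (\<integral>\<^sup>+w. ennreal (exp (a * X x w + b * X y w)) \<partial>M) =
      ennreal (exp ((a\<^sup>2 + b\<^sup>2) / 2 * k 0 + a * b * k (x - y)))"
    and k_nonneg: "\<And>z. 0 \<le> k z"
    and k_measurable [measurable]: "k \<in> borel_measurable borel"
begin

lemma X_joint: "(\<lambda>(x, w). X x w) \<in> borel_measurable (borel \<Otimes>\<^sub>M M)"
  by (rule measurable_continuous_parameter[OF X_measurable X_continuous])

lemma X_joint' [measurable (raw)]:
  assumes "f \<in> borel_measurable N" "g \<in> N \<rightarrow>\<^sub>M M"
  shows "(\<lambda>v. X (f v) (g v)) \<in> borel_measurable N"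
  using measurable_compose[OF measurable_Pair[OF assms] X_joint] by (simp only: split)

lemma mgf1: "(\<integral>\<^sup>+w. ennreal (exp (a * X x w)) \<partial>M) = ennreal (exp (a\<^sup>2 / 2 * k 0))"
  using mgf[of a x 0 x] by simp

lemma mgf_hb: "has_bochner_integral M (\<lambda>w. exp (a * X x w + b * X y w)) (exp ((a\<^sup>2 + b\<^sup>2) / 2 * k 0 + a * b * k (x - y)))"
  by (rule has_bochner_integral_nn_integral) (auto simp: mgf)

lemma mgf1_hb: "has_bochner_integral M (\<lambda>w. exp (a * X x w)) (exp (a\<^sup>2 / 2 * k 0))"
  using mgf_hb[of a x 0 x] by simp

text \<open>The covariance is largest at the origin: in terms of exponential moments this is the inequality
\<open>2 a b \<le> a\<^sup>2 + b\<^sup>2\<close> for \<open>a = exp (X z)\<close> and \<open>b = exp (X 0)\<close>.\<close>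

lemma k_le: "k z \<le> k 0"
proof -
  have "exp (k 0 + k z) = (LINT w|M. exp (1 * X z w + 1 * X 0 w))"
    using has_bochner_integral_integral_eq[OF mgf_hb[of 1 z 1 0]] by simp
  also have "\<dots> \<le> (LINT w|M. (exp (2 * X z w) + exp (2 * X 0 w)) / 2)"
  proof (rule integral_mono)
    show "integrable M (\<lambda>w. exp (1 * X z w + 1 * X 0 w))" by (rule integrable.intros[OF mgf_hb])
    show "integrable M (\<lambda>w. (exp (2 * X z w) + exp (2 * X 0 w)) / 2)"
      by (intro integrable_divide Bochner_Integration.integrable_add integrable.intros[OF mgf1_hb])
    show "exp (1 * X z w + 1 * X 0 w) \<le> (exp (2 * X z w) + exp (2 * X 0 w)) / 2" for w
      using sum_squares_bound[of "exp (X z w)" "exp (X 0 w)"]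
      by (simp add: exp_add exp_double)
  qed
  also have "\<dots> = exp (2 * k 0)"
    using has_bochner_integral_integral_eq[OF mgf1_hb[of 2]] integrable.intros[OF mgf1_hb[of 2]] by simp
  finally show ?thesis by simp
qed

text \<open>The bound is uniform in \<open>y\<close>, so that the increments can be integrated over \<open>y\<close> with Fubini's theorem.\<close>

lemma nn_integral_tilted_abs:
  obtains B where "\<And>y. (\<integral>\<^sup>+w. ennreal (norm (exp (a * X x w) * (X y w - X x w))) \<partial>M) \<le> ennreal B"
proof
  fix y
  let ?B = "\<lambda>c. exp ((c\<^sup>2 + 1) / 2 * k 0 + \<bar>c\<bar> * k 0)"
  have "norm (exp (a * X x w) * (X y w - X x w)) \<le> exp ((a - 1) * X x w + 1 * X y w) + exp ((a + 1) * X x w + (-1) * X y w)" for w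
  proof -
    have "norm (exp (a * X x w) * (X y w - X x w)) \<le> exp (a * X x w) * (exp (X y w - X x w) + exp (- (X y w - X x w)))"
      using mult_left_mono[OF abs_le_exp[of "X y w - X x w"], of "exp (a * X x w)"]
      by (simp add: abs_mult)
    also have "\<dots> = exp ((a - 1) * X x w + 1 * X y w) + exp ((a + 1) * X x w + (-1) * X y w)"
      by (simp add: distrib_left exp_add[symmetric] algebra_simps)
    finally show ?thesis .
  qed
  then have "(\<integral>\<^sup>+w. ennreal (norm (exp (a * X x w) * (X y w - X x w))) \<partial>M) \<le>
    (\<integral>\<^sup>+w. ennreal (exp ((a - 1) * X x w + 1 * X y w)) + ennreal (exp ((a + 1) * X x w + (-1) * X y w)) \<partial>M)"
    by (intro nn_integral_mono) (simp add: ennreal_plus[symmetric] ennreal_leI del: ennreal_plus)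
  also have "\<dots> = ennreal (exp (((a - 1)\<^sup>2 + 1\<^sup>2) / 2 * k 0 + (a - 1) * 1 * k (x - y))) +
      ennreal (exp (((a + 1)\<^sup>2 + (-1)\<^sup>2) / 2 * k 0 + (a + 1) * (-1) * k (x - y)))"
    unfolding mgf[symmetric] by (rule nn_integral_add) (use X_measurable in measurable)
  also have "\<dots> \<le> ennreal (?B (a - 1)) + ennreal (?B (a + 1))"
  proof (intro add_mono ennreal_leI)
    have *: "c * k z \<le> \<bar>c\<bar> * k 0" for c z
      using mult_mono[of c "\<bar>c\<bar>" "k z" "k 0"] k_le k_nonneg by simp
    show "exp (((a - 1)\<^sup>2 + 1\<^sup>2) / 2 * k 0 + (a - 1) * 1 * k (x - y)) \<le> ?B (a - 1)"
      using *[of "a - 1" "x - y"] by simp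
    show "exp (((a + 1)\<^sup>2 + (-1)\<^sup>2) / 2 * k 0 + (a + 1) * (-1) * k (x - y)) \<le> ?B (a + 1)"
      using *[of "- (a + 1)" "x - y"] unfolding abs_minus_cancel by simp
  qed
  finally show "(\<integral>\<^sup>+w. ennreal (norm (exp (a * X x w) * (X y w - X x w))) \<partial>M) \<le> ennreal (?B (a - 1) + ?B (a + 1))"
    by simp
qed

lemma integrable_tilted: "integrable M (\<lambda>w. exp (a * X x w) * (X y w - X x w))"
proof -
  note X_measurable[measurable]
  obtain B where "(\<integral>\<^sup>+w. ennreal (norm (exp (a * X x w) * (X y w - X x w))) \<partial>M) \<le> ennreal B"
    using nn_integral_tilted_abs[of a x] by blast
  then show ?thesis
    by (intro integrableI_bounded) (auto intro: le_less_trans)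
qed

text \<open>Tilting by \<open>exp (a X x)\<close> shifts the mean of \<open>X y\<close> by \<open>a k (x - y)\<close>. The lower bound follows from
exponential moments alone: \<open>1 - b z \<le> exp (- b z)\<close> bounds an increment \<open>z\<close> below by
\<open>(1 - exp (- b z)) / b\<close>, whose tilted mean is explicit, and \<open>b\<close> tends to \<open>0\<close>.\<close>

lemma tilted_increment_ge:
  "- a * (k 0 - k (x - y)) * exp (a\<^sup>2 / 2 * k 0) \<le> (LINT w|M. exp (a * X x w) * (X y w - X x w))"
proof -
  let ?I = "LINT w|M. exp (a * X x w) * (X y w - X x w)"
  let ?c = "k 0 - k (x - y)"
  let ?f = "\<lambda>b. exp ((a * b + b\<^sup>2) * ?c)"
  have "(?f has_real_derivative a * ?c) (at 0)"
    by (auto intro!: derivative_eq_intros)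
  then have "(\<lambda>b. (?f (0 + b) - ?f 0) / b) \<midarrow>0\<rightarrow> a * ?c"
    by (simp add: DERIV_def)
  then have "((\<lambda>b. (?f b - 1) / b) \<longlongrightarrow> a * ?c) (at_right 0)"
    by (auto intro: tendsto_mono[OF at_le])
  then have "((\<lambda>b. exp (a\<^sup>2 / 2 * k 0) * - ((?f b - 1) / b)) \<longlongrightarrow> exp (a\<^sup>2 / 2 * k 0) * - (a * ?c)) (at_right 0)"
    by (intro tendsto_intros)
  moreover have "eventually (\<lambda>b. exp (a\<^sup>2 / 2 * k 0) * - ((?f b - 1) / b) \<le> ?I) (at_right 0)"
    using eventually_at_right_less[of 0]
  proof eventually_elim
    case (elim b)
    let ?g = "\<lambda>w. (exp (a * X x w) - exp ((a + b) * X x w + - b * X y w)) / b"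
    have "(LINT w|M. ?g w) \<le> ?I"
    proof (rule integral_mono)
      show "integrable M ?g"
        by (intro integrable_divide Bochner_Integration.integrable_diff integrable.intros[OF mgf1_hb] integrable.intros[OF mgf_hb])
      fix w
      let ?d = "X y w - X x w"
      have "1 - b * ?d \<le> exp (- (b * ?d))" using exp_ge_add_one_self[of "- (b * ?d)"] by simp
      from mult_left_mono[OF this, of "exp (a * X x w)"]
      have "exp (a * X x w) * (1 - b * ?d) \<le> exp (a * X x w + - (b * ?d))"
        unfolding exp_add by simp
      also have "a * X x w + - (b * ?d) = (a + b) * X x w + - b * X y w" by (simp add: algebra_simps)
      finally have "exp (a * X x w) - exp ((a + b) * X x w + - b * X y w) \<le> b * (exp (a * X x w) * ?d)"
        by (simp add: algebra_simps)
      then show "?g w \<le> exp (a * X x w) * ?d"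
        using elim by (simp add: pos_divide_le_eq mult.commute)
    qed (rule integrable_tilted)
    moreover have "(LINT w|M. ?g w) =
       (exp (a\<^sup>2 / 2 * k 0) - exp (((a + b)\<^sup>2 + (- b)\<^sup>2) / 2 * k 0 + (a + b) * - b * k (x - y))) / b"
      by (intro has_bochner_integral_integral_eq has_bochner_integral_divide has_bochner_integral_diff mgf1_hb mgf_hb)
    moreover have "exp (((a + b)\<^sup>2 + (- b)\<^sup>2) / 2 * k 0 + (a + b) * - b * k (x - y)) = exp (a\<^sup>2 / 2 * k 0) * ?f b"
      unfolding exp_add[symmetric] by (simp add: field_simps power2_eq_square)
    ultimately show ?case
      by (simp add: right_diff_distrib diff_divide_distrib)
  qed
  ultimately have "exp (a\<^sup>2 / 2 * k 0) * - (a * ?c) \<le> ?I"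
    by (rule tendsto_upperbound) simp
  then show ?thesis by (simp add: mult_ac)
qed

end

section \<open>Moments of the Feynman-Kac functional of a Gaussian field\<close>

locale field_and_path = F: gaussian_field M X k + R: random_path P W t
  for M :: "'a measure" and X :: "real ^ 'n::finite \<Rightarrow> 'a \<Rightarrow> real" and k
    and P :: "'b measure" and W :: "real \<Rightarrow> 'b \<Rightarrow> real ^ 'n" and t :: real
begin

sublocale MO: pair_prob_space M R.occ ..

definition u :: "'a \<Rightarrow> real" where
  "u w = (LINT b|P. exp (LINT s:{0..t}|lborel. X (W s b) w))"

text \<open>The exponent of the Feynman-Kac functional, written as an integral over \<open>time_law\<close> so that it is
jointly measurable in the field and the path.\<close>

definition exponent :: "'a \<Rightarrow> 'b \<Rightarrow> real" where
  "exponent w b = t * (LINT s|R.time_law. X (W (max 0 s) b) w)"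

lemma exponent_eq:
  assumes "w \<in> space M" "b \<in> space P"
  shows "(LINT s:{0..t}|lborel. X (W s b) w) = exponent w b"
  unfolding exponent_def by (rule R.path_integral_eq(1)[OF F.X_continuous[OF assms(1)] assms(2)])

lemma exponent_measurable: "(\<lambda>(w, b). exponent w b) \<in> borel_measurable (M \<Otimes>\<^sub>M P)"
  unfolding exponent_def by measurable

lemma exponent_measurable' [measurable (raw)]:
  assumes "f \<in> N \<rightarrow>\<^sub>M M" "g \<in> N \<rightarrow>\<^sub>M P"
  shows "(\<lambda>v. exponent (f v) (g v)) \<in> borel_measurable N"
  using measurable_compose[OF measurable_Pair[OF assms] exponent_measurable] by (simp only: split)

lemma u_eq: "w \<in> space M \<Longrightarrow> u w = (LINT b|P. exp (exponent w b))"
  unfolding u_def by (intro Bochner_Integration.integral_cong) (auto simp: exponent_eq)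

lemma u_measurable [measurable]: "u \<in> borel_measurable M"
proof -
  have "(\<lambda>w. LINT b|P. exp (exponent w b)) \<in> borel_measurable M" by measurable
  then show ?thesis by (subst measurable_cong[OF u_eq])
qed

lemma u_nonneg: "0 \<le> u w"
  unfolding u_def by (simp add: integral_nonneg_AE)

lemma nn_integral_exp_exponent_le:
  assumes "w \<in> space M"
  shows "(\<integral>\<^sup>+b. ennreal (exp (exponent w b)) \<partial>P) \<le> (\<integral>\<^sup>+y. ennreal (exp (t * X y w)) \<partial>R.occ)"
proof -
  have "(\<integral>\<^sup>+b. ennreal (exp (exponent w b)) \<partial>P) = (\<integral>\<^sup>+b. ennreal (exp (LINT s:{0..t}|lborel. X (W s b) w)) \<partial>P)"
    by (intro nn_integral_cong) (simp add: exponent_eq assms)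
  then show ?thesis using R.nn_integral_exp_path_le[OF F.X_continuous[OF assms]] by simp
qed

lemma nn_integral_occ_field:
  assumes [measurable]: "g \<in> borel_measurable borel"
  shows "(\<integral>\<^sup>+w. \<integral>\<^sup>+y. g (X y w) \<partial>R.occ \<partial>M) = (\<integral>\<^sup>+y. \<integral>\<^sup>+w. g (X y w) \<partial>M \<partial>R.occ)"
proof -
  have "(\<lambda>(w, y). g (X y w)) \<in> borel_measurable (M \<Otimes>\<^sub>M R.occ)" by measurable
  from MO.Fubini'[OF this] show ?thesis by simp
qed

lemma AE_occ_exp_finite: "AE w in M. (\<integral>\<^sup>+y. ennreal (exp (a * X y w)) \<partial>R.occ) < \<infinity>"
proof -
  have "(\<integral>\<^sup>+w. \<integral>\<^sup>+y. ennreal (exp (a * X y w)) \<partial>R.occ \<partial>M) = ennreal (exp (a\<^sup>2 / 2 * k 0))"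
    by (subst nn_integral_occ_field[of "\<lambda>x. ennreal (exp (a * x))"])
      (auto simp: F.mgf1 R.occ.emeasure_space_1)
  then have "AE w in M. (\<integral>\<^sup>+y. ennreal (exp (a * X y w)) \<partial>R.occ) \<noteq> \<infinity>"
    by (intro nn_integral_noteq_infinite) auto
  then show ?thesis by eventually_elim (simp add: less_top)
qed

lemma AE_integrable_exponent: "AE w in M. integrable P (\<lambda>b. exp (exponent w b))"
  using AE_occ_exp_finite[of t] AE_space
proof eventually_elim
  case (elim w)
  then show ?case
    using le_less_trans[OF nn_integral_exp_exponent_le]
    by (intro integrableI_bounded) auto
qed

lemma AE_integrable: "AE w in M. integrable P (\<lambda>b. exp (LINT s:{0..t}|lborel. X (W s b) w))"
  using AE_integrable_exponent AE_space
proof eventually_elim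
  case (elim w)
  have "integrable P (\<lambda>b. exp (LINT s:{0..t}|lborel. X (W s b) w)) \<longleftrightarrow> integrable P (\<lambda>b. exp (exponent w b))"
    by (rule Bochner_Integration.integrable_cong) (simp_all add: exponent_eq elim)
  then show ?case using elim by simp
qed

lemma AE_ennreal_u: "AE w in M. ennreal (u w) = (\<integral>\<^sup>+b. ennreal (exp (exponent w b)) \<partial>P)"
  using AE_integrable_exponent AE_space
  by eventually_elim (simp add: u_eq nn_integral_eq_integral)

lemma AE_u_pos: "AE w in M. 0 < u w"
  using AE_integrable_exponent AE_space
proof eventually_elim
  case (elim w)
  show ?case unfolding u_eq[OF elim(2)]
    by (rule R.integral_less_AE_space[where X="\<lambda>_. 0", simplified]) (use elim R.emeasure_space_1 in auto)
qed

lemma AE_u_le: "AE w in M. ennreal (u w) \<le> (\<integral>\<^sup>+y. ennreal (exp (t * X y w)) \<partial>R.occ)"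
  using AE_ennreal_u AE_space by eventually_elim (simp add: nn_integral_exp_exponent_le)

text \<open>For \<open>p \<ge> 1\<close>, Jensen's inequality passes the power under the occupation measure.\<close>

lemma moment_le_ge1:
  assumes p: "p \<ge> 1"
  shows "(\<integral>\<^sup>+w. ennreal (u w powr p) \<partial>M) \<le> ennreal (exp (p\<^sup>2 * t\<^sup>2 / 2 * k 0))"
proof -
  have "(\<integral>\<^sup>+w. ennreal (u w powr p) \<partial>M) \<le> (\<integral>\<^sup>+w. \<integral>\<^sup>+y. ennreal (exp ((p * t) * X y w)) \<partial>R.occ \<partial>M)"
  proof (rule nn_integral_mono_AE)
    show "AE w in M. ennreal (u w powr p) \<le> (\<integral>\<^sup>+y. ennreal (exp ((p * t) * X y w)) \<partial>R.occ)"
      using AE_u_le AE_occ_exp_finite[of t] AE_occ_exp_finite[of "p * t"] AE_space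
    proof eventually_elim
      case (elim w)
      have [measurable]: "(\<lambda>y. X y w) \<in> borel_measurable borel"
        by (rule borel_measurable_continuous_onI[OF F.X_continuous[OF elim(4)]])
      have i1: "integrable R.occ (\<lambda>y. exp (t * X y w))" using elim by (intro integrableI_bounded) auto
      have i2: "integrable R.occ (\<lambda>y. exp ((p * t) * X y w))" using elim by (intro integrableI_bounded) auto
      have pw: "exp (t * X y w) powr p = exp ((p * t) * X y w)" for y
        by (simp add: powr_def mult_ac)
      have "u w \<le> (LINT y|R.occ. exp (t * X y w))"
        using elim(1) by (subst (asm) nn_integral_eq_integral[OF i1]) (auto simp: integral_nonneg_AE)
      then have "u w powr p \<le> (LINT y|R.occ. exp (t * X y w)) powr p"
        using p by (intro powr_mono2) (auto simp: u_nonneg)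
      also have "\<dots> \<le> (LINT y|R.occ. exp ((p * t) * X y w))"
        using R.occ.jensens_inequality[where I="{0<..}" and a=0 and X="\<lambda>y. exp (t * X y w)" and q="\<lambda>x. x powr p"]
          i1 i2 powr_convex[OF p] by (simp add: pw)
      finally show ?case
        by (subst nn_integral_eq_integral[OF i2]) (auto simp: ennreal_leI)
    qed
  qed
  also have "\<dots> = ennreal (exp (p\<^sup>2 * t\<^sup>2 / 2 * k 0))"
    by (subst nn_integral_occ_field[of "\<lambda>x. ennreal (exp ((p * t) * x))"])
      (auto simp: F.mgf1 R.occ.emeasure_space_1 power_mult_distrib)
  finally show ?thesis .
qed

text \<open>The number \<open>\<kappa>\<close> measures how far the covariance drops on average along paths conditioned on
\<open>A\<close>. After restriction to \<open>A\<close> and Jensen's inequality one needs a lower bound for the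
expectation of \<open>exp (a G)\<close>, where \<open>a = p t\<close> and \<open>G\<close> is the mean of the field under the conditional
occupation measure. The tangent of the exponential at a suitable random point is linear in \<open>G\<close>, which
reduces the expectation to tilted means of single increments of the field.\<close>

lemma moment_ge:
  assumes A [measurable]: "A \<in> sets P" and pos: "0 < measure P A" and p: "p > 0"
    and \<kappa>: "(\<integral>\<^sup>+y. ennreal (k 0 - k (x - y)) \<partial>(random_path.occ (cond_law P A) W t)) \<le> ennreal \<kappa>" "0 \<le> \<kappa>"
    and int: "integrable M (\<lambda>w. u w powr p)"
  shows "measure P A powr p * exp (p\<^sup>2 * t\<^sup>2 * (k 0 / 2 - \<kappa>)) \<le> (LINT w|M. u w powr p)"
proof -
  define a where "a = p * t"
  have a: "a > 0" using p R.t_pos by (simp add: a_def)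
  interpret Q: random_path "cond_law P A" W t by (rule R.random_path_cond_law[OF A pos])
  interpret FQ: field_and_path M X k "cond_law P A" W t ..
  define G where "G w = (LINT y|Q.occ. X y w)" for w
  have G_meas [measurable]: "G \<in> borel_measurable M" unfolding G_def by measurable
  have AE_int: "AE w in M. integrable Q.occ (\<lambda>y. X y w)"
    using FQ.AE_occ_exp_finite[of 1] FQ.AE_occ_exp_finite[of "-1"] AE_space
  proof eventually_elim
    case (elim w)
    have [measurable]: "(\<lambda>y. X y w) \<in> borel_measurable borel"
      by (rule borel_measurable_continuous_onI[OF F.X_continuous[OF elim(3)]])
    have "integrable Q.occ (\<lambda>y. exp (X y w))" "integrable Q.occ (\<lambda>y. exp (- X y w))"
      using elim by (auto intro!: integrableI_bounded)
    then have "integrable Q.occ (\<lambda>y. exp (X y w) + exp (- X y w))" by simp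
    then show ?case
      by (rule Bochner_Integration.integrable_bound) (auto intro!: order_trans[OF abs_le_exp])
  qed
  \<comment> \<open>The tangent is taken at \<open>a X x w + m\<close>, which gives the factor \<open>exp m * (1 - m - a\<^sup>2 \<kappa>)\<close> below.
    It is largest for this \<open>m\<close>.\<close>
  define m where "m = - a\<^sup>2 * \<kappa>"
  have low: "AE w in M. measure P A powr p * (exp m * ((1 - m) * exp (a * X x w) + a * (exp (a * X x w) * (G w - X x w)))) \<le> u w powr p"
    using AE_int AE_integrable_exponent FQ.AE_integrable AE_space
  proof eventually_elim
    case (elim w)
    have "exp (t * G w) \<le> (LINT b|cond_law P A. exp (LINT s:{0..t}|lborel. X (W s b) w))"
      unfolding G_def by (rule Q.exp_integral_occ_le) (use elim F.X_continuous in auto)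
    also have "\<dots> = (LINT b|cond_law P A. exp (exponent w b))"
      by (rule Bochner_Integration.integral_cong) (auto simp: exponent_eq elim)
    also have "\<dots> = (LINT b:A|P. exp (exponent w b)) / measure P A"
      by (rule integral_cond_law[OF A _ pos]) (use elim in measurable)
    also have "\<dots> \<le> (LINT b|P. exp (exponent w b)) / measure P A"
      unfolding set_lebesgue_integral_def using elim pos
      by (intro divide_right_mono integral_mono integrable_mult_indicator) (auto split: split_indicator)
    finally have "measure P A * exp (t * G w) \<le> u w"
      using pos elim by (simp add: u_eq field_simps)
    then have "(measure P A * exp (t * G w)) powr p \<le> u w powr p"
      using p pos by (intro powr_mono2) auto
    moreover have "(measure P A * exp (t * G w)) powr p = measure P A powr p * exp (a * G w)"
      using pos by (simp add: powr_mult powr_def[of "exp _"] a_def mult_ac)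
    moreover have "exp (a * X x w + m) * (1 + (a * G w - (a * X x w + m))) \<le> exp (a * G w)"
      using mult_left_mono[OF exp_ge_add_one_self[of "a * G w - (a * X x w + m)"], of "exp (a * X x w + m)"]
      by (simp flip: exp_add)
    moreover have "exp (a * X x w + m) * (1 + (a * G w - (a * X x w + m))) =
      exp m * ((1 - m) * exp (a * X x w) + a * (exp (a * X x w) * (G w - X x w)))"
      by (simp add: exp_add algebra_simps)
    ultimately show ?case
      using mult_left_mono[of _ _ "measure P A powr p"] by (metis order_trans powr_ge_zero)
  qed
  have intX: "integrable M (\<lambda>w. exp (a * X x w))" by (rule integrable.intros[OF F.mgf1_hb])
  have meanX: "(LINT w|M. exp (a * X x w)) = exp (a\<^sup>2 / 2 * k 0)"
    by (rule has_bochner_integral_integral_eq[OF F.mgf1_hb])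
  define E where "E = exp (a\<^sup>2 / 2 * k 0)"
  have E: "0 < E" by (simp add: E_def)
  let ?h = "\<lambda>(w, y). exp (a * X x w) * (X y w - X x w)"
  have h_int: "integrable (M \<Otimes>\<^sub>M Q.occ) ?h"
  proof -
    obtain B where B: "\<And>y. (\<integral>\<^sup>+w. ennreal (norm (exp (a * X x w) * (X y w - X x w))) \<partial>M) \<le> ennreal B"
      using F.nn_integral_tilted_abs[of a x] by blast
    have "(\<integral>\<^sup>+p. ennreal (norm (?h p)) \<partial>(M \<Otimes>\<^sub>M Q.occ)) = (\<integral>\<^sup>+y. \<integral>\<^sup>+w. ennreal (norm (?h (w, y))) \<partial>M \<partial>Q.occ)"
      by (subst FQ.MO.nn_integral_snd) auto
    also have "\<dots> \<le> (\<integral>\<^sup>+y. ennreal B \<partial>Q.occ)"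
      using B by (intro nn_integral_mono) simp
    also have "\<dots> < \<infinity>" by (simp add: Q.occ.emeasure_space_1)
    finally show ?thesis by (intro integrableI_bounded) auto
  qed
  have AE_G: "AE w in M. (LINT y|Q.occ. ?h (w, y)) = exp (a * X x w) * (G w - X x w)"
    using AE_int by eventually_elim (simp add: G_def Q.occ.prob_space)
  have intG: "integrable M (\<lambda>w. exp (a * X x w) * (G w - X x w))"
    using FQ.MO.integrable_fst'[OF h_int] AE_G
    by (subst (asm) integrable_cong_AE[OF _ _ AE_G]) auto
  have int_k: "integrable Q.occ (\<lambda>y. k 0 - k (x - y))"
    by (rule Q.occ.integrable_const_bound[where B="k 0"]) (auto simp: F.k_le F.k_nonneg)
  have k_int: "(LINT y|Q.occ. k 0 - k (x - y)) \<le> \<kappa>"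
    using \<kappa> by (subst (asm) nn_integral_eq_integral[OF int_k]) (auto simp: F.k_le)
  have "- a * \<kappa> * E \<le> - a * (LINT y|Q.occ. k 0 - k (x - y)) * E"
    using k_int a E by simp
  also have "\<dots> = (LINT y|Q.occ. - a * (k 0 - k (x - y)) * E)"
    by simp
  also have "\<dots> \<le> (LINT y|Q.occ. (LINT w|M. ?h (w, y)))"
  proof (rule integral_mono)
    show "integrable Q.occ (\<lambda>y. - a * (k 0 - k (x - y)) * E)"
      using int_k by (intro integrable_mult_left integrable_mult_right)
    show "integrable Q.occ (\<lambda>y. LINT w|M. ?h (w, y))"
      using FQ.MO.integrable_snd[of "\<lambda>w y. ?h (w, y)"] h_int by simp
    show "- a * (k 0 - k (x - y)) * E \<le> (LINT w|M. ?h (w, y))" for y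
      using F.tilted_increment_ge[of a x y] by (simp add: E_def)
  qed
  also have "\<dots> = (LINT w|M. (LINT y|Q.occ. ?h (w, y)))"
    using FQ.MO.Fubini_integral[of "\<lambda>w y. ?h (w, y)"] h_int by simp
  also have "\<dots> = (LINT w|M. exp (a * X x w) * (G w - X x w))"
    by (rule integral_cong_AE[OF _ _ AE_G]) auto
  finally have mean: "- a * \<kappa> * E \<le> (LINT w|M. exp (a * X x w) * (G w - X x w))" .
  have "measure P A powr p * (exp m * ((1 - m) * E + a * (- a * \<kappa> * E))) \<le>
      measure P A powr p * (exp m * ((1 - m) * (LINT w|M. exp (a * X x w)) + a * (LINT w|M. exp (a * X x w) * (G w - X x w))))"
    unfolding meanX E_def[symmetric] using a mean by (intro mult_left_mono add_left_mono) auto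
  also have "\<dots> = (LINT w|M. measure P A powr p * (exp m * ((1 - m) * exp (a * X x w) + a * (exp (a * X x w) * (G w - X x w)))))"
    using intX intG by simp
  also have "\<dots> \<le> (LINT w|M. u w powr p)"
    by (rule integral_mono_AE[OF _ int low])
       (intro integrable_mult_right Bochner_Integration.integrable_add intX intG)
  also have "(1 - m) * E + a * (- a * \<kappa> * E) = E"
    by (simp add: m_def power2_eq_square algebra_simps)
  also have "exp m * E = exp (p\<^sup>2 * t\<^sup>2 * (k 0 / 2 - \<kappa>))"
    unfolding E_def exp_add[symmetric] m_def a_def by (simp add: power_mult_distrib algebra_simps)
  finally show ?thesis .
qed

end

text \<open>The corner of the lattice cube of side length \<open>h\<close> that contains \<open>y\<close>.\<close>

definition cell :: "real \<Rightarrow> real ^ 'n \<Rightarrow> real ^ 'n::finite" where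
  "cell h y = (\<Sum>b\<in>Basis. (h * of_int \<lfloor>(y \<bullet> b) / h\<rfloor>) *\<^sub>R b)"

lemma cell_measurable [measurable]: "cell h \<in> borel_measurable borel"
  unfolding cell_def by measurable

lemma cell_inner: "b \<in> Basis \<Longrightarrow> cell h y \<bullet> b = h * of_int \<lfloor>(y \<bullet> b) / h\<rfloor>"
  unfolding cell_def by simp

lemma cell_bounds:
  fixes y :: "real ^ 'n::finite"
  assumes "h > 0" "b \<in> Basis"
  shows "cell h y \<bullet> b \<le> y \<bullet> b" "y \<bullet> b < cell h y \<bullet> b + h"
proof -
  have "of_int \<lfloor>(y \<bullet> b) / h\<rfloor> \<le> (y \<bullet> b) / h" "(y \<bullet> b) / h < of_int \<lfloor>(y \<bullet> b) / h\<rfloor> + 1" by linarith+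
  then have "of_int \<lfloor>(y \<bullet> b) / h\<rfloor> * h \<le> y \<bullet> b" "y \<bullet> b < (of_int \<lfloor>(y \<bullet> b) / h\<rfloor> + 1) * h"
    using assms(1) by (simp_all only: pos_le_divide_eq pos_divide_less_eq)
  then show "cell h y \<bullet> b \<le> y \<bullet> b" "y \<bullet> b < cell h y \<bullet> b + h"
    using assms by (simp_all add: cell_inner algebra_simps)
qed

lemma same_cell_dist:
  fixes y z :: "real ^ 'n::finite"
  assumes h: "h > 0" and "cell h y = cell h z"
  shows "norm (y - z) \<le> real CARD('n) * h"
proof -
  have "norm (y - z) \<le> (\<Sum>b\<in>Basis. \<bar>(y - z) \<bullet> b\<bar>)" by (rule norm_le_l1)
  also have "\<dots> \<le> (\<Sum>b\<in>(Basis :: (real ^ 'n) set). h)"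
  proof (rule sum_mono)
    fix b :: "real ^ 'n" assume b: "b \<in> Basis"
    show "\<bar>(y - z) \<bullet> b\<bar> \<le> h"
      using cell_bounds[OF h b, of y] cell_bounds[OF h b, of z] assms(2) by (simp add: inner_diff_left)
  qed
  finally show ?thesis by simp
qed

lemma cell_dist:
  fixes y :: "real ^ 'n::finite"
  assumes h: "h > 0"
  shows "norm (y - cell h y) \<le> real CARD('n) * h"
proof (rule same_cell_dist[OF h])
  have "cell h (cell h y) = (\<Sum>b\<in>Basis. (h * of_int \<lfloor>(y \<bullet> b) / h\<rfloor>) *\<^sub>R b)"
    unfolding cell_def[of h "cell h y"] using h by (intro sum.cong) (simp_all add: cell_inner)
  then show "cell h y = cell h (cell h y)" by (simp add: cell_def[of h y])
qed

lemma emeasure_cell: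
  fixes y :: "real ^ 'n::finite"
  assumes h: "h > 0"
  shows "ennreal (h ^ CARD('n)) \<le> emeasure lborel {z. cell h z = cell h y}"
proof -
  let ?B = "box (cell h y) (cell h y + h *\<^sub>R One)"
  have "ennreal (h ^ CARD('n)) = emeasure lborel ?B"
    using h by (subst emeasure_lborel_box) (auto simp: inner_add_left)
  also have "\<dots> \<le> emeasure lborel {z. cell h z = cell h y}"
  proof (rule emeasure_mono)
    show "?B \<subseteq> {z. cell h z = cell h y}"
    proof safe
      fix z assume z: "z \<in> ?B"
      show "cell h z = cell h y"
      proof (rule euclidean_eqI)
        fix b :: "real ^ 'n" assume b: "b \<in> Basis"
        have "h * of_int \<lfloor>(y \<bullet> b) / h\<rfloor> < z \<bullet> b" "z \<bullet> b < h * of_int \<lfloor>(y \<bullet> b) / h\<rfloor> + h"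
          using z b by (auto simp: mem_box cell_inner inner_add_left)
        then have "\<lfloor>(z \<bullet> b) / h\<rfloor> = \<lfloor>(y \<bullet> b) / h\<rfloor>"
          using h by (intro floor_unique) (auto simp: field_simps)
        then show "cell h z \<bullet> b = cell h y \<bullet> b" using b by (simp add: cell_inner)
      qed
    qed
  qed measurable
  finally show ?thesis .
qed

context field_and_path
begin

text \<open>Since \<open>x \<mapsto> x powr p\<close> is concave for \<open>p < 1\<close>, Jensen's inequality is replaced by Young's inequality
\<open>u powr p \<le> p u \<Lambda> powr (- q) + (1 - p) \<Lambda>\<close> with \<open>q = (1 - p) / p\<close>. Here \<open>\<Lambda>\<close> is a Gaussian average
of \<open>exp (p t X)\<close>, evaluated at corners of lattice cubes. Its expectation is exactly
\<open>exp (p\<^sup>2 t\<^sup>2 k 0 / 2)\<close>, while the cube of \<open>y\<close> alone shows that \<open>\<Lambda>\<close> is at least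
\<open>exp (p t X (cell h y))\<close> times a deterministic weight. In the product with \<open>exp (t X y)\<close> the latter
leaves \<open>exp (t X y - (1 - p) t X (cell h y))\<close>, whose expectation is again
\<open>exp (p\<^sup>2 t\<^sup>2 k 0 / 2)\<close>, up to the loss of covariance within a cube.\<close>

lemma moment_le_lt1:
  assumes p: "0 < p" "p < 1" and h: "h > 0" and L: "L > 0" and \<eta>: "0 \<le> \<eta>"
    and near: "\<And>z. norm z \<le> real CARD('n) * h \<Longrightarrow> k 0 - k z \<le> \<eta>"
  shows "(\<integral>\<^sup>+w. ennreal (u w powr p) \<partial>M) \<le> ennreal (exp (p\<^sup>2 * t\<^sup>2 / 2 * k 0 + (1 - p) * t\<^sup>2 * \<eta>)) *
    (1 + ennreal ((h ^ CARD('n) * ((2 * pi * L\<^sup>2) powr (- real CARD('n) / 2) * exp (- (real CARD('n) * h)\<^sup>2 / L\<^sup>2))) powr (- (1 - p) / p)) *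
      (\<integral>\<^sup>+y. ennreal (exp ((1 - p) / (p * L\<^sup>2) * (norm y)\<^sup>2)) \<partial>R.occ))"
proof -
  define q where "q = (1 - p) / p"
  let ?I = "\<integral>\<^sup>+y. ennreal (exp (q / L\<^sup>2 * (norm y)\<^sup>2)) \<partial>R.occ"
  have q: "0 < q" "p * q = 1 - p" using p by (auto simp: q_def)
  define D where "D = real CARD('n) * h"
  define c where "c = (2 * pi * L\<^sup>2) powr (- real CARD('n) / 2) * exp (- D\<^sup>2 / L\<^sup>2)"
  have c: "0 < c" using L by (simp add: c_def)
  define C where "C = h ^ CARD('n) * c"
  have C: "0 < C" using h c by (simp add: C_def)
  define r where "r y = exp (- (norm y)\<^sup>2 / L\<^sup>2)" for y :: "real ^ 'n"
  have r: "0 < r y" for y by (simp add: r_def)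
  have rm [measurable]: "r \<in> borel_measurable borel" unfolding r_def by measurable
  \<comment> \<open>The variable \<open>\<Lambda>\<close>. The Gaussian weight is integrable, and if \<open>L\<close> is large its negative power
    still has finite mean under the occupation measure.\<close>
  define Lam where "Lam w = (\<integral>\<^sup>+z. ennreal (gauss L z) * ennreal (exp (p * t * X (cell h z) w)) \<partial>lborel)" for w
  have Lam_meas [measurable]: "Lam \<in> borel_measurable M" unfolding Lam_def by measurable
  have gauss_cell: "c * r y \<le> gauss L z" if "cell h z = cell h y" for y z
  proof -
    have "(norm z)\<^sup>2 \<le> (norm y + D)\<^sup>2"
      using same_cell_dist[OF h that] norm_triangle_sub[of z y] by (intro power_mono) (auto simp: D_def)
    also have "\<dots> \<le> 2 * (norm y)\<^sup>2 + 2 * D\<^sup>2"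
      using sum_squares_bound[of "norm y" D] by (simp add: power2_sum)
    finally have "(norm z)\<^sup>2 / (2 * L\<^sup>2) \<le> (2 * (norm y)\<^sup>2 + 2 * D\<^sup>2) / (2 * L\<^sup>2)"
      by (intro divide_right_mono) auto
    then have "- D\<^sup>2 / L\<^sup>2 + - (norm y)\<^sup>2 / L\<^sup>2 \<le> - (norm z)\<^sup>2 / (2 * L\<^sup>2)"
      by (simp add: add_divide_distrib)
    then have "exp (- D\<^sup>2 / L\<^sup>2) * exp (- (norm y)\<^sup>2 / L\<^sup>2) \<le> exp (- (norm z)\<^sup>2 / (2 * L\<^sup>2))"
      by (simp only: exp_add[symmetric] exp_le_cancel_iff)
    then show ?thesis
      unfolding c_def r_def gauss_def mult.assoc by (intro mult_left_mono) auto
  qed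
  have Lam_ge: "ennreal (exp (p * t * X (cell h y) w) * (C * r y)) \<le> Lam w" for y w
  proof -
    have "ennreal (exp (p * t * X (cell h y) w) * (C * r y)) = ennreal (c * r y * exp (p * t * X (cell h y) w)) * ennreal (h ^ CARD('n))"
      using c h by (simp add: ennreal_mult[symmetric] C_def r_def mult_ac)
    also have "\<dots> \<le> ennreal (c * r y * exp (p * t * X (cell h y) w)) * emeasure lborel {z. cell h z = cell h y}"
      by (intro mult_left_mono emeasure_cell h) simp
    also have "\<dots> = (\<integral>\<^sup>+z. ennreal (c * r y * exp (p * t * X (cell h y) w)) * indicator {z. cell h z = cell h y} z \<partial>lborel)"
      by (subst nn_integral_cmult_indicator) auto
    also have "\<dots> \<le> Lam w"
      unfolding Lam_def
      by (intro nn_integral_mono)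
         (auto simp: ennreal_mult[symmetric] gauss_nonneg intro!: ennreal_leI mult_right_mono gauss_cell split: split_indicator)
    finally show ?thesis .
  qed
  have Lam_mean: "(\<integral>\<^sup>+w. Lam w \<partial>M) = ennreal (exp (p\<^sup>2 * t\<^sup>2 / 2 * k 0))"
  proof -
    interpret MLeb: pair_sigma_finite M "lborel :: (real ^ 'n) measure" ..
    have "(\<lambda>(w, z). ennreal (gauss L z) * ennreal (exp (p * t * X (cell h z) w))) \<in> borel_measurable (M \<Otimes>\<^sub>M lborel)"
      by measurable
    from MLeb.Fubini'[OF this]
    have "(\<integral>\<^sup>+w. Lam w \<partial>M) = (\<integral>\<^sup>+z. \<integral>\<^sup>+w. ennreal (gauss L z) * ennreal (exp (p * t * X (cell h z) w)) \<partial>M \<partial>lborel)"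
      unfolding Lam_def by simp
    also have "\<dots> = (\<integral>\<^sup>+z. ennreal (exp (p\<^sup>2 * t\<^sup>2 / 2 * k 0)) * ennreal (gauss L z) \<partial>(lborel :: (real ^ 'n) measure))"
      using F.X_measurable by (intro nn_integral_cong) (simp add: nn_integral_cmult F.mgf1 power_mult_distrib mult.commute)
    finally show ?thesis by (simp add: nn_integral_cmult nn_integral_gauss[OF L])
  qed
  have Lam_fin: "AE w in M. Lam w \<noteq> \<infinity>"
    by (rule nn_integral_noteq_infinite) (auto simp: Lam_mean)
  define T where "T y w = (C * r y) powr (- q) * exp (t * X y w + (- (1 - p) * t) * X (cell h y) w)" for y w
  have ptw: "AE w in M. ennreal (u w powr p) \<le> Lam w + (\<integral>\<^sup>+y. ennreal (T y w) \<partial>R.occ)"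
    using Lam_fin AE_u_le AE_u_pos AE_space
  proof eventually_elim
    case (elim w)
    have [measurable]: "(\<lambda>y. X y w) \<in> borel_measurable borel"
      by (rule borel_measurable_continuous_onI[OF F.X_continuous[OF elim(4)]])
    define l where "l = enn2real (Lam w)"
    have l: "Lam w = ennreal l" "0 \<le> l" using elim(1) by (auto simp: l_def less_top)
    have lge: "exp (p * t * X (cell h y) w) * (C * r y) \<le> l" for y
      using Lam_ge[of y w] l by simp
    have lpos: "0 < l"
      using lge[of 0] C r[of 0] by (smt (verit) exp_gt_zero mult_pos_pos)
    have "u w powr p = (u w * l powr (- q)) powr p * l powr (1 - p)"
      using elim(3) lpos q by (simp add: powr_mult powr_powr powr_add[symmetric] mult.commute)
    also have "\<dots> \<le> p * (u w * l powr (- q)) + (1 - p) * l"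
      using p elim(3) lpos by (intro Youngs_inequality_0) auto
    also have "\<dots> \<le> u w * l powr (- q) + l"
      using p elim(3) lpos by (intro add_mono mult_left_le_one_le) auto
    finally have "ennreal (u w powr p) \<le> Lam w + ennreal (l powr (- q)) * ennreal (u w)"
      using elim(3) lpos by (simp add: l(1) ennreal_mult[symmetric] ennreal_plus[symmetric] ennreal_leI add.commute mult.commute del: ennreal_plus)
    also have "ennreal (l powr (- q)) * ennreal (u w) \<le> ennreal (l powr (- q)) * (\<integral>\<^sup>+y. ennreal (exp (t * X y w)) \<partial>R.occ)"
      using elim(2) by (rule mult_left_mono) simp
    also have "\<dots> = (\<integral>\<^sup>+y. ennreal (l powr (- q)) * ennreal (exp (t * X y w)) \<partial>R.occ)"
      by (subst nn_integral_cmult) auto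
    also have "\<dots> \<le> (\<integral>\<^sup>+y. ennreal (T y w) \<partial>R.occ)"
    proof (intro nn_integral_mono)
      fix y
      have "l powr (- q) \<le> (exp (p * t * X (cell h y) w) * (C * r y)) powr (- q)"
        using q C r[of y] by (intro powr_mono2' lge) auto
      also have "\<dots> = exp (- (1 - p) * t * X (cell h y) w) * (C * r y) powr (- q)"
      proof -
        have "exp (p * t * X (cell h y) w) powr (- q) = exp (- (p * q) * t * X (cell h y) w)"
          by (simp add: powr_def mult_ac)
        then show ?thesis using C r[of y] by (simp add: powr_mult q(2))
      qed
      finally have "l powr (- q) * exp (t * X y w) \<le> exp (- (1 - p) * t * X (cell h y) w) * (C * r y) powr (- q) * exp (t * X y w)"
        by (rule mult_right_mono) simp
      also have "\<dots> = T y w"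
        unfolding T_def exp_add by (simp only: mult_ac)
      finally show "ennreal (l powr (- q)) * ennreal (exp (t * X y w)) \<le> ennreal (T y w)"
        by (simp add: ennreal_mult[symmetric] ennreal_leI)
    qed
    finally show ?case by (simp add: add_left_mono)
  qed
  have Tm [measurable]: "(\<lambda>(w, y). ennreal (T y w)) \<in> borel_measurable (M \<Otimes>\<^sub>M R.occ)"
    unfolding T_def by measurable
  let ?E = "exp (p\<^sup>2 * t\<^sup>2 / 2 * k 0 + (1 - p) * t\<^sup>2 * \<eta>)"
  have Tmean: "(\<integral>\<^sup>+w. ennreal (T y w) \<partial>M) \<le> ennreal (?E * C powr (- q)) * ennreal (exp (q / L\<^sup>2 * (norm y)\<^sup>2))" for y
  proof -
    have "(\<integral>\<^sup>+w. ennreal (T y w) \<partial>M) = ennreal ((C * r y) powr (- q)) *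
        ennreal (exp ((t\<^sup>2 + (- (1 - p) * t)\<^sup>2) / 2 * k 0 + t * (- (1 - p) * t) * k (y - cell h y)))"
      unfolding T_def F.mgf[symmetric] using F.X_measurable
      by (subst nn_integral_cmult[symmetric]) (auto simp: ennreal_mult intro!: nn_integral_cong)
    also have "(t\<^sup>2 + (- (1 - p) * t)\<^sup>2) / 2 * k 0 + t * (- (1 - p) * t) * k (y - cell h y) =
        p\<^sup>2 * t\<^sup>2 / 2 * k 0 + (1 - p) * t\<^sup>2 * (k 0 - k (y - cell h y))"
      by (simp add: power2_eq_square field_simps)
    also have "ennreal ((C * r y) powr (- q)) * ennreal (exp \<dots>) \<le> ennreal ((C * r y) powr (- q)) * ennreal ?E"
      using near[OF cell_dist[OF h, of y]] p
      by (intro mult_left_mono ennreal_leI) (auto intro!: mult_left_mono)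
    also have "(C * r y) powr (- q) = C powr (- q) * exp (q / L\<^sup>2 * (norm y)\<^sup>2)"
      using C by (simp add: powr_mult r_def powr_def[of "exp _"])
    finally show ?thesis by (simp add: ennreal_mult[symmetric] mult_ac)
  qed
  have "(\<integral>\<^sup>+w. ennreal (u w powr p) \<partial>M) \<le> (\<integral>\<^sup>+w. Lam w + (\<integral>\<^sup>+y. ennreal (T y w) \<partial>R.occ) \<partial>M)"
    by (rule nn_integral_mono_AE[OF ptw])
  also have "\<dots> = (\<integral>\<^sup>+w. Lam w \<partial>M) + (\<integral>\<^sup>+w. \<integral>\<^sup>+y. ennreal (T y w) \<partial>R.occ \<partial>M)"
    by (rule nn_integral_add) measurable
  also have "(\<integral>\<^sup>+w. \<integral>\<^sup>+y. ennreal (T y w) \<partial>R.occ \<partial>M) = (\<integral>\<^sup>+y. \<integral>\<^sup>+w. ennreal (T y w) \<partial>M \<partial>R.occ)"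
    using MO.Fubini'[OF Tm] by simp
  also have "\<dots> \<le> (\<integral>\<^sup>+y. ennreal (?E * C powr (- q)) * ennreal (exp (q / L\<^sup>2 * (norm y)\<^sup>2)) \<partial>R.occ)"
    by (intro nn_integral_mono Tmean)
  also have "\<dots> = ennreal ?E * (ennreal (C powr (- q)) * ?I)"
    by (simp add: nn_integral_cmult ennreal_mult mult.assoc)
  also have "(\<integral>\<^sup>+w. Lam w \<partial>M) \<le> ennreal ?E * 1"
    using p \<eta> by (simp add: Lam_mean)
  finally have "(\<integral>\<^sup>+w. ennreal (u w powr p) \<partial>M) \<le>
     ennreal ?E * (1 + ennreal (C powr (- q)) * ?I)"
    by (simp add: distrib_left add_right_mono)
  moreover have "- (1 - p) / p = - q"
    unfolding q_def by (rule minus_divide_left[symmetric])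
  moreover have "(1 - p) / (p * L\<^sup>2) = q / L\<^sup>2"
    by (simp add: q_def)
  ultimately show ?thesis
    unfolding C_def c_def D_def by (simp only:)
qed

end

section \<open>Brownian motion\<close>

locale brownian =
  fixes \<kappa> :: real and x :: "real ^ 'n::finite" and P :: "'b measure" and W :: "real \<Rightarrow> 'b \<Rightarrow> real ^ 'n"
  assumes brownian_motion: "brownian_motion \<kappa> x P W" and \<kappa>_pos: "\<kappa> > 0"
begin

sublocale prob_space P
  using brownian_motion by (simp add: brownian_motion_def)

lemma W_measurable: "0 \<le> s \<Longrightarrow> W s \<in> borel_measurable P"
  using brownian_motion by (simp add: brownian_motion_def)

lemma W_0: "AE b in P. W 0 b = x"
  using brownian_motion by (simp add: brownian_motion_def)

lemma W_continuous: "b \<in> space P \<Longrightarrow> continuous_on {0..} (\<lambda>s. W s b)"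
  using brownian_motion by (simp add: brownian_motion_def)

lemma increment_distributed:
  "0 \<le> r \<Longrightarrow> r < s \<Longrightarrow> distributed P lborel (\<lambda>b. W s b - W r b) (\<lambda>z. ennreal (gauss (sqrt (2 * \<kappa> * (s - r))) z))"
  using brownian_motion by (simp add: brownian_motion_def)

lemma increments_indep:
  "0 \<le> \<tau> 0 \<Longrightarrow> strict_mono \<tau> \<Longrightarrow> indep_vars (\<lambda>_. borel) (\<lambda>i b. W (\<tau> (Suc i)) b - W (\<tau> i) b) {..<n::nat}"
  using brownian_motion by (simp add: brownian_motion_def)

lemma nn_integral_increment:
  assumes "0 \<le> r" "r < s" and [measurable]: "f \<in> borel_measurable borel"
  shows "(\<integral>\<^sup>+b. f (W s b - W r b) \<partial>P) = (\<integral>\<^sup>+z. ennreal (gauss (sqrt (2 * \<kappa> * (s - r))) z) * f z \<partial>lborel)"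
  by (rule distributed_nn_integral[OF increment_distributed[OF assms(1,2)], symmetric]) simp

lemma increment_exp_moment:
  assumes "0 \<le> r" "r < s" "c \<le> 1 / (8 * \<kappa> * (s - r))"
  shows "(\<integral>\<^sup>+b. ennreal (exp (c * (norm (W s b - W r b))\<^sup>2)) \<partial>P) \<le> ennreal (2 powr (real CARD('n) / 2))"
proof -
  let ?a = "sqrt (2 * \<kappa> * (s - r))"
  have a: "0 < ?a" "?a\<^sup>2 = 2 * \<kappa> * (s - r)" using assms \<kappa>_pos by auto
  have "(\<integral>\<^sup>+b. ennreal (exp (c * (norm (W s b - W r b))\<^sup>2)) \<partial>P) =
     (\<integral>\<^sup>+z. ennreal (gauss ?a z) * ennreal (exp (c * (norm z)\<^sup>2)) \<partial>(lborel :: (real ^ 'n) measure))"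
    by (rule nn_integral_increment[OF assms(1,2), of "\<lambda>z. ennreal (exp (c * (norm z)\<^sup>2))"]) measurable
  also have "\<dots> \<le> (\<integral>\<^sup>+z. ennreal (exp ((norm z)\<^sup>2 / (4 * ?a\<^sup>2))) * ennreal (gauss ?a z) \<partial>(lborel :: (real ^ 'n) measure))"
  proof (intro nn_integral_mono)
    fix z :: "real ^ 'n"
    have "c * (norm z)\<^sup>2 \<le> 1 / (8 * \<kappa> * (s - r)) * (norm z)\<^sup>2"
      using assms(3) by (rule mult_right_mono) simp
    then have "c * (norm z)\<^sup>2 \<le> (norm z)\<^sup>2 / (4 * ?a\<^sup>2)" unfolding a(2) by (simp add: mult.assoc)
    then show "ennreal (gauss ?a z) * ennreal (exp (c * (norm z)\<^sup>2)) \<le> ennreal (exp ((norm z)\<^sup>2 / (4 * ?a\<^sup>2))) * ennreal (gauss ?a z)"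
      by (subst mult.commute) (intro mult_right_mono ennreal_leI, auto)
  qed
  also have "\<dots> = ennreal (2 powr (real CARD('n) / 2))" by (rule nn_integral_exp_gauss[OF a(1)])
  finally show ?thesis .
qed

lemma exp_moment:
  assumes s: "0 \<le> s" "s \<le> t" and c: "0 \<le> c" "16 * \<kappa> * t * c \<le> 1"
  shows "(\<integral>\<^sup>+b. ennreal (exp (c * (norm (W s b))\<^sup>2)) \<partial>P) \<le> ennreal (exp (2 * c * (norm x)\<^sup>2) * 2 powr (real CARD('n) / 2))"
proof (cases "s = 0")
  case True
  have "(\<integral>\<^sup>+b. ennreal (exp (c * (norm (W s b))\<^sup>2)) \<partial>P) \<le> (\<integral>\<^sup>+b. ennreal (exp (2 * c * (norm x)\<^sup>2) * 2 powr (real CARD('n) / 2)) \<partial>P)"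
  proof (rule nn_integral_mono_AE)
    have "exp (c * (norm x)\<^sup>2) * 1 \<le> exp (2 * c * (norm x)\<^sup>2) * 2 powr (real CARD('n) / 2)"
      using c by (intro mult_mono) (auto simp: ge_one_powr_ge_zero)
    then show "AE b in P. ennreal (exp (c * (norm (W s b))\<^sup>2)) \<le> ennreal (exp (2 * c * (norm x)\<^sup>2) * 2 powr (real CARD('n) / 2))"
      using W_0 by (auto simp: True elim!: eventually_mono intro!: ennreal_leI)
  qed
  then show ?thesis by (simp add: emeasure_space_1)
next
  case False
  then have s0: "0 < s" using s by simp
  have [measurable]: "W s \<in> borel_measurable P" "W 0 \<in> borel_measurable P" using s by (auto intro: W_measurable)
  have "(\<integral>\<^sup>+b. ennreal (exp (c * (norm (W s b))\<^sup>2)) \<partial>P) \<le>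
      (\<integral>\<^sup>+b. ennreal (exp (2 * c * (norm x)\<^sup>2)) * ennreal (exp (2 * c * (norm (W s b - W 0 b))\<^sup>2)) \<partial>P)"
  proof (rule nn_integral_mono_AE)
    show "AE b in P. ennreal (exp (c * (norm (W s b))\<^sup>2)) \<le> ennreal (exp (2 * c * (norm x)\<^sup>2)) * ennreal (exp (2 * c * (norm (W s b - W 0 b))\<^sup>2))"
      using W_0
    proof eventually_elim
      case (elim b)
      have "(norm (W s b))\<^sup>2 \<le> (norm x + norm (W s b - x))\<^sup>2"
        using norm_triangle_sub[of "W s b" x] by (intro power_mono) auto
      also have "\<dots> \<le> 2 * (norm x)\<^sup>2 + 2 * (norm (W s b - x))\<^sup>2"
        using sum_squares_bound[of "norm x" "norm (W s b - x)"] by (simp add: power2_sum)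
      finally have "c * (norm (W s b))\<^sup>2 \<le> c * (2 * (norm x)\<^sup>2 + 2 * (norm (W s b - x))\<^sup>2)"
        using c by (intro mult_left_mono)
      then show ?case
        by (simp add: elim ennreal_mult[symmetric] exp_add[symmetric] algebra_simps)
    qed
  qed
  also have "\<dots> = ennreal (exp (2 * c * (norm x)\<^sup>2)) * (\<integral>\<^sup>+b. ennreal (exp (2 * c * (norm (W s b - W 0 b))\<^sup>2)) \<partial>P)"
    by (rule nn_integral_cmult) measurable
  also have "\<dots> \<le> ennreal (exp (2 * c * (norm x)\<^sup>2)) * ennreal (2 powr (real CARD('n) / 2))"
  proof (intro mult_left_mono increment_exp_moment)
    have "16 * \<kappa> * s * c \<le> 16 * \<kappa> * t * c" using s c \<kappa>_pos by (intro mult_right_mono mult_left_mono) auto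
    then have "2 * c * (8 * \<kappa> * s) \<le> 1" using c by (simp add: mult_ac)
    then show "2 * c \<le> 1 / (8 * \<kappa> * (s - 0))" using s0 \<kappa>_pos by (simp add: pos_le_divide_eq)
  qed (use s0 in auto)
  finally show ?thesis by (simp add: ennreal_mult)
qed

text \<open>Markov's inequality for the quadratic exponential moment.\<close>

lemma increment_tail:
  assumes r: "0 \<le> r" "r < s" "s - r \<le> h" and \<rho>: "0 < \<rho>"
  shows "prob {b \<in> space P. \<rho> < norm (W s b - W r b)} \<le> 2 powr (real CARD('n) / 2) * exp (- \<rho>\<^sup>2 / (8 * \<kappa> * h))"
proof -
  let ?far = "{b \<in> space P. \<rho> < norm (W s b - W r b)}"
  have [measurable]: "W s \<in> borel_measurable P" "W r \<in> borel_measurable P" using r by (auto intro: W_measurable)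
  let ?c = "1 / (8 * \<kappa> * (s - r))"
  have c: "0 < ?c" using r \<kappa>_pos by simp
  have "emeasure P ?far = (\<integral>\<^sup>+b. indicator ?far b \<partial>P)"
    by simp
  also have "\<dots> \<le> (\<integral>\<^sup>+b. ennreal (exp (- ?c * \<rho>\<^sup>2)) * ennreal (exp (?c * (norm (W s b - W r b))\<^sup>2)) \<partial>P)"
  proof (intro nn_integral_mono)
    fix b assume "b \<in> space P"
    have "1 \<le> exp (- ?c * \<rho>\<^sup>2 + ?c * (norm (W s b - W r b))\<^sup>2)" if "\<rho> < norm (W s b - W r b)"
    proof -
      have "\<rho>\<^sup>2 \<le> (norm (W s b - W r b))\<^sup>2" using that \<rho> by (intro power_mono) auto
      then have "?c * \<rho>\<^sup>2 \<le> ?c * (norm (W s b - W r b))\<^sup>2" using c by (intro mult_left_mono) auto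
      then show ?thesis by simp
    qed
    then show "indicator ?far b \<le> ennreal (exp (- ?c * \<rho>\<^sup>2)) * ennreal (exp (?c * (norm (W s b - W r b))\<^sup>2))"
      by (simp add: ennreal_mult[symmetric] exp_add[symmetric] del: mult_minus_left split: split_indicator)
  qed
  also have "\<dots> = ennreal (exp (- ?c * \<rho>\<^sup>2)) * (\<integral>\<^sup>+b. ennreal (exp (?c * (norm (W s b - W r b))\<^sup>2)) \<partial>P)"
    by (rule nn_integral_cmult) measurable
  also have "\<dots> \<le> ennreal (exp (- ?c * \<rho>\<^sup>2)) * ennreal (2 powr (real CARD('n) / 2))"
    using r by (intro mult_left_mono increment_exp_moment) auto
  also have "\<dots> \<le> ennreal (exp (- \<rho>\<^sup>2 / (8 * \<kappa> * h))) * ennreal (2 powr (real CARD('n) / 2))"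
  proof (intro mult_right_mono ennreal_leI)
    have "\<rho>\<^sup>2 / (8 * \<kappa> * h) \<le> \<rho>\<^sup>2 / (8 * \<kappa> * (s - r))"
      using r \<kappa>_pos by (intro divide_left_mono mult_left_mono mult_pos_pos) auto
    then show "exp (- ?c * \<rho>\<^sup>2) \<le> exp (- \<rho>\<^sup>2 / (8 * \<kappa> * h))" by simp
  qed simp
  finally show ?thesis
    by (simp add: emeasure_eq_measure ennreal_mult[symmetric] mult.commute)
qed

text \<open>The ball of radius \<open>\<eta>\<close> contains a cube with side length \<open>2 \<eta> / d\<close>, on which the density is bounded
below by its value at distance \<open>\<eta>\<close>.\<close>

lemma increment_small:
  assumes r: "0 \<le> r" "0 < h" and \<eta>: "0 < \<eta>"
  shows "prob {b \<in> space P. norm (W (r + h) b - W r b) \<le> \<eta>} \<ge>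
    (2 * pi * (2 * \<kappa> * h)) powr (- real CARD('n) / 2) * exp (- \<eta>\<^sup>2 / (2 * (2 * \<kappa> * h))) * (2 * \<eta> / real CARD('n)) ^ CARD('n)"
proof -
  let ?small = "{b \<in> space P. norm (W (r + h) b - W r b) \<le> \<eta>}"
  let ?a = "sqrt (2 * \<kappa> * h)"
  let ?g = "(2 * pi * (2 * \<kappa> * h)) powr (- real CARD('n) / 2) * exp (- \<eta>\<^sup>2 / (2 * (2 * \<kappa> * h)))"
  have a: "0 < ?a" "?a\<^sup>2 = 2 * \<kappa> * h" using assms \<kappa>_pos by auto
  have [measurable]: "W (r + h) \<in> borel_measurable P" "W r \<in> borel_measurable P" using r by (auto intro: W_measurable)
  define v where "v = (\<Sum>b\<in>Basis. (\<eta> / real CARD('n)) *\<^sub>R b :: real ^ 'n)"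
  have v: "v \<bullet> b = \<eta> / real CARD('n)" if "b \<in> Basis" for b using that by (simp add: v_def inner_sum_left_Basis)
  let ?B = "box (- v) v"
  have B: "norm z \<le> \<eta>" if "z \<in> ?B" for z
  proof -
    have "norm z \<le> (\<Sum>b\<in>Basis. \<bar>z \<bullet> b\<bar>)" by (rule norm_le_l1)
    also have "\<dots> \<le> (\<Sum>b\<in>(Basis :: (real ^ 'n) set). \<eta> / real CARD('n))"
    proof (rule sum_mono)
      fix b :: "real ^ 'n" assume "b \<in> Basis"
      then show "\<bar>z \<bullet> b\<bar> \<le> \<eta> / real CARD('n)" using that by (force simp: mem_box v inner_minus_left abs_le_iff)
    qed
    finally show ?thesis by simp
  qed
  have "ennreal (?g * (2 * \<eta> / real CARD('n)) ^ CARD('n)) = ennreal ?g * emeasure lborel ?B"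
  proof -
    have "emeasure lborel ?B = ennreal (\<Prod>b\<in>Basis. (v - - v) \<bullet> b)"
      using \<eta> by (intro emeasure_lborel_box) (auto simp: v)
    also have "(\<Prod>b\<in>Basis. (v - - v) \<bullet> b) = (\<Prod>b\<in>(Basis :: (real ^ 'n) set). 2 * \<eta> / real CARD('n))"
    proof (rule prod.cong)
      fix b :: "real ^ 'n" assume b: "b \<in> Basis"
      show "(v - - v) \<bullet> b = 2 * \<eta> / real CARD('n)"
        unfolding inner_diff_left inner_minus_left v[OF b] by simp
    qed simp
    finally have "emeasure lborel ?B = ennreal ((2 * \<eta> / real CARD('n)) ^ CARD('n))" by simp
    then show ?thesis by (simp only:, intro ennreal_mult) (use \<eta> in auto)
  qed
  also have "\<dots> = (\<integral>\<^sup>+z. ennreal ?g * indicator ?B z \<partial>lborel)" by (simp add: nn_integral_cmult_indicator)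
  also have "\<dots> \<le> (\<integral>\<^sup>+z. ennreal (gauss ?a z) * indicator {z. norm z \<le> \<eta>} z \<partial>(lborel :: (real ^ 'n) measure))"
  proof (intro nn_integral_mono)
    fix z :: "real ^ 'n"
    have "?g \<le> gauss ?a z" if "norm z \<le> \<eta>"
    proof -
      have "(norm z)\<^sup>2 / (2 * (2 * \<kappa> * h)) \<le> \<eta>\<^sup>2 / (2 * (2 * \<kappa> * h))"
        using that r \<kappa>_pos by (intro divide_right_mono power_mono) auto
      then show ?thesis unfolding gauss_def a(2) by (intro mult_left_mono) auto
    qed
    then show "ennreal ?g * indicator ?B z \<le> ennreal (gauss ?a z) * indicator {z. norm z \<le> \<eta>} z"
      using B[of z] by (auto intro!: ennreal_leI split: split_indicator)
  qed
  also have "\<dots> = (\<integral>\<^sup>+b. indicator {z. norm z \<le> \<eta>} (W (r + h) b - W r b) \<partial>P)"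
    using nn_integral_increment[of r "r + h" "indicator {z. norm z \<le> \<eta>}"] r by simp
  also have "\<dots> = (\<integral>\<^sup>+b. indicator ?small b \<partial>P)"
    by (intro nn_integral_cong) (auto split: split_indicator)
  also have "\<dots> = ennreal (prob ?small)"
    by (simp add: emeasure_eq_measure)
  finally show ?thesis by simp
qed

lemma increment_prob_shift:
  assumes "0 \<le> r" "0 < h"
  shows "prob {b \<in> space P. norm (W (r + h) b - W r b) \<le> \<eta>} = prob {b \<in> space P. norm (W h b - W 0 b) \<le> \<eta>}"
proof -
  let ?small = "\<lambda>r. {b \<in> space P. norm (W (r + h) b - W r b) \<le> \<eta>}"
  have eq: "ennreal (prob (?small r)) =
    (\<integral>\<^sup>+z. ennreal (gauss (sqrt (2 * \<kappa> * h)) z) * indicator {z. norm z \<le> \<eta>} z \<partial>(lborel :: (real ^ 'n) measure))" if "0 \<le> r" for r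
  proof -
    have [measurable]: "W (r + h) \<in> borel_measurable P" "W r \<in> borel_measurable P" using that assms by (auto intro: W_measurable)
    have "ennreal (prob (?small r)) =
       (\<integral>\<^sup>+b. indicator (?small r) b \<partial>P)" by (simp add: emeasure_eq_measure)
    also have "\<dots> = (\<integral>\<^sup>+b. indicator {z. norm z \<le> \<eta>} (W (r + h) b - W r b) \<partial>P)"
      by (intro nn_integral_cong) (auto split: split_indicator)
    also have "\<dots> = (\<integral>\<^sup>+z. ennreal (gauss (sqrt (2 * \<kappa> * h)) z) * indicator {z. norm z \<le> \<eta>} z \<partial>(lborel :: (real ^ 'n) measure))"
      using nn_integral_increment[of r "r + h" "indicator {z. norm z \<le> \<eta>}"] that assms by simp
    finally show ?thesis .
  qed
  from trans[OF eq[OF assms(1)] eq[OF order_refl, symmetric]] show ?thesis by simp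
qed

lemma prob_increment_events:
  fixes \<tau> :: "nat \<Rightarrow> real"
  assumes \<tau>: "0 \<le> \<tau> 0" "strict_mono \<tau>" and J: "J \<subseteq> {..<n}" "J \<noteq> {}" and [measurable]: "\<And>j. j \<in> J \<Longrightarrow> B j \<in> sets borel"
  shows "prob {b \<in> space P. \<forall>j\<in>J. W (\<tau> (Suc j)) b - W (\<tau> j) b \<in> B j} =
    (\<Prod>j\<in>J. prob {b \<in> space P. W (\<tau> (Suc j)) b - W (\<tau> j) b \<in> B j})"
proof -
  have "prob (\<Inter>j\<in>J. (\<lambda>b. W (\<tau> (Suc j)) b - W (\<tau> j) b) -` B j \<inter> space P) =
    (\<Prod>j\<in>J. prob ((\<lambda>b. W (\<tau> (Suc j)) b - W (\<tau> j) b) -` B j \<inter> space P))"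
    using J finite_subset[OF J(1)]
    by (intro indep_varsD[OF increments_indep[OF \<tau>, of n]]) auto
  moreover have "(\<Inter>j\<in>J. (\<lambda>b. W (\<tau> (Suc j)) b - W (\<tau> j) b) -` B j \<inter> space P) =
     {b \<in> space P. \<forall>j\<in>J. W (\<tau> (Suc j)) b - W (\<tau> j) b \<in> B j}"
    using J(2) by auto
  moreover have "(\<lambda>b. W (\<tau> (Suc j)) b - W (\<tau> j) b) -` B j \<inter> space P = {b \<in> space P. W (\<tau> (Suc j)) b - W (\<tau> j) b \<in> B j}" for j
    by auto
  ultimately show ?thesis by (simp only:)
qed

text \<open>The event \<open>A\<close> requires all increments over the grid of mesh \<open>t / N\<close> to be at most \<open>\<eta>\<close>; this keeps the
grid values within \<open>N \<eta>\<close> of \<open>x\<close>, and by independence \<open>A\<close> has the probability \<open>Q ^ N\<close>, where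
\<open>Q \<ge> q\<close> is the probability for one increment. For a time \<open>s\<close> inside a grid interval, the increment
from the left grid point to \<open>s\<close> is independent of the increments over the other \<open>N - 1\<close> intervals.
Dropping the condition on the interval of \<open>s\<close> costs a factor \<open>1 / Q\<close>, which the Gaussian tail of the
increment outweighs when \<open>N\<close> is large.\<close>

lemma confinement:
  fixes N :: nat and t \<eta> \<rho> :: real
  assumes t: "t > 0" and N: "N > 0" and \<eta>: "\<eta> > 0" and \<rho>: "\<rho> > 0"
  defines "q \<equiv> (2 * pi * (2 * \<kappa> * (t / N))) powr (- real CARD('n) / 2) * exp (- \<eta>\<^sup>2 / (2 * (2 * \<kappa> * (t / N)))) * (2 * \<eta> / real CARD('n)) ^ CARD('n)"
  obtains A where "A \<in> sets P" "q ^ N \<le> prob A" "0 < prob A"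
    "\<And>s. 0 \<le> s \<Longrightarrow> s \<le> t \<Longrightarrow> prob ({b \<in> space P. N * \<eta> + \<rho> < norm (W s b - x)} \<inter> A) \<le>
       2 powr (real CARD('n) / 2) * exp (- \<rho>\<^sup>2 / (8 * \<kappa> * (t / N))) / q * prob A"
proof -
  define h where "h = t / N"
  have h: "0 < h" "N * h = t" using t N by (auto simp: h_def)
  have q_pos: "0 < q" unfolding q_def using \<kappa>_pos t N \<eta> by simp
  define \<tau> where "\<tau> i = real i * h" for i
  have \<tau>: "0 \<le> \<tau> 0" "strict_mono \<tau>" "\<And>i. \<tau> (Suc i) = \<tau> i + h" "\<And>i. 0 \<le> \<tau> i"
    using h by (auto simp: \<tau>_def strict_mono_def algebra_simps)
  have Wm [measurable]: "W (\<tau> i) \<in> borel_measurable P" for i by (rule W_measurable[OF \<tau>(4)])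
  let ?small = "{z :: real ^ 'n. norm z \<le> \<eta>}"
  define Q where "Q = prob {b \<in> space P. norm (W h b - W 0 b) \<le> \<eta>}"
  have Qi: "prob {b \<in> space P. norm (W (\<tau> (Suc i)) b - W (\<tau> i) b) \<le> \<eta>} = Q" for i
    unfolding \<tau>(3) Q_def using increment_prob_shift[OF \<tau>(4) h(1)] by simp
  have qQ: "q \<le> Q"
    using increment_small[of 0 h \<eta>] h \<eta> unfolding Q_def q_def h_def[symmetric] by simp
  have Q_pos: "0 < Q" using qQ q_pos by simp
  define A where "A = {b \<in> space P. \<forall>i\<in>{..<N}. W (\<tau> (Suc i)) b - W (\<tau> i) b \<in> ?small}"
  have A [measurable]: "A \<in> sets P" unfolding A_def by measurable
  have PA: "prob A = Q ^ N"
    unfolding A_def using N by (subst prob_increment_events[OF \<tau>(1,2), of _ N]) (auto simp: Qi)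
  have grid: "norm (W (\<tau> i) b - x) \<le> i * \<eta>" if "b \<in> A" "W 0 b = x" "i \<le> N" for b i
    using that(3)
  proof (induction i)
    case 0
    then show ?case using that by (simp add: \<tau>_def)
  next
    case (Suc i)
    have "norm (W (\<tau> (Suc i)) b - W (\<tau> i) b) \<le> \<eta>" using that(1) Suc by (auto simp: A_def)
    then have "norm (W (\<tau> (Suc i)) b - x) \<le> i * \<eta> + \<eta>"
      using Suc norm_triangle_ineq[of "W (\<tau> (Suc i)) b - W (\<tau> i) b" "W (\<tau> i) b - x"] by simp
    then show ?case by (simp add: algebra_simps)
  qed
  let ?T = "2 powr (real CARD('n) / 2) * exp (- \<rho>\<^sup>2 / (8 * \<kappa> * h))"
  have main: "prob ({b \<in> space P. N * \<eta> + \<rho> < norm (W s b - x)} \<inter> A) \<le> ?T / q * prob A" if s: "0 \<le> s" "s \<le> t" for s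
  proof -
    have [measurable]: "W s \<in> borel_measurable P" using s(1) by (rule W_measurable)
    define i where "i = nat \<lfloor>s / h\<rfloor>"
    have i: "\<tau> i \<le> s" "s < \<tau> i + h"
    proof -
      have "real i = of_int \<lfloor>s / h\<rfloor>" using s h by (simp add: i_def)
      then have "real i \<le> s / h" "s / h < real i + 1" by linarith+
      then show "\<tau> i \<le> s" "s < \<tau> i + h" using h by (simp_all add: \<tau>_def field_simps)
    qed
    have iN: "i \<le> N"
    proof -
      have "real i * h \<le> N * h" using i s h by (simp add: \<tau>_def)
      from mult_right_le_imp_le[OF this h(1)] show ?thesis by simp
    qed
    let ?far = "{b \<in> space P. \<rho> < norm (W s b - W (\<tau> i) b)}"
    have "prob ({b \<in> space P. N * \<eta> + \<rho> < norm (W s b - x)} \<inter> A) \<le> prob (?far \<inter> A)"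
    proof (rule finite_measure_mono_AE)
      show "AE b in P. b \<in> {b \<in> space P. N * \<eta> + \<rho> < norm (W s b - x)} \<inter> A \<longrightarrow> b \<in> ?far \<inter> A"
        using W_0
      proof eventually_elim
        case (elim b)
        show ?case
        proof
          assume b: "b \<in> {b \<in> space P. N * \<eta> + \<rho> < norm (W s b - x)} \<inter> A"
          have "i * \<eta> \<le> N * \<eta>" using iN \<eta> by simp
          then have "norm (W (\<tau> i) b - x) \<le> N * \<eta>" using grid[of b i] b elim iN by auto
          then show "b \<in> ?far \<inter> A"
            using b norm_triangle_ineq[of "W s b - W (\<tau> i) b" "W (\<tau> i) b - x"] by simp
        qed
      qed
    qed measurable
    also have "\<dots> \<le> ?T / q * prob A"
    proof (cases "\<tau> i = s")
      case True
      then have "?far = {}" using \<rho> by auto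
      then show ?thesis using q_pos by (simp only: Int_empty_left measure_empty) simp
    next
      case False
      then have si: "\<tau> i < s" using i by simp
      then have iN': "i < N" using s h i iN by (cases "i = N") (auto simp: \<tau>_def)
      \<comment> \<open>The grid with \<open>s\<close> inserted: its increments with index \<open>i\<close> and \<open>Suc i\<close> are those before and
        after \<open>s\<close>, and later indices are shifted by one.\<close>
      define \<tau>' where "\<tau>' j = (if j \<le> i then \<tau> j else if j = Suc i then s else \<tau> (j - 1))" for j
      have \<tau>': "0 \<le> \<tau>' 0" using \<tau> by (simp add: \<tau>'_def)
      have mono': "strict_mono \<tau>'"
        unfolding strict_mono_Suc_iff
      proof
        fix j
        consider "j < i" | "j = i" | "j = Suc i" | "j > Suc i" by linarith
        then show "\<tau>' j < \<tau>' (Suc j)"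
        proof cases
          case 4
          then obtain m where "j = Suc m" by (cases j) auto
          then show ?thesis using 4 \<tau>(3)[of m] h by (simp add: \<tau>'_def)
        qed (use si i \<tau>(3) h in \<open>auto simp: \<tau>'_def\<close>)
      qed
      define J where "J = {..<Suc N} - {Suc i}"
      define B where "B j = (if j = i then {z :: real ^ 'n. \<rho> < norm z} else ?small)" for j
      let ?D = "\<lambda>j. {b \<in> space P. W (\<tau>' (Suc j)) b - W (\<tau>' j) b \<in> B j}"
      let ?E = "{b \<in> space P. \<forall>j\<in>J. W (\<tau>' (Suc j)) b - W (\<tau>' j) b \<in> B j}"
      have "{z :: real ^ 'n. \<rho> < norm z} \<in> sets borel" "?small \<in> sets borel" by measurable
      then have [measurable]: "B j \<in> sets borel" for j by (auto simp: B_def)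
      have iJ: "i \<in> J" using iN' by (simp add: J_def)
      have inc: "W (\<tau>' (Suc j)) b - W (\<tau>' j) b = (if j < i then W (\<tau> (Suc j)) b - W (\<tau> j) b
          else if j = i then W s b - W (\<tau> i) b else W (\<tau> (Suc (j - 1))) b - W (\<tau> (j - 1)) b)" if "j \<in> J" for j b
        using that by (auto simp: \<tau>'_def J_def)
      have "?far \<inter> A \<subseteq> ?E"
      proof
        fix b assume b: "b \<in> ?far \<inter> A"
        have sm: "norm (W (\<tau> (Suc j)) b - W (\<tau> j) b) \<le> \<eta>" if "j < N" for j
          using b that by (auto simp: A_def)
        have "W (\<tau>' (Suc j)) b - W (\<tau>' j) b \<in> B j" if j: "j \<in> J" for j
        proof -
          consider "j < i" | "j = i" | "j > Suc i" using j by (force simp: J_def)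
          then show ?thesis
          proof cases
            case 1
            then show ?thesis using sm[of j] iN' inc[OF j, of b] by (simp add: B_def)
          next
            case 2
            then show ?thesis using b inc[OF j, of b] by (simp add: B_def)
          next
            case 3
            then have "j - 1 < N" using j by (auto simp: J_def)
            from sm[OF this] 3 show ?thesis using inc[OF j, of b] by (simp add: B_def)
          qed
        qed
        then show "b \<in> ?E"
          using b by simp
      qed
      then have "prob (?far \<inter> A) \<le> prob ?E"
      proof (rule finite_measure_mono)
        have "W (\<tau>' j) \<in> borel_measurable P" for j
          using \<tau>(4) s by (intro W_measurable) (auto simp: \<tau>'_def)
        then show "?E \<in> events"
          unfolding J_def by measurable
      qed
      also have "\<dots> = (\<Prod>j\<in>J. prob (?D j))"
        using iJ by (intro prob_increment_events[OF \<tau>' mono', of _ "Suc N"]) (auto simp: J_def)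
      also have "\<dots> = prob ?far * (\<Prod>j\<in>J - {i}. prob (?D j))"
      proof -
        have "prob (?D i) = prob ?far"
          using inc[OF iJ] by (simp add: B_def)
        then show ?thesis using iJ by (subst prod.remove[of J i]) (auto simp: J_def)
      qed
      also have "(\<Prod>j\<in>J - {i}. prob (?D j)) = (\<Prod>j\<in>J - {i}. Q)"
      proof (rule prod.cong)
        fix j assume j: "j \<in> J - {i}"
        show "prob (?D j) = Q"
        proof (cases "j < i")
          case True
          then show ?thesis using j Qi[of j] by (simp add: inc B_def)
        next
          case False
          then show ?thesis using j Qi[of "j - 1"] by (simp add: inc B_def)
        qed
      qed simp
      also have "\<dots> = Q ^ (N - 1)"
        using iN' by (simp add: J_def card_Diff_subset)
      also have "prob ?far * Q ^ (N - 1) \<le> ?T * Q ^ (N - 1)"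
        using increment_tail[OF \<tau>(4) si _ \<rho>, of h] i Q_pos by (intro mult_right_mono) auto
      also have "\<dots> = ?T / Q * prob A"
        using Q_pos N by (simp add: PA power_eq_if)
      also have "\<dots> \<le> ?T / q * prob A"
        using q_pos qQ by (intro mult_right_mono divide_left_mono) auto
      finally show ?thesis .
    qed
    finally show ?thesis .
  qed
  show ?thesis
  proof (rule that[OF A])
    show "q ^ N \<le> prob A" unfolding PA using qQ q_pos by (intro power_mono) auto
    show "0 < prob A" unfolding PA using Q_pos by simp
  qed (use main in \<open>simp add: h_def\<close>)
qed

end

section \<open>The limit of vanishing mollification\<close>

text \<open>The hypotheses on the kernel are reduced to its homogeneity, which is common to the three types
of noise.\<close>

locale rescaled_noise =
  fixes \<kappa> t \<omega> :: real and \<gamma> :: "(real ^ 'n::finite) measure" and M :: "'a measure"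
    and \<xi> :: "(real ^ 'n \<Rightarrow> real) \<Rightarrow> 'a \<Rightarrow> real" and X :: "real \<Rightarrow> real ^ 'n \<Rightarrow> 'a \<Rightarrow> real"
    and P :: "real ^ 'n \<Rightarrow> 'b measure" and W :: "real \<Rightarrow> 'b \<Rightarrow> real ^ 'n"
  assumes \<kappa>_pos: "\<kappa> > 0" and t_pos: "t > 0" and \<omega>_gt: "\<omega> > 2"
    and kernel: "homogeneous_kernel \<gamma> \<omega>"
    and noise: "gaussian_noise M \<gamma> \<xi>"
    and mollified: "\<And>\<epsilon>. \<epsilon> > 0 \<Longrightarrow> mollified_noise M \<xi> \<epsilon> (X \<epsilon>)"
    and motion: "\<And>x. brownian_motion \<kappa> x (P x) W"
begin

lemma gaussian_field: "\<epsilon> > 0 \<Longrightarrow> gaussian_field M (X \<epsilon>) (mollified_kernel \<gamma> \<epsilon>)"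
proof -
  assume e: "\<epsilon> > 0"
  interpret prob_space M
    using noise by (simp add: gaussian_noise_def centered_gaussian_process_def)
  have [measurable_cong]: "sets \<gamma> = sets borel" using kernel by (simp add: homogeneous_kernel_def)
  interpret G: sigma_finite_measure \<gamma> using kernel by (simp add: homogeneous_kernel_def)
  show ?thesis
  proof
    show "X \<epsilon> x \<in> borel_measurable M" for x
      using mollified[OF e] by (auto simp: mollified_noise_def extended_value_def)
    show "continuous_on UNIV (\<lambda>x. X \<epsilon> x w)" if "w \<in> space M" for w
    proof -
      have "C_k 0 (\<lambda>x. X \<epsilon> x w)"
        using mollified[OF e] that unfolding mollified_noise_def smooth_def by blast
      then show ?thesis by simp
    qed
    show "(\<integral>\<^sup>+w. ennreal (exp (a * X \<epsilon> x w + b * X \<epsilon> y w)) \<partial>M) =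
      ennreal (exp ((a\<^sup>2 + b\<^sup>2) / 2 * mollified_kernel \<gamma> \<epsilon> 0 + a * b * mollified_kernel \<gamma> \<epsilon> (x - y)))" for x y a b
      by (rule mollified_noise_mgf[OF noise kernel e mollified[OF e]])
    show "0 \<le> mollified_kernel \<gamma> \<epsilon> z" for z by (rule mollified_kernel_nonneg)
    show "mollified_kernel \<gamma> \<epsilon> \<in> borel_measurable borel"
      unfolding mollified_kernel_def[abs_def] by measurable
  qed
qed

lemma brownian: "brownian \<kappa> x (P x) W"
  by (intro brownian.intro motion \<kappa>_pos)

lemma random_path: "random_path (P x) W t"
proof -
  interpret brownian \<kappa> x "P x" W by (rule brownian)
  show ?thesis by standard (use t_pos W_measurable W_continuous in auto)
qed

lemma field_and_path: "\<epsilon> > 0 \<Longrightarrow> field_and_path M (X \<epsilon>) (mollified_kernel \<gamma> \<epsilon>) (P x) W t"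
  by (intro field_and_path.intro gaussian_field random_path)

definition u :: "real \<Rightarrow> real ^ 'n \<Rightarrow> 'a \<Rightarrow> real" where
  "u \<epsilon> x w = feynman_kac P W (\<lambda>y. X \<epsilon> y w) t x"

lemma u_eq: "\<epsilon> > 0 \<Longrightarrow> u \<epsilon> x = field_and_path.u (X \<epsilon>) (P x) W t"
  by (simp add: fun_eq_iff u_def feynman_kac_def field_and_path.u_def[OF field_and_path])

abbreviation k :: "real \<Rightarrow> real ^ 'n \<Rightarrow> real" where "k \<equiv> mollified_kernel \<gamma>"

abbreviation c :: real where "c \<equiv> k 1 0"

abbreviation moment :: "real \<Rightarrow> real ^ 'n \<Rightarrow> real \<Rightarrow> real" where
  "moment \<epsilon> x p \<equiv> (LINT w|M. u \<epsilon> x w powr p)"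

abbreviation A :: "real \<Rightarrow> real" where "A \<epsilon> \<equiv> \<epsilon> powr (- \<omega>)"

lemma kernel_0: "\<epsilon> > 0 \<Longrightarrow> k \<epsilon> 0 = A \<epsilon> * c"
  using mollified_kernel_scaling[OF kernel, of \<epsilon> 0] by simp

lemma c_nonneg: "0 \<le> c" by (rule mollified_kernel_nonneg)

abbreviation lyap :: "real \<Rightarrow> real" where "lyap p \<equiv> p\<^sup>2 * t\<^sup>2 * c / 2"

text \<open>Continuity of the unscaled covariance function at the origin, transported to scale \<open>\<epsilon>\<close>.\<close>

lemma kernel_near_0:
  assumes "\<eta> > 0"
  obtains \<delta> where "\<delta> > 0"
    "\<And>\<epsilon> z. \<epsilon> > 0 \<Longrightarrow> norm z < \<delta> * \<epsilon> \<Longrightarrow> k \<epsilon> 0 - k \<epsilon> z \<le> A \<epsilon> * \<eta>"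
proof -
  obtain \<delta> where \<delta>: "\<delta> > 0" "\<And>z. norm z < \<delta> \<Longrightarrow> \<bar>k 1 z - c\<bar> < \<eta>"
    using isCont_mollified_kernel_0[OF kernel] assms
    unfolding continuous_at_eps_delta by (auto simp: dist_norm)
  show ?thesis
  proof (rule that[OF \<delta>(1)])
    fix \<epsilon> :: real and z :: "real ^ 'n" assume e: "\<epsilon> > 0" and z: "norm z < \<delta> * \<epsilon>"
    define y where "y = (1 / \<epsilon>) *\<^sub>R z"
    have y: "norm y < \<delta>" "z = \<epsilon> *\<^sub>R y" using e z by (auto simp: y_def pos_divide_less_eq)
    have "k \<epsilon> 0 - k \<epsilon> z = A \<epsilon> * (c - k 1 y)"
      unfolding y(2) kernel_0[OF e] mollified_kernel_scaling[OF kernel e] by (simp add: right_diff_distrib)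
    also have "\<dots> \<le> A \<epsilon> * \<eta>"
      using \<delta>(2)[OF y(1)] by (intro mult_left_mono) auto
    finally show "k \<epsilon> 0 - k \<epsilon> z \<le> A \<epsilon> * \<eta>" .
  qed
qed

lemma u_measurable: "\<epsilon> > 0 \<Longrightarrow> u \<epsilon> x \<in> borel_measurable M"
  unfolding u_eq by (rule field_and_path.u_measurable[OF field_and_path])

lemma moment_of_nn_bound:
  assumes e: "\<epsilon> > 0" and le: "(\<integral>\<^sup>+w. ennreal (u \<epsilon> x w powr p) \<partial>M) \<le> ennreal B" and B: "0 \<le> B"
  shows "integrable M (\<lambda>w. u \<epsilon> x w powr p)" and "moment \<epsilon> x p \<le> B"
    and "0 < moment \<epsilon> x p"
proof -
  interpret fp: field_and_path M "X \<epsilon>" "k \<epsilon>" "P x" W t by (rule field_and_path[OF e])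
  note u_measurable[OF e, measurable]
  show i: "integrable M (\<lambda>w. u \<epsilon> x w powr p)"
    using le_less_trans[OF le] by (intro integrableI_bounded) auto
  show "moment \<epsilon> x p \<le> B"
    using le B by (subst (asm) nn_integral_eq_integral[OF i]) auto
  have "AE w in M. 0 < u \<epsilon> x w powr p"
    using fp.AE_u_pos by eventually_elim (simp add: u_eq[OF e])
  then show "0 < moment \<epsilon> x p"
    using fp.F.integral_less_AE_space[of "\<lambda>_. 0" "\<lambda>w. u \<epsilon> x w powr p"] i fp.F.emeasure_space_1 by simp
qed

lemma moment_upper_ge1:
  assumes p: "p \<ge> 1" and e: "\<epsilon> > 0"
  shows "integrable M (\<lambda>w. u \<epsilon> x w powr p)" and "0 < moment \<epsilon> x p"
    and "ln (moment \<epsilon> x p) / A \<epsilon> \<le> lyap p"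
proof -
  interpret fp: field_and_path M "X \<epsilon>" "k \<epsilon>" "P x" W t by (rule field_and_path[OF e])
  have "(\<integral>\<^sup>+w. ennreal (u \<epsilon> x w powr p) \<partial>M) \<le> ennreal (exp (p\<^sup>2 * t\<^sup>2 / 2 * (A \<epsilon> * c)))"
    using fp.moment_le_ge1[OF p] unfolding u_eq[OF e] kernel_0[OF e] .
  note m = moment_of_nn_bound[OF e this]
  show "integrable M (\<lambda>w. u \<epsilon> x w powr p)" "0 < moment \<epsilon> x p" using m by auto
  have "ln (moment \<epsilon> x p) \<le> ln (exp (p\<^sup>2 * t\<^sup>2 / 2 * (A \<epsilon> * c)))"
    using m by (intro ln_mono) auto
  then show "ln (moment \<epsilon> x p) / A \<epsilon> \<le> lyap p"
    using e by (simp add: pos_divide_le_eq mult_ac)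
qed

text \<open>The lattice has mesh \<open>\<delta> \<epsilon>\<close> for a fixed small \<open>\<delta>\<close>: the covariance drops by at most
\<open>\<epsilon>\<^sup>-\<^sup>\<omega> \<eta>\<close> within a cube, and the weight of a cube is a power of \<open>\<epsilon>\<close>, whose logarithm is
negligible against \<open>\<epsilon>\<^sup>-\<^sup>\<omega>\<close>.\<close>

lemma moment_upper_lt1:
  assumes p: "0 < p" "p < 1" and e: "e > 0"
  shows "\<forall>\<^sub>F \<epsilon> in at_right 0. integrable M (\<lambda>w. u \<epsilon> x w powr p) \<and> 0 < moment \<epsilon> x p \<and>
    ln (moment \<epsilon> x p) / A \<epsilon> \<le> lyap p + e"
proof -
  interpret bm: brownian \<kappa> x "P x" W by (rule brownian)
  let ?d = "real CARD('n)"
  define \<eta> where "\<eta> = e / (2 * (1 - p) * t\<^sup>2)"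
  have \<eta>: "\<eta> > 0" "(1 - p) * t\<^sup>2 * \<eta> = e / 2" using p e t_pos by (auto simp: \<eta>_def field_simps)
  obtain \<delta>0 where \<delta>0: "\<delta>0 > 0" "\<And>\<epsilon> z. \<epsilon> > 0 \<Longrightarrow> norm z < \<delta>0 * \<epsilon> \<Longrightarrow> k \<epsilon> 0 - k \<epsilon> z \<le> A \<epsilon> * \<eta>"
    using kernel_near_0[OF \<eta>(1)] by blast
  define \<delta> where "\<delta> = \<delta>0 / (2 * ?d)"
  have \<delta>: "\<delta> > 0" "?d * \<delta> = \<delta>0 / 2" using \<delta>0 by (auto simp: \<delta>_def)
  define q where "q = (1 - p) / p"
  have q: "q > 0" using p by (simp add: q_def)
  have q_eq: "- (1 - p) / p = - q" unfolding q_def by (rule minus_divide_left[symmetric])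
  \<comment> \<open>wide enough for the Gaussian moments of the Brownian motion up to time \<open>t\<close>\<close>
  define L where "L = sqrt (16 * \<kappa> * t * q)"
  have L: "L > 0" "L\<^sup>2 = 16 * \<kappa> * t * q" using q \<kappa>_pos t_pos by (auto simp: L_def)
  have cL: "(1 - p) / (p * L\<^sup>2) = 1 / (16 * \<kappa> * t)"
    using p \<kappa>_pos t_pos by (simp add: L(2) q_def)
  define E where "E = exp (2 * (1 / (16 * \<kappa> * t)) * (norm x)\<^sup>2) * 2 powr (?d / 2)"
  have E: "E > 0" by (simp add: E_def)
  define c1 where "c1 = \<delta> ^ CARD('n) * ((2 * pi * L\<^sup>2) powr (- ?d / 2) * exp (- (?d * \<delta>)\<^sup>2 / L\<^sup>2))"
  have c1: "c1 > 0" using \<delta> L(1) by (simp add: c1_def)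
  define B where "B = c1 powr (- q) * E"
  define s where "s = ?d * q"
  have Bs: "B > 0" "s > 0" using c1 E q by (auto simp: B_def s_def)
  have bound: "integrable M (\<lambda>w. u \<epsilon> x w powr p) \<and> 0 < moment \<epsilon> x p \<and>
    ln (moment \<epsilon> x p) / A \<epsilon> \<le> lyap p + e / 2 + \<epsilon> powr \<omega> * ln (1 + B * \<epsilon> powr (- s))"
    if \<epsilon>: "0 < \<epsilon>" "\<epsilon> < 1" for \<epsilon>
  proof -
    interpret fp: field_and_path M "X \<epsilon>" "k \<epsilon>" "P x" W t by (rule field_and_path[OF \<epsilon>(1)])
    define h where "h = \<delta> * \<epsilon>"
    have h: "h > 0" "h \<le> \<delta>" using \<delta> \<epsilon> by (auto simp: h_def)
    let ?C = "h ^ CARD('n) * ((2 * pi * L\<^sup>2) powr (- ?d / 2) * exp (- (?d * h)\<^sup>2 / L\<^sup>2))"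
    have "c1 * \<epsilon> ^ CARD('n) \<le> ?C"
    proof -
      have "(?d * h)\<^sup>2 \<le> (?d * \<delta>)\<^sup>2" using h by (intro power_mono mult_left_mono) auto
      then have "exp (- (?d * \<delta>)\<^sup>2 / L\<^sup>2) \<le> exp (- (?d * h)\<^sup>2 / L\<^sup>2)" by (simp add: divide_right_mono)
      then have "h ^ CARD('n) * ((2 * pi * L\<^sup>2) powr (- ?d / 2) * exp (- (?d * \<delta>)\<^sup>2 / L\<^sup>2)) \<le> ?C"
        using h by (intro mult_left_mono) auto
      then show ?thesis by (simp add: c1_def h_def power_mult_distrib mult_ac)
    qed
    then have "?C powr (- q) \<le> (c1 * \<epsilon> ^ CARD('n)) powr (- q)"
      using c1 \<epsilon> q by (intro powr_mono2') auto
    also have "\<dots> = c1 powr (- q) * \<epsilon> powr (- s)"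
      unfolding powr_realpow[OF \<epsilon>(1), symmetric] using c1 \<epsilon> by (simp add: powr_mult powr_powr s_def)
    finally have C: "?C powr (- q) \<le> c1 powr (- q) * \<epsilon> powr (- s)" .
    have occ: "(\<integral>\<^sup>+y. ennreal (exp (1 / (16 * \<kappa> * t) * (norm y)\<^sup>2)) \<partial>fp.R.occ) \<le> ennreal E"
    proof (rule fp.R.nn_integral_occ_le)
      show "(\<integral>\<^sup>+b. ennreal (exp (1 / (16 * \<kappa> * t) * (norm (W s b))\<^sup>2)) \<partial>P x) \<le> ennreal E" if "0 \<le> s" "s \<le> t" for s
        unfolding E_def using \<kappa>_pos t_pos by (intro bm.exp_moment[OF that]) auto
    qed measurable
    let ?b = "exp (p\<^sup>2 * t\<^sup>2 / 2 * (A \<epsilon> * c) + (1 - p) * t\<^sup>2 * (A \<epsilon> * \<eta>))"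
    have near: "k \<epsilon> 0 - k \<epsilon> z \<le> A \<epsilon> * \<eta>" if "norm z \<le> ?d * h" for z
    proof -
      have "?d * h = \<delta>0 / 2 * \<epsilon>" using \<delta>(2) by (simp add: h_def mult.assoc[symmetric])
      then have "norm z < \<delta>0 * \<epsilon>" using that \<delta>0(1) \<epsilon> by (smt (verit) field_sum_of_halves mult_strict_right_mono)
      then show ?thesis by (rule \<delta>0(2)[OF \<epsilon>(1)])
    qed
    have "(\<integral>\<^sup>+w. ennreal (u \<epsilon> x w powr p) \<partial>M) \<le> ennreal ?b * (1 + ennreal (?C powr (- q)) *
        (\<integral>\<^sup>+y. ennreal (exp (1 / (16 * \<kappa> * t) * (norm y)\<^sup>2)) \<partial>fp.R.occ))"
      using fp.moment_le_lt1[OF p h(1) L(1) _ near] \<eta> unfolding u_eq[OF \<epsilon>(1)] kernel_0[OF \<epsilon>(1)] q_eq cL by simp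
    also have "\<dots> \<le> ennreal ?b * (1 + ennreal (c1 powr (- q) * \<epsilon> powr (- s)) * ennreal E)"
      using C occ by (intro mult_left_mono add_left_mono mult_mono ennreal_leI) auto
    also have "\<dots> = ennreal (?b * (1 + B * \<epsilon> powr (- s)))"
      using Bs E by (simp add: B_def ennreal_mult[symmetric] ennreal_plus[symmetric] ennreal_1[symmetric] mult_ac del: ennreal_plus ennreal_1)
    finally have le: "(\<integral>\<^sup>+w. ennreal (u \<epsilon> x w powr p) \<partial>M) \<le> ennreal (?b * (1 + B * \<epsilon> powr (- s)))" .
    have pos: "0 < 1 + B * \<epsilon> powr (- s)" using Bs by (simp add: add_pos_nonneg)
    note m = moment_of_nn_bound[OF \<epsilon>(1) le]
    have "ln (moment \<epsilon> x p) \<le> ln (?b * (1 + B * \<epsilon> powr (- s)))"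
      using m pos by (intro ln_mono) auto
    also have "\<dots> = p\<^sup>2 * t\<^sup>2 / 2 * (A \<epsilon> * c) + A \<epsilon> * (e / 2) + ln (1 + B * \<epsilon> powr (- s))"
      using pos \<eta>(2) by (subst ln_mult) (auto simp: mult.left_commute)
    finally have "ln (moment \<epsilon> x p) / A \<epsilon> \<le>
      (p\<^sup>2 * t\<^sup>2 / 2 * (A \<epsilon> * c) + A \<epsilon> * (e / 2) + ln (1 + B * \<epsilon> powr (- s))) / A \<epsilon>"
      by (rule divide_right_mono) simp
    also have "\<dots> = lyap p + e / 2 + \<epsilon> powr \<omega> * ln (1 + B * \<epsilon> powr (- s))"
    proof -
      have "p\<^sup>2 * t\<^sup>2 / 2 * (A \<epsilon> * c) / A \<epsilon> = lyap p" "A \<epsilon> * (e / 2) / A \<epsilon> = e / 2"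
        using \<epsilon> by simp_all
      moreover have "y / A \<epsilon> = \<epsilon> powr \<omega> * y" for y
        by (simp add: powr_minus_divide)
      ultimately show ?thesis
        unfolding add_divide_distrib by metis
    qed
    finally show ?thesis using m pos by auto
  qed
  have "((\<lambda>\<epsilon>. \<epsilon> powr \<omega> * ln (1 + B * \<epsilon> powr (- s))) \<longlongrightarrow> 0) (at_right 0)"
    using \<omega>_gt Bs by real_asymp
  then have "\<forall>\<^sub>F \<epsilon> in at_right 0. \<epsilon> powr \<omega> * ln (1 + B * \<epsilon> powr (- s)) < e / 2"
    using e by (intro order_tendstoD(2)) auto
  moreover have "\<forall>\<^sub>F \<epsilon> in at_right 0. \<epsilon> \<in> {0<..<1::real}"
    by (rule eventually_at_right_real) simp
  ultimately show ?thesis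
  proof eventually_elim
    case (elim \<epsilon>)
    then show ?case using bound[of \<epsilon>] by auto
  qed
qed

lemma moment_upper:
  assumes "p > 0" "e > 0"
  shows "\<forall>\<^sub>F \<epsilon> in at_right 0. integrable M (\<lambda>w. u \<epsilon> x w powr p) \<and> 0 < moment \<epsilon> x p \<and>
    ln (moment \<epsilon> x p) / A \<epsilon> \<le> lyap p + e"
proof (cases "p < 1")
  case True
  then show ?thesis using assms by (intro moment_upper_lt1) auto
next
  case False
  show ?thesis
    using eventually_at_right_less[of 0]
  proof eventually_elim
    case (elim \<epsilon>)
    have "p \<ge> 1" using False by simp
    note b = moment_upper_ge1[OF this elim, of x]
    from b(3) \<open>e > 0\<close> have "ln (moment \<epsilon> x p) / A \<epsilon> \<le> lyap p + e"
      by linarith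
    with b show ?case by blast
  qed
qed

text \<open>The first summand is the cost \<open>p N ln q\<close> of the confinement to the radius \<open>2 \<delta> \<epsilon>\<close>, with
\<open>q \<ge> c2 \<epsilon> powr s\<close>. The term with \<open>\<eta>\<close> is the drop of the covariance inside this radius, and the last
one bounds the contribution of excursions to the outside, where the covariance may drop to \<open>0\<close>.\<close>

lemma moment_lower_explicit:
  fixes N :: nat
  assumes p: "p > 0" and \<eta>: "\<eta> > 0" and \<epsilon>: "0 < \<epsilon>" "\<epsilon> < 1" and \<delta>: "0 < \<delta>" "\<delta> \<le> 1"
    and near: "\<And>z. norm z \<le> 2 * \<delta> * \<epsilon> \<Longrightarrow> k \<epsilon> 0 - k \<epsilon> z \<le> A \<epsilon> * \<eta>"
    and N: "\<epsilon> powr (- \<theta>) \<le> real N" "real N \<le> 2 * \<epsilon> powr (- \<theta>)" and \<theta>: "\<theta> > 0"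
    and int: "integrable M (\<lambda>w. u \<epsilon> x w powr p)"
  defines "c2 \<equiv> (2 * pi * (2 * \<kappa> * t)) powr (- real CARD('n) / 2) * exp (- 1 / (4 * \<kappa> * t)) * (\<delta> / real CARD('n)) ^ CARD('n)"
    and "s \<equiv> (1 + \<theta>) * real CARD('n)"
  shows "p * (2 * \<epsilon> powr (\<omega> - \<theta>) * ln (c2 * \<epsilon> powr s)) + p\<^sup>2 * t\<^sup>2 * (c / 2 - (\<eta> +
      c * (2 powr (real CARD('n) / 2) * (exp (- (\<delta>\<^sup>2 / (8 * \<kappa> * t)) * \<epsilon> powr (- (\<theta> - 2))) / (c2 * \<epsilon> powr s)))))
    \<le> ln (moment \<epsilon> x p) / A \<epsilon>"
proof -
  interpret bm: brownian \<kappa> x "P x" W by (rule brownian)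
  interpret fp: field_and_path M "X \<epsilon>" "k \<epsilon>" "P x" W t by (rule field_and_path[OF \<epsilon>(1)])
  let ?d = "real CARD('n)"
    have N1: "1 \<le> real N"
  proof -
    have "1 \<le> \<epsilon> powr (- \<theta>)" using \<epsilon> \<theta> by (simp add: powr_minus one_le_inverse_iff powr_le1)
    then show ?thesis using N by simp
  qed
  then have N0: "N > 0" by simp
  define r where "r = \<delta> * \<epsilon> / N"
  define \<rho> where "\<rho> = \<delta> * \<epsilon>"
  have r\<rho>: "r > 0" "\<rho> > 0" "N * r + \<rho> = 2 * \<delta> * \<epsilon>" using \<delta> \<epsilon> N0 by (auto simp: r_def \<rho>_def)
  define q where "q = (2 * pi * (2 * \<kappa> * (t / N))) powr (- ?d / 2) * exp (- r\<^sup>2 / (2 * (2 * \<kappa> * (t / N)))) * (2 * r / ?d) ^ CARD('n)"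
  have c2: "c2 > 0" unfolding c2_def using \<delta> \<kappa>_pos t_pos by simp
  have q0: "c2 * \<epsilon> powr s \<le> q"
  proof -
    have 1: "(2 * pi * (2 * \<kappa> * t)) powr (- ?d / 2) \<le> (2 * pi * (2 * \<kappa> * (t / N))) powr (- ?d / 2)"
      using \<kappa>_pos t_pos N1 by (intro powr_mono2' mult_left_mono) (auto simp: pos_divide_le_eq)
    have 2: "exp (- 1 / (4 * \<kappa> * t)) \<le> exp (- r\<^sup>2 / (2 * (2 * \<kappa> * (t / N))))"
    proof -
      have "(\<delta> * \<epsilon>)\<^sup>2 \<le> 1" using \<delta> \<epsilon> by (intro power_le_one) (auto intro: mult_le_one)
      then have "(\<delta> * \<epsilon>)\<^sup>2 / N \<le> 1" using N1 by (simp add: pos_divide_le_eq)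
      then have "(\<delta> * \<epsilon>)\<^sup>2 / N / (4 * \<kappa> * t) \<le> 1 / (4 * \<kappa> * t)"
        using \<kappa>_pos t_pos by (intro divide_right_mono) auto
      moreover have "r\<^sup>2 / (2 * (2 * \<kappa> * (t / N))) = (\<delta> * \<epsilon>)\<^sup>2 / N / (4 * \<kappa> * t)"
        using N0 \<kappa>_pos t_pos by (simp add: r_def power_divide field_simps power2_eq_square)
      ultimately show ?thesis by simp
    qed
    have 3: "(\<delta> / ?d) ^ CARD('n) * \<epsilon> powr s \<le> (2 * r / ?d) ^ CARD('n)"
    proof -
      have "\<epsilon> powr (1 + \<theta>) * N \<le> \<epsilon> powr (1 + \<theta>) * (2 * \<epsilon> powr (- \<theta>))"
        using N by (intro mult_left_mono) auto
      also have "\<dots> = 2 * \<epsilon>" using \<epsilon> by (simp add: powr_add[symmetric] mult.left_commute)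
      finally have "\<epsilon> powr (1 + \<theta>) \<le> 2 * \<epsilon> / N" using N0 by (simp add: pos_le_divide_eq)
      then have "\<delta> / ?d * \<epsilon> powr (1 + \<theta>) \<le> \<delta> / ?d * (2 * \<epsilon> / N)"
        using \<delta> by (intro mult_left_mono) auto
      then have "(\<delta> / ?d * \<epsilon> powr (1 + \<theta>)) ^ CARD('n) \<le> (2 * r / ?d) ^ CARD('n)"
        using \<delta> by (intro power_mono) (auto simp: r_def mult_ac)
      moreover have "(\<epsilon> powr (1 + \<theta>)) ^ CARD('n) = \<epsilon> powr s"
        using \<epsilon> by (simp add: s_def powr_power mult.commute)
      ultimately show ?thesis by (simp only: power_mult_distrib)
    qed
    have "c2 * \<epsilon> powr s = (2 * pi * (2 * \<kappa> * t)) powr (- ?d / 2) * exp (- 1 / (4 * \<kappa> * t)) * ((\<delta> / ?d) ^ CARD('n) * \<epsilon> powr s)"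
      by (simp add: c2_def mult_ac)
    also have "\<dots> \<le> q"
      unfolding q_def using \<delta> by (intro mult_mono 1 2 3) auto
    finally show ?thesis .
  qed
  have q0_pos: "0 < c2 * \<epsilon> powr s" using c2 \<epsilon> by simp
  obtain C where C [measurable]: "C \<in> sets (P x)" and qC: "q ^ N \<le> measure (P x) C" and C_pos: "0 < measure (P x) C"
    and far: "\<And>s. 0 \<le> s \<Longrightarrow> s \<le> t \<Longrightarrow> measure (P x) ({b \<in> space (P x). N * r + \<rho> < norm (W s b - x)} \<inter> C) \<le>
       2 powr (?d / 2) * exp (- \<rho>\<^sup>2 / (8 * \<kappa> * (t / N))) / q * measure (P x) C"
    using that by (rule bm.confinement[OF t_pos N0 r\<rho>(1,2), folded q_def])
  define R where "R = 2 powr (?d / 2) * (exp (- (\<delta>\<^sup>2 / (8 * \<kappa> * t)) * \<epsilon> powr (- (\<theta> - 2))) / (c2 * \<epsilon> powr s))"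
  let ?low = "p\<^sup>2 * t\<^sup>2 * (k \<epsilon> 0 / 2 - A \<epsilon> * (\<eta> + c * R))"
  let ?cost = "p * (2 * \<epsilon> powr (- \<theta>) * ln (c2 * \<epsilon> powr s))"
  have R: "0 \<le> R" using q0_pos by (simp add: R_def)
  have farR: "measure (P x) ({b \<in> space (P x). 2 * \<delta> * \<epsilon> < norm (W s b - x)} \<inter> C) \<le> R * measure (P x) C" if "0 \<le> s" "s \<le> t" for s
  proof -
    have "\<epsilon> powr (- (\<theta> - 2)) = \<epsilon>\<^sup>2 * \<epsilon> powr (- \<theta>)"
      using \<epsilon> by (simp add: powr_diff powr_minus divide_inverse powr_numeral)
    also have "\<dots> \<le> \<epsilon>\<^sup>2 * N" using N by (intro mult_left_mono) auto
    finally have "\<delta>\<^sup>2 / (8 * \<kappa> * t) * \<epsilon> powr (- (\<theta> - 2)) \<le> \<delta>\<^sup>2 / (8 * \<kappa> * t) * (\<epsilon>\<^sup>2 * N)"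
      using \<kappa>_pos t_pos by (intro mult_left_mono) auto
    also have "\<dots> = \<rho>\<^sup>2 / (8 * \<kappa> * (t / N))" by (simp add: \<rho>_def power_mult_distrib)
    finally have "exp (- \<rho>\<^sup>2 / (8 * \<kappa> * (t / N))) \<le> exp (- (\<delta>\<^sup>2 / (8 * \<kappa> * t)) * \<epsilon> powr (- (\<theta> - 2)))" by simp
    then have "2 powr (?d / 2) * exp (- \<rho>\<^sup>2 / (8 * \<kappa> * (t / N))) / q \<le> R"
      unfolding R_def times_divide_eq_right using q0 q0_pos by (intro frac_le mult_left_mono) auto
    from mult_right_mono[OF this, of "measure (P x) C"] far[OF that] show ?thesis
      unfolding r\<rho>(3) by simp
  qed
  interpret Q: random_path "cond_law (P x) C" W t by (rule fp.R.random_path_cond_law[OF C C_pos])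
  have \<kappa>b: "(\<integral>\<^sup>+y. ennreal (k \<epsilon> 0 - k \<epsilon> (x - y)) \<partial>Q.occ) \<le> ennreal (A \<epsilon> * (\<eta> + c * R))"
  proof (rule Q.nn_integral_occ_le)
    fix s assume s: "0 \<le> s" "s \<le> t"
    have [measurable]: "W s \<in> borel_measurable (P x)" by (rule bm.W_measurable[OF s(1)])
    note fp.F.k_measurable[measurable]
    let ?F = "{b \<in> space (P x). 2 * \<delta> * \<epsilon> < norm (W s b - x)}"
    have "(\<integral>\<^sup>+b. ennreal (k \<epsilon> 0 - k \<epsilon> (x - W s b)) \<partial>cond_law (P x) C) =
        ennreal (1 / measure (P x) C) * (\<integral>\<^sup>+b. ennreal (k \<epsilon> 0 - k \<epsilon> (x - W s b)) * indicator C b \<partial>P x)"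
      by (rule nn_integral_cond_law[OF C _ C_pos]) measurable
    also have "\<dots> \<le> ennreal (1 / measure (P x) C) *
       (\<integral>\<^sup>+b. ennreal (A \<epsilon> * \<eta>) * indicator C b + ennreal (A \<epsilon> * c) * indicator (?F \<inter> C) b \<partial>P x)"
    proof (intro mult_left_mono nn_integral_mono)
      fix b assume b: "b \<in> space (P x)"
      show "ennreal (k \<epsilon> 0 - k \<epsilon> (x - W s b)) * indicator C b \<le>
        ennreal (A \<epsilon> * \<eta>) * indicator C b + ennreal (A \<epsilon> * c) * indicator (?F \<inter> C) b"
      proof (cases "2 * \<delta> * \<epsilon> < norm (W s b - x)")
        case True
        have "k \<epsilon> 0 - k \<epsilon> (x - W s b) \<le> A \<epsilon> * c"
          using mollified_kernel_nonneg[of \<gamma> \<epsilon> "x - W s b"] kernel_0[OF \<epsilon>(1)] by simp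
        then show ?thesis
          using True b by (auto intro!: add_increasing ennreal_leI split: split_indicator)
      next
        case False
        then have "k \<epsilon> 0 - k \<epsilon> (x - W s b) \<le> A \<epsilon> * \<eta>"
          by (intro near) (simp add: norm_minus_commute)
        then show ?thesis
          using False by (auto intro!: ennreal_leI split: split_indicator)
      qed
    qed simp
    also have "(\<integral>\<^sup>+b. ennreal (A \<epsilon> * \<eta>) * indicator C b + ennreal (A \<epsilon> * c) * indicator (?F \<inter> C) b \<partial>P x)
        = ennreal (A \<epsilon> * \<eta> * measure (P x) C + A \<epsilon> * c * measure (P x) (?F \<inter> C))"
      using \<eta> c_nonneg
      by (subst nn_integral_add)
         (auto simp: nn_integral_cmult_indicator bm.emeasure_eq_measure ennreal_mult[symmetric] ennreal_plus[symmetric] simp del: ennreal_plus)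
    also have "ennreal (1 / measure (P x) C) * \<dots> \<le> ennreal (1 / measure (P x) C) *
        ennreal (A \<epsilon> * \<eta> * measure (P x) C + A \<epsilon> * c * (R * measure (P x) C))"
      using farR[OF s] c_nonneg by (intro mult_left_mono ennreal_leI add_left_mono) auto
    also have "\<dots> = ennreal (A \<epsilon> * (\<eta> + c * R))"
    proof -
      let ?Y = "A \<epsilon> * \<eta> * measure (P x) C + A \<epsilon> * c * (R * measure (P x) C)"
      have "ennreal (1 / measure (P x) C) * ennreal ?Y = ennreal (1 / measure (P x) C * ?Y)"
        by (rule ennreal_mult[symmetric]) (use \<eta> c_nonneg R in auto)
      moreover have "1 / measure (P x) C * ?Y = A \<epsilon> * (\<eta> + c * R)"
        using C_pos by (simp add: field_simps)
      ultimately show ?thesis by (simp only:)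
    qed
    finally show "(\<integral>\<^sup>+b. ennreal (k \<epsilon> 0 - k \<epsilon> (x - W s b)) \<partial>cond_law (P x) C) \<le> ennreal (A \<epsilon> * (\<eta> + c * R))" .
  next
    note fp.F.k_measurable[measurable]
    show "(\<lambda>y. ennreal (k \<epsilon> 0 - k \<epsilon> (x - y))) \<in> borel_measurable borel" by measurable
  qed
  have "measure (P x) C powr p * exp ?low \<le> moment \<epsilon> x p"
    unfolding u_eq[OF \<epsilon>(1)]
    by (rule fp.moment_ge[OF C C_pos p \<kappa>b]) (use \<eta> c_nonneg R int in \<open>auto simp: u_eq[OF \<epsilon>(1)]\<close>)
  then have "ln (measure (P x) C powr p * exp ?low) \<le> ln (moment \<epsilon> x p)"
    using C_pos by (intro ln_mono) auto
  also have "ln (measure (P x) C powr p * exp ?low) =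
      p * ln (measure (P x) C) + ?low"
    using C_pos by (simp add: ln_mult ln_powr)
  finally have low: "p * ln (measure (P x) C) + ?low \<le> ln (moment \<epsilon> x p)" .
  have "2 * \<epsilon> powr (- \<theta>) * ln (c2 * \<epsilon> powr s) \<le> N * ln (c2 * \<epsilon> powr s)"
  proof (rule mult_right_mono_neg[OF N(2)])
    have "q \<le> 1"
    proof (rule ccontr)
      assume "\<not> q \<le> 1"
      then have "1 < q ^ N" using N0 by (intro one_less_power) auto
      then show False using qC bm.prob_le_1[of C] by simp
    qed
    then show "ln (c2 * \<epsilon> powr s) \<le> 0" using q0 q0_pos by (simp add: ln_le_zero_iff)
  qed
  also have "\<dots> \<le> N * ln q" using q0 q0_pos by (intro mult_left_mono ln_mono) auto
  also have "\<dots> = ln (q ^ N)" using q0 q0_pos by (simp add: ln_realpow)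
  also have "\<dots> \<le> ln (measure (P x) C)" using qC q0 q0_pos by (intro ln_mono zero_less_power) auto
  finally have "?cost \<le> p * ln (measure (P x) C)"
    using p by (intro mult_left_mono) auto
  with low have "?cost + ?low \<le> ln (moment \<epsilon> x p)"
    by simp
  then have "(?cost + ?low) / A \<epsilon> \<le> ln (moment \<epsilon> x p) / A \<epsilon>"
    by (rule divide_right_mono) simp
  moreover have "(?cost + ?low) / A \<epsilon> =
     p * (2 * \<epsilon> powr (\<omega> - \<theta>) * ln (c2 * \<epsilon> powr s)) + p\<^sup>2 * t\<^sup>2 * (c / 2 - (\<eta> + c * R))"
  proof -
    have "\<epsilon> powr (\<omega> - \<theta>) = \<epsilon> powr (- \<theta>) / A \<epsilon>" by (simp flip: powr_diff)
    moreover have "(k \<epsilon> 0 / 2 - A \<epsilon> * (\<eta> + c * R)) / A \<epsilon> = c / 2 - (\<eta> + c * R)"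
    proof -
      have "k \<epsilon> 0 / 2 - A \<epsilon> * (\<eta> + c * R) = A \<epsilon> * (c / 2 - (\<eta> + c * R))"
        unfolding kernel_0[OF \<epsilon>(1)] by (simp only: right_diff_distrib times_divide_eq_right)
      then show ?thesis using \<epsilon> by simp
    qed
    moreover have "(p * (2 * y * l) + b * z) / a = p * (2 * (y / a) * l) + b * (z / a)" for y l b z a :: real
      by (simp add: add_divide_distrib)
    ultimately show ?thesis by (simp only:)
  qed
  ultimately show ?thesis unfolding R_def by simp
qed

text \<open>The choice \<open>\<theta> = (\<omega> + 2) / 2\<close> lies strictly between \<open>2\<close> and \<open>\<omega>\<close>, so that both error terms of the
explicit bound vanish: the cost of the confinement is \<open>\<epsilon> powr (\<omega> - \<theta>)\<close> up to a logarithm, and the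
probability of an excursion is exponentially small in \<open>\<epsilon> powr (2 - \<theta>)\<close>.\<close>

lemma moment_lower:
  assumes p: "p > 0" and e: "e > 0"
  shows "\<forall>\<^sub>F \<epsilon> in at_right 0. lyap p - e \<le> ln (moment \<epsilon> x p) / A \<epsilon>"
proof -
  define \<eta> where "\<eta> = e / (2 * p\<^sup>2 * t\<^sup>2)"
  have \<eta>: "\<eta> > 0" "p\<^sup>2 * t\<^sup>2 * \<eta> = e / 2" using p e t_pos by (auto simp: \<eta>_def)
  obtain \<delta>0 where \<delta>0: "\<delta>0 > 0" "\<And>\<epsilon> z. \<epsilon> > 0 \<Longrightarrow> norm z < \<delta>0 * \<epsilon> \<Longrightarrow> k \<epsilon> 0 - k \<epsilon> z \<le> A \<epsilon> * \<eta>"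
    using kernel_near_0[OF \<eta>(1)] by blast
  define \<delta> where "\<delta> = min 1 (\<delta>0 / 4)"
  have \<delta>: "0 < \<delta>" "\<delta> \<le> 1" "2 * \<delta> < \<delta>0" using \<delta>0 by (auto simp: \<delta>_def)
  define \<theta> where "\<theta> = (\<omega> + 2) / 2"
  have \<theta>: "2 < \<theta>" "\<theta> < \<omega>" using \<omega>_gt by (auto simp: \<theta>_def)
  define c2 where "c2 = (2 * pi * (2 * \<kappa> * t)) powr (- real CARD('n) / 2) * exp (- 1 / (4 * \<kappa> * t)) * (\<delta> / real CARD('n)) ^ CARD('n)"
  define s where "s = (1 + \<theta>) * real CARD('n)"
  define a where "a = \<delta>\<^sup>2 / (8 * \<kappa> * t)"
  have pos: "c2 > 0" "s > 0" "a > 0"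
    using \<delta> \<kappa>_pos t_pos \<theta> by (auto simp: c2_def s_def a_def)
  define err where "err \<epsilon> = p * (2 * \<epsilon> powr (\<omega> - \<theta>) * ln (c2 * \<epsilon> powr s)) - p\<^sup>2 * t\<^sup>2 *
      (c * (2 powr (real CARD('n) / 2) * (exp (- a * \<epsilon> powr (- (\<theta> - 2))) / (c2 * \<epsilon> powr s))))" for \<epsilon>
  have bound: "lyap p - e / 2 + err \<epsilon> \<le> ln (moment \<epsilon> x p) / A \<epsilon>"
    if \<epsilon>: "0 < \<epsilon>" "\<epsilon> < 1" and int: "integrable M (\<lambda>w. u \<epsilon> x w powr p)" for \<epsilon>
  proof -
    define N where "N = nat \<lceil>\<epsilon> powr (- \<theta>)\<rceil>"
    have "1 \<le> \<epsilon> powr (- \<theta>)" using \<epsilon> \<theta> by (simp add: powr_minus one_le_inverse_iff powr_le1)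
    then have N: "\<epsilon> powr (- \<theta>) \<le> real N" "real N \<le> 2 * \<epsilon> powr (- \<theta>)" unfolding N_def by linarith+
    have near: "k \<epsilon> 0 - k \<epsilon> z \<le> A \<epsilon> * \<eta>" if "norm z \<le> 2 * \<delta> * \<epsilon>" for z
    proof (rule \<delta>0(2)[OF \<epsilon>(1)])
      have "2 * \<delta> * \<epsilon> < \<delta>0 * \<epsilon>" using \<delta> \<epsilon> by (intro mult_strict_right_mono) auto
      then show "norm z < \<delta>0 * \<epsilon>" using that by simp
    qed
    have "0 < \<theta>" using \<theta> by simp
    from moment_lower_explicit[OF p \<eta>(1) \<epsilon> \<delta>(1,2) near N this int, folded c2_def s_def a_def]
    show ?thesis
      using \<eta>(2) by (simp add: err_def algebra_simps)
  qed
  have "((\<lambda>\<epsilon>. \<epsilon> powr (\<omega> - \<theta>) * ln (c2 * \<epsilon> powr s)) \<longlongrightarrow> 0) (at_right 0)"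
    using \<theta> pos by real_asymp
  moreover have "((\<lambda>\<epsilon>. exp (- a * \<epsilon> powr (- (\<theta> - 2))) / (c2 * \<epsilon> powr s)) \<longlongrightarrow> 0) (at_right 0)"
    using \<theta> pos by real_asymp
  ultimately have "((\<lambda>\<epsilon>. p * (2 * (\<epsilon> powr (\<omega> - \<theta>) * ln (c2 * \<epsilon> powr s))) - p\<^sup>2 * t\<^sup>2 *
      (c * (2 powr (real CARD('n) / 2) * (exp (- a * \<epsilon> powr (- (\<theta> - 2))) / (c2 * \<epsilon> powr s))))) \<longlongrightarrow>
      p * (2 * 0) - p\<^sup>2 * t\<^sup>2 * (c * (2 powr (real CARD('n) / 2) * 0))) (at_right 0)"
    by (intro tendsto_intros)
  then have "(err \<longlongrightarrow> 0) (at_right 0)"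
    unfolding err_def[abs_def] by (simp add: mult.assoc)
  then have "\<forall>\<^sub>F \<epsilon> in at_right 0. - (e / 2) < err \<epsilon>"
    using e by (intro order_tendstoD(1)) auto
  moreover have "\<forall>\<^sub>F \<epsilon> in at_right 0. \<epsilon> \<in> {0<..<1::real}"
    by (rule eventually_at_right_real) simp
  moreover note moment_upper[OF p zero_less_one, of x]
  ultimately show ?thesis
  proof eventually_elim
    case (elim \<epsilon>)
    then show ?case using bound[of \<epsilon>] by auto
  qed
qed

lemma lyapunov_exponent:
  assumes p: "p > 0"
  shows "has_lyapunov_exponent M (\<lambda>\<epsilon>. u \<epsilon> x) A (at_right 0) p (lyap p)"
  unfolding has_lyapunov_exponent_def
proof
  show "\<forall>\<^sub>F \<epsilon> in at_right 0. integrable M (\<lambda>w. u \<epsilon> x w powr p)"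
    using moment_upper[OF p zero_less_one, of x] by eventually_elim simp
  show "((\<lambda>\<epsilon>. ln (moment \<epsilon> x p) / A \<epsilon>) \<longlongrightarrow> lyap p) (at_right 0)"
  proof (rule tendstoI)
    fix e :: real assume "e > 0"
    then have e: "e / 2 > 0" by simp
    show "\<forall>\<^sub>F \<epsilon> in at_right 0. dist (ln (moment \<epsilon> x p) / A \<epsilon>) (lyap p) < e"
      using moment_upper[OF p e, of x] moment_lower[OF p e, of x]
    proof eventually_elim
      case (elim \<epsilon>)
      then show ?case using \<open>e > 0\<close> by (simp add: dist_real_def abs_less_iff)
    qed
  qed
qed

lemma intermittent: "intermittent M u A (at_right 0)"
  unfolding intermittent_def
proof (intro exI conjI)
  show "{0<..} \<subseteq> {0::real<..}" ..
  show "\<exists>p\<in>{0<..}. \<exists>q\<in>{0::real<..}. p \<noteq> q"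
    by (intro bexI[of _ 1] bexI[of _ 2]) auto
  show "\<forall>p\<in>{0<..}. \<forall>x. has_lyapunov_exponent M (\<lambda>\<epsilon>. u \<epsilon> x) A (at_right 0) p (lyap p)"
    using lyapunov_exponent by auto
  have l: "lyap p / p = p * (t\<^sup>2 * c / 2)" if "p > 0" for p
    using that by (simp add: power2_eq_square)
  have "0 < t\<^sup>2 * c / 2"
    using t_pos mollified_kernel_pos[OF kernel, of 1 0] by simp
  then show "strict_mono_on {0<..} (\<lambda>p. lyap p / p)"
    by (intro strict_mono_onI) (simp only: l greaterThan_iff mult_strict_right_mono)
qed

end

theorem theorem2p23:
  fixes \<kappa> \<sigma> t :: real
    and K :: "'n::finite noise"
    and M :: "'a measure"
    and \<xi> :: "(real ^ 'n \<Rightarrow> real) \<Rightarrow> 'a \<Rightarrow> real"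
    and \<xi>\<^sub>\<epsilon> :: "real \<Rightarrow> real ^ 'n \<Rightarrow> 'a \<Rightarrow> real"
    and P :: "real ^ 'n \<Rightarrow> 'b measure"
    and W :: "real \<Rightarrow> 'b \<Rightarrow> real ^ 'n"
  defines "\<gamma> \<equiv> noise_kernel \<sigma> K"
    and "u \<equiv> (\<lambda>\<epsilon> x w. feynman_kac P W (\<lambda>y. \<xi>\<^sub>\<epsilon> \<epsilon> y w) t x)"
    and "A \<equiv> (\<lambda>\<epsilon>. \<epsilon> powr (- scaling_exponent K))"
  assumes "\<kappa> > 0" and "\<sigma> > 0" and "admissible K"
    and "gaussian_noise M \<gamma> \<xi>"
    and "\<And>\<epsilon>. \<epsilon> > 0 \<Longrightarrow> mollified_noise M \<xi> \<epsilon> (\<xi>\<^sub>\<epsilon> \<epsilon>)"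
    and "\<And>x. brownian_motion \<kappa> x (P x) W"
    and "scaling_exponent K > 2"
    and "t > 0"
  shows "(\<forall>\<epsilon>>0. \<forall>x. AE w in M. integrable (P x) (\<lambda>b. exp (LINT s:{0..t}|lborel. \<xi>\<^sub>\<epsilon> \<epsilon> (W s b) w)))
    \<and> intermittent M u A (at_right 0)
    \<and> (\<forall>p>0. \<forall>x. has_lyapunov_exponent M (\<lambda>\<epsilon>. u \<epsilon> x) A (at_right 0) p
            (p\<^sup>2 * t\<^sup>2 * mollified_kernel \<gamma> 1 0 / 2))"
proof -
  interpret rescaled_noise \<kappa> t "scaling_exponent K" \<gamma> M \<xi> \<xi>\<^sub>\<epsilon> P W
    using assms homogeneous_noise_kernel by unfold_locales (auto simp: \<gamma>_def)
  have u: "u = rescaled_noise.u t \<xi>\<^sub>\<epsilon> P W"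
    by (simp add: fun_eq_iff u_def assms(2))
  show ?thesis
    using field_and_path.AE_integrable[OF field_and_path] intermittent lyapunov_exponent
    unfolding u A_def by auto
qed

end
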